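(* Let $k\ge1$, $d,n_1,\dots,n_k\ge1$, let $\mathcal{S}_w\subset\mathbb{R}^d$ and $\mathcal{S}_{v_\ell}\subset\mathbb{R}^{n_\ell}$ be compact convex sets, $\mathcal{S}_v:=\mathcal{S}_{v_1}\times\dots\times\mathcal{S}_{v_k}$ with elements $v=(v_1,\dots,v_k)$, and let $\psi:\mathcal{S}_w\times\mathcal{S}_v\to\mathbb{R}$ be continuous and convex-concave (convex in $w$ for each fixed $v$, concave in $v$ for each fixed $w$). Let $\alpha_\ell(w)=A_\ell w+a_\ell$ and $\beta_\ell(u)=B_\ell u+b_\ell$ be affine maps, with $A_\ell\in\mathbb{R}^{d\times d}$, $a_\ell\in\mathbb{R}^d$, $B_\ell\in\mathbb{R}^{n_\ell\times n_\ell}$, $b_\ell\in\mathbb{R}^{n_\ell}$. Let $G_\ell\in\mathbb{R}^{n_\ell\times d}$, $g_\ell\in\mathbb{R}^d$, $h_\ell\in\mathbb{R}^{n_\ell}$ be mutually independent with i.i.d. $\mathcal{N}(0,1)$ entries, and define $$\Phi(G):=\min_{w\in\mathcal{S}_w}\max_{v\in\mathcal{S}_v}\sum_{\ell=1}^k\beta_\ell(v_\ell)^TG_\ell\,\alpha_\ell(w)+\psi(w,v),$$ $$\phi(g,h):=\min_{w\in\mathcal{S}_w}\max_{v\in\mathcal{S}_v}\sum_{\ell=1}^k\Big[\|\beta_\ell(v_\ell)\|_2\,g_\ell^T\alpha_\ell(w)+\|\alpha_\ell(w)\|_2\,h_\ell^T\beta_\ell(v_\ell)\Big]+\psi(w,v).$$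 Then for all $c\in\mathbb{R}$ and $\eta>0$, $$\mathbb{P}(|\Phi(G)-c|>\eta)\le 2^k\,\mathbb{P}(|\phi(g,h)-c|>\eta).$$
   Context: Norms are Euclidean. $G=(G_1,\dots,G_k)$, $g=(g_1,\dots,g_k)$, $h=(h_1,\dots,h_k)$. *)

theory Defs
  imports "HOL-Library.Function_Algebras" "HOL-Analysis.Analysis" "HOL-Probability.Probability"
begin

text \<open>Real vector structure on functions (pointwise), so that vectors of R^n can be
  represented as functions nat => real vanishing outside the index range.\<close>

instantiation "fun" :: (type, real_vector) real_vector
begin
definition scaleR_fun :: "real \<Rightarrow> ('a \<Rightarrow> 'b) \<Rightarrow> 'a \<Rightarrow> 'b"
  where "scaleR_fun r f = (\<lambda>x. r *\<^sub>R f x)"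
instance
  by intro_classes (auto simp: scaleR_fun_def fun_eq_iff plus_fun_def scaleR_add_right scaleR_add_left)
end

definition vecs :: "nat \<Rightarrow> (nat \<Rightarrow> real) set" where
  "vecs n = {x. \<forall>i\<ge>n. x i = 0}"

definition enorm :: "nat \<Rightarrow> (nat \<Rightarrow> real) \<Rightarrow> real" where
  "enorm n x = sqrt (\<Sum>i<n. (x i)\<^sup>2)"

definition dotp :: "nat \<Rightarrow> (nat \<Rightarrow> real) \<Rightarrow> (nat \<Rightarrow> real) \<Rightarrow> real" where
  "dotp n x y = (\<Sum>i<n. x i * y i)"

definition affmap :: "nat \<Rightarrow> (nat \<Rightarrow> nat \<Rightarrow> real) \<Rightarrow> (nat \<Rightarrow> real) \<Rightarrow> (nat \<Rightarrow> real) \<Rightarrow> nat \<Rightarrow> real" where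
  "affmap n M m x = (\<lambda>i. if i < n then (\<Sum>j<n. M i j * x j) + m i else 0)"

definition prodset :: "nat \<Rightarrow> (nat \<Rightarrow> (nat \<Rightarrow> real) set) \<Rightarrow> (nat \<Rightarrow> nat \<Rightarrow> real) set" where
  "prodset k S = {v. (\<forall>l<k. v l \<in> S l) \<and> (\<forall>l\<ge>k. v l = 0)}"

text \<open>Indices of the Gaussian variables: entries G_l(i,j), g_l(j), h_l(i).\<close>
datatype gidx = GG nat nat nat | gg nat nat | hh nat nat

definition gindices :: "nat \<Rightarrow> nat \<Rightarrow> (nat \<Rightarrow> nat) \<Rightarrow> gidx set" where
  "gindices k d n =
     {GG l i j | l i j. l < k \<and> i < n l \<and> j < d} \<union>
     {gg l j | l j. l < k \<and> j < d} \<union>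
     {hh l i | l i. l < k \<and> i < n l}"

end

theory Submission
  imports Defs
begin

text \<open>
  Adding to the bilinear form the terms $\gamma_\ell \|\alpha_\ell(w)\| \|\beta_\ell(v_\ell)\|$ with
  independent standard normal $\gamma_\ell$ gives a Gaussian process whose covariance exceeds that of
  the process behind $\phi$ by
  $\sum_\ell (\|\alpha_\ell\|\|\alpha_\ell'\| - \alpha_\ell\cdot\alpha_\ell')
  (\|\beta_\ell\|\|\beta_\ell'\| - \beta_\ell\cdot\beta_\ell') \ge 0$, with equality when $w = w'$ or
  $v = v'$, so that Gordon's inequality compares the two min-max values. On the event that all
  $\gamma_\ell$ are nonpositive, which is independent of $G$ and has probability at least $2^{-k}$,
  the extra terms only decrease the value; this gives
  $P(\Phi < c) \le 2^k P(\phi < c)$ without any convexity. Since $\Phi$ is also a max-min by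
  convexity, the same argument with the two players exchanged bounds the upper tail.

  Gordon's inequality is proved by moving from one process to the other in $N$ steps: replacing an
  independent Gaussian increment of variance $1/N$ changes the expectation of a smooth test function
  by at least $-K N^{-3/2}$, so no Gaussian integration by parts is needed.
\<close>

subsection \<open>Minimax for convex-concave functions\<close>

text \<open>One replacement of an increment of standard deviation s = N^(-1/2) costs O(s^3): the
  linear terms of the expansion have mean zero, and the quadratic terms differ only by covariance
  differences, which vanish when both indices share the choice of the minimising player and
  otherwise meet nonnegative second derivatives. The N losses add up to O(N^(-1/2)). The remainder
  must be uniform in the base point, hence a test function built from logistic functions, whose
  derivatives are polynomials in their values and so bounded.

  Ties at the threshold make the finite comparison pair a strict event with a nonstrict one; the gap
  is closed by moving the threshold after the passage from finite nets to compact sets. The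
  covariance equality serves w = w' for one tail and v = v' for the other, since exchanging the
  players changes who minimises. Strong duality is used for Phi alone: the objective of phi is in
  general not convex-concave, but weak duality points the right way. The two tail events of phi are
  disjoint, so treating both tails does not double the factor 2^k.\<close>

lemma compact_sublevel:
  fixes f :: "'a::topological_space \<Rightarrow> real"
  assumes "compact S" "continuous_on S f"
  shows "compact {x\<in>S. f x \<le> c}"
proof -
  obtain A where "closed A" "A \<inter> S = f -` {..c} \<inter> S"
    using assms(2) unfolding continuous_on_closed_invariant by (metis closed_atMost)
  moreover have "f -` {..c} \<inter> S = {x\<in>S. f x \<le> c}" by auto
  ultimately show ?thesis
    using closed_Int_compact[of A S] \<open>compact S\<close> by simp
qed

text \<open>Where \<open>p\<close> is nonpositive the weight \<open>t\<close> must exceed a ratio,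
  where \<open>q\<close> is nonpositive it must stay below another; compactness turns these into one
  lower and one upper bound, attained at \<open>x1\<close> and \<open>x2\<close>. If the bounds
  crossed, a point of the segment from \<open>x1\<close> to \<open>x2\<close> would make both
  functions nonpositive. The type carries a vector structure and a topology without compatibility
  between them, which suits the function spaces of the main theorem.\<close>

lemma convex_two_point:
  fixes p q :: "'a::{real_vector,topological_space} \<Rightarrow> real"
  assumes "compact S" "convex S"
    and cont: "continuous_on S p" "continuous_on S q"
    and conv: "convex_on S p" "convex_on S q"
    and pos: "\<And>x. x \<in> S \<Longrightarrow> p x > 0 \<or> q x > 0"
  obtains t where "0 \<le> t" "t \<le> 1" "\<And>x. x \<in> S \<Longrightarrow> (1 - t) * p x + t * q x > 0"
proof -
  define S1 where "S1 = {x\<in>S. p x \<le> 0}"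
  define S2 where "S2 = {x\<in>S. q x \<le> 0}"
  have c1: "compact S1" and c2: "compact S2"
    unfolding S1_def S2_def using compact_sublevel assms by blast+
  consider "S1 = {}" | "S2 = {}" | "S1 \<noteq> {}" "S2 \<noteq> {}" by blast
  then show ?thesis
  proof cases
    case 1
    then show ?thesis using that[of 0] by (simp add: S1_def) (meson not_le)
  next
    case 2
    then show ?thesis using that[of 1] by (simp add: S2_def) (meson not_le)
  next
    case 3
    have "continuous_on S1 (\<lambda>x. - p x / (q x - p x))"
      by (intro continuous_intros continuous_on_subset[OF cont(1)] continuous_on_subset[OF cont(2)])
        (use pos in \<open>force simp: S1_def\<close>)+
    then obtain x1 where x1: "x1 \<in> S1" "\<And>x. x \<in> S1 \<Longrightarrow> - p x / (q x - p x) \<le> - p x1 / (q x1 - p x1)"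
      using continuous_attains_sup[OF c1 3(1)] by blast
    have "continuous_on S2 (\<lambda>x. p x / (p x - q x))"
      by (intro continuous_intros continuous_on_subset[OF cont(1)] continuous_on_subset[OF cont(2)])
        (use pos in \<open>force simp: S2_def\<close>)+
    then obtain x2 where x2: "x2 \<in> S2" "\<And>x. x \<in> S2 \<Longrightarrow> p x2 / (p x2 - q x2) \<le> p x / (p x - q x)"
      using continuous_attains_inf[OF c2 3(2)] by blast
    have s1: "x1 \<in> S" "p x1 \<le> 0" "q x1 > 0" and s2: "x2 \<in> S" "q x2 \<le> 0" "p x2 > 0"
      using x1(1) x2(1) pos by (force simp: S1_def S2_def)+
    have key: "p x1 * q x2 < p x2 * q x1"
    proof (rule ccontr)
      assume c: "\<not> ?thesis"
      \<comment> \<open>\<open>u\<close> is the zero of the chord of \<open>p\<close> from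
        \<open>x1\<close> to \<open>x2\<close>. By convexity \<open>p\<close> is at most 0 at that
        point, and the negated claim says that the chord of \<open>q\<close> is at most 0 there
        too.\<close>
      define u where "u = - p x1 / (p x2 - p x1)"
      have u: "0 \<le> u" "u \<le> 1" using s1 s2 by (auto simp: u_def field_simps)
      define y where "y = (1 - u) *\<^sub>R x1 + u *\<^sub>R x2"
      have "y \<in> S" unfolding y_def using u s1 s2 \<open>convex S\<close> by (simp add: convex_alt)
      have "p y \<le> (1 - u) * p x1 + u * p x2"
        unfolding y_def using convex_onD[OF conv(1)] u s1 s2 by blast
      also have "\<dots> = 0" using s1 s2 by (simp add: u_def field_simps)
      finally have "p y \<le> 0" .
      have "q y \<le> (1 - u) * q x1 + u * q x2"
        unfolding y_def using convex_onD[OF conv(2)] u s1 s2 by blast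
      also have "\<dots> = (p x2 * q x1 - p x1 * q x2) / (p x2 - p x1)"
      proof -
        have "u * (p x2 - p x1) = - p x1" using s1 s2 by (simp add: u_def)
        then have "((1 - u) * q x1 + u * q x2) * (p x2 - p x1) = p x2 * q x1 - p x1 * q x2"
          by algebra
        then show ?thesis using s1 s2 by (simp add: eq_divide_eq)
      qed
      also have "\<dots> \<le> 0" using c s1 s2 by (intro divide_nonpos_pos) auto
      finally show False using \<open>p y \<le> 0\<close> pos[OF \<open>y \<in> S\<close>] by linarith
    qed
    \<comment> \<open>The combination with weight \<open>t\<close> is positive on \<open>S1\<close> iff \<open>t > r1\<close>
      and on \<open>S2\<close> iff \<open>t < r2\<close>.\<close>
    define r1 where "r1 = - p x1 / (q x1 - p x1)"
    define r2 where "r2 = p x2 / (p x2 - q x2)"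
    have "r1 < r2"
      using key s1 s2 by (simp add: r1_def r2_def field_simps)
    moreover have "0 \<le> r1" "r2 \<le> 1" using s1 s2 by (auto simp: r1_def r2_def field_simps)
    moreover define t where "t = (r1 + r2) / 2"
    ultimately have t: "0 < t" "t < 1" "r1 < t" "t < r2" by auto
    have "(1 - t) * p x + t * q x > 0" if x: "x \<in> S" for x
    proof -
      consider "p x \<le> 0" "q x > 0" | "q x \<le> 0" "p x > 0" | "p x > 0" "q x > 0"
        using pos[OF x] by fastforce
      then show ?thesis
      proof cases
        case 1
        then have "- p x / (q x - p x) < t"
          using x1(2)[of x] t x by (auto simp: S1_def r1_def)
        then show ?thesis using 1 by (simp add: field_simps)
      next
        case 2
        then have "t < p x / (p x - q x)"
          using x2(2)[of x] t x by (auto simp: S2_def r2_def)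
        then show ?thesis using 2 by (simp add: field_simps)
      next
        case 3
        then show ?thesis using t by (simp add: add_pos_pos)
      qed
    qed
    then show ?thesis using that[of t] t by auto
  qed
qed

lemma convex_concave_finite:
  fixes f :: "'a::{real_vector,topological_space} \<Rightarrow> 'b::real_vector \<Rightarrow> real"
  assumes "finite Y" "Y \<noteq> {}" "Y \<subseteq> T" "compact S" "convex S"
    and cont: "\<And>y. y \<in> T \<Longrightarrow> continuous_on S (\<lambda>x. f x y)"
    and conv: "\<And>y. y \<in> T \<Longrightarrow> convex_on S (\<lambda>x. f x y)"
    and conc: "\<And>x. x \<in> S \<Longrightarrow> concave_on T (f x)"
    and "convex T"
    and "\<And>x. x \<in> S \<Longrightarrow> \<exists>y\<in>Y. f x y > c"
  shows "\<exists>y\<in>T. \<forall>x\<in>S. f x y > c"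
  using assms(1-5) cont conv conc assms(10)
proof (induction Y arbitrary: S rule: finite_ne_induct)
  case (singleton y)
  then show ?case by blast
next
  case (insert y Y)
  define S' where "S' = {x\<in>S. f x y \<le> c}"
  have yT: "y \<in> T" using insert by auto
  have cvx: "convex S'"
    unfolding convex_alt
  proof (intro ballI allI impI)
    fix x x' and u :: real assume *: "x \<in> S'" "x' \<in> S'" "0 \<le> u \<and> u \<le> 1"
    have "f ((1 - u) *\<^sub>R x + u *\<^sub>R x') y \<le> (1 - u) * f x y + u * f x' y"
      using convex_onD[OF insert.prems(5)[OF yT]] * by (auto simp: S'_def)
    also have "\<dots> \<le> (1 - u) * c + u * c"
      using * by (intro add_mono mult_left_mono) (auto simp: S'_def)
    finally show "(1 - u) *\<^sub>R x + u *\<^sub>R x' \<in> S'"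
      using * \<open>convex S\<close> by (auto simp: S'_def convex_alt algebra_simps)
  qed
  have cmp: "compact S'"
    unfolding S'_def using compact_sublevel insert.prems yT by blast
  have sub: "S' \<subseteq> S" by (auto simp: S'_def)
  have "\<exists>z\<in>T. \<forall>x\<in>S'. f x z > c"
  proof (rule insert.IH)
    show "Y \<subseteq> T" using insert by auto
    show "continuous_on S' (\<lambda>x. f x z)" if "z \<in> T" for z
      using insert.prems(4)[OF that] sub continuous_on_subset by blast
    show "convex_on S' (\<lambda>x. f x z)" if "z \<in> T" for z
      using insert.prems(5)[OF that] sub cvx convex_on_subset by blast
    show "concave_on T (f x)" if "x \<in> S'" for x
      using insert.prems(6) that sub by blast
    show "\<exists>y\<in>Y. c < f x y" if "x \<in> S'" for x
      using insert.prems(7)[of x] that by (auto simp: S'_def)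
  qed (use cvx cmp in auto)
  then obtain z where z: "z \<in> T" "\<And>x. x \<in> S' \<Longrightarrow> f x z > c" by blast
  \<comment> \<open>Subtracting \<open>c\<close> turns the two alternatives into positivity of one
    of two convex functions at each point.\<close>
  obtain t where t: "0 \<le> t" "t \<le> 1" "\<And>x. x \<in> S \<Longrightarrow> (1 - t) * (f x y - c) + t * (f x z - c) > 0"
  proof (rule convex_two_point[of S "\<lambda>x. f x y - c" "\<lambda>x. f x z - c"])
    have *: "convex_on S (\<lambda>x. f x w - c)" if "w \<in> T" for w
      using convex_on_diff[OF insert.prems(5)[OF that], of "\<lambda>_. c"] insert.prems(3)
      by (simp add: concave_on_const)
    show "convex_on S (\<lambda>x. f x y - c)" "convex_on S (\<lambda>x. f x z - c)" using * yT z by auto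
    show "f x y - c > 0 \<or> f x z - c > 0" if "x \<in> S" for x
      using z(2)[of x] that by (cases "f x y \<le> c") (auto simp: S'_def)
  qed (use insert.prems z yT in \<open>auto intro!: continuous_intros\<close>)
  define w where "w = (1 - t) *\<^sub>R y + t *\<^sub>R z"
  have "w \<in> T" using t yT z \<open>convex T\<close> by (simp add: w_def convex_alt)
  moreover have "f x w > c" if "x \<in> S" for x
  proof -
    have "(1 - t) * f x y + t * f x z \<le> f x w"
      unfolding w_def using concave_onD[OF insert.prems(6)[OF that]] t yT z by blast
    then show ?thesis using t(3)[OF that] by (simp add: algebra_simps)
  qed
  ultimately show ?case by blast
qed

text \<open>Suprema and infima of reals are meaningful only for nonempty bounded sets, so these side
  conditions are derived once from a uniform bound, together with weak duality.\<close>

lemma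
  fixes f :: "'a \<Rightarrow> 'b \<Rightarrow> real"
  assumes ne: "S \<noteq> {}" "T \<noteq> {}" and bdd: "\<And>x y. x \<in> S \<Longrightarrow> y \<in> T \<Longrightarrow> \<bar>f x y\<bar> \<le> K"
  shows bdd_above_SUP: "x \<in> S \<Longrightarrow> bdd_above (f x ` T)"
    and bdd_below_INF_SUP: "bdd_below ((\<lambda>x. SUP y\<in>T. f x y) ` S)"
    and bdd_above_SUP_INF: "bdd_above ((\<lambda>y. INF x\<in>S. f x y) ` T)"
    and SUP_INF_le_INF_SUP: "(SUP y\<in>T. INF x\<in>S. f x y) \<le> (INF x\<in>S. SUP y\<in>T. f x y)"
proof -
  have ba: "bdd_above (f x ` T)" if "x \<in> S" for x
    using bdd[OF that] by (intro bdd_aboveI[of _ K]) (auto simp: abs_le_iff)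
  have bb: "bdd_below ((\<lambda>x. f x y) ` S)" if "y \<in> T" for y
    using bdd[OF _ that] by (intro bdd_belowI[of _ "- K"]) (force simp: abs_le_iff)
  have bb2: "bdd_below ((\<lambda>x. SUP y\<in>T. f x y) ` S)"
  proof (intro bdd_belowI2[of _ "- K"])
    fix x assume x: "x \<in> S"
    obtain y where "y \<in> T" using \<open>T \<noteq> {}\<close> by blast
    then show "- K \<le> (SUP y\<in>T. f x y)"
      using cSUP_upper[OF _ ba[OF x], of y] bdd[OF x, of y] by linarith
  qed
  have ba2: "bdd_above ((\<lambda>y. INF x\<in>S. f x y) ` T)"
  proof (intro bdd_aboveI2[of _ _ K])
    fix y assume y: "y \<in> T"
    obtain x where "x \<in> S" using \<open>S \<noteq> {}\<close> by blast
    then show "(INF x\<in>S. f x y) \<le> K"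
      using cINF_lower[OF bb[OF y], of x] bdd[of x, OF _ y] by linarith
  qed
  show "(SUP y\<in>T. INF x\<in>S. f x y) \<le> (INF x\<in>S. SUP y\<in>T. f x y)"
    by (intro cSUP_least cINF_greatest ne) (metis ba bb cINF_lower cSUP_upper order_trans)
  show "x \<in> S \<Longrightarrow> bdd_above (f x ` T)" by (rule ba)
  show "bdd_below ((\<lambda>x. SUP y\<in>T. f x y) ` S)" by (rule bb2)
  show "bdd_above ((\<lambda>y. INF x\<in>S. f x y) ` T)" by (rule ba2)
qed

text \<open>If \<open>c\<close> lay strictly between the two values, the sets where some
  \<open>y\<close> gives more than \<open>c\<close> would cover \<open>S\<close>. Compactness leaves
  finitely many \<open>y\<close>, and the finite case merges them into one that beats
  \<open>c\<close> on all of \<open>S\<close>, pushing the max-min value up to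
  \<open>c\<close>.\<close>

theorem convex_concave_minimax:
  fixes f :: "'a::{real_vector,topological_space} \<Rightarrow> 'b::{real_vector} \<Rightarrow> real"
  assumes "compact S" "convex S" "convex T" "S \<noteq> {}" "T \<noteq> {}"
    and cont: "\<And>y. y \<in> T \<Longrightarrow> continuous_on S (\<lambda>x. f x y)"
    and conv: "\<And>y. y \<in> T \<Longrightarrow> convex_on S (\<lambda>x. f x y)"
    and conc: "\<And>x. x \<in> S \<Longrightarrow> concave_on T (f x)"
    and bdd: "\<And>x y. x \<in> S \<Longrightarrow> y \<in> T \<Longrightarrow> \<bar>f x y\<bar> \<le> K"
  shows "(INF x\<in>S. SUP y\<in>T. f x y) = (SUP y\<in>T. INF x\<in>S. f x y)"
proof (rule antisym)
  have ba: "bdd_above (f x ` T)" if "x \<in> S" for x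
    by (rule bdd_above_SUP[of S T f K]) (use assms that in auto)
  have bb2: "bdd_below ((\<lambda>x. SUP y\<in>T. f x y) ` S)"
    by (rule bdd_below_INF_SUP[of S T f K]) (use assms in auto)
  have ba2: "bdd_above ((\<lambda>y. INF x\<in>S. f x y) ` T)"
    by (rule bdd_above_SUP_INF[of S T f K]) (use assms in auto)
  show "(SUP y\<in>T. INF x\<in>S. f x y) \<le> (INF x\<in>S. SUP y\<in>T. f x y)"
    by (rule SUP_INF_le_INF_SUP[of S T f K]) (use assms in auto)
  show "(INF x\<in>S. SUP y\<in>T. f x y) \<le> (SUP y\<in>T. INF x\<in>S. f x y)"
  proof (rule ccontr)
    assume "\<not> ?thesis"
    then obtain c where c: "(SUP y\<in>T. INF x\<in>S. f x y) < c" "c < (INF x\<in>S. SUP y\<in>T. f x y)"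
      using dense by (metis not_le)
    have ex: "\<exists>y\<in>T. f x y > c" if "x \<in> S" for x
    proof -
      have "c < (SUP y\<in>T. f x y)" using c(2) cINF_lower[OF bb2 that] by linarith
      then show ?thesis using less_cSUP_iff[OF \<open>T \<noteq> {}\<close> ba[OF that]] by blast
    qed
    \<comment> \<open>Continuity is given on \<open>S\<close> only, so the superlevel sets are
      traces on \<open>S\<close> of open sets, and these open sets form the cover.\<close>
    have "\<forall>y\<in>T. \<exists>A. open A \<and> A \<inter> S = (\<lambda>x. f x y) -` {c<..} \<inter> S"
      using cont unfolding continuous_on_open_invariant by (metis open_greaterThan)
    then obtain A where A: "\<And>y. y \<in> T \<Longrightarrow> open (A y)"
        "\<And>y. y \<in> T \<Longrightarrow> A y \<inter> S = (\<lambda>x. f x y) -` {c<..} \<inter> S" by metis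
    have "S \<subseteq> (\<Union>y\<in>T. A y)"
    proof
      fix x assume x: "x \<in> S"
      then obtain y where "y \<in> T" "f x y > c" using ex by blast
      then have "x \<in> A y" using A(2)[of y] x by auto
      then show "x \<in> (\<Union>y\<in>T. A y)" using \<open>y \<in> T\<close> by blast
    qed
    then obtain Y where Y: "Y \<subseteq> T" "finite Y" "S \<subseteq> (\<Union>y\<in>Y. A y)"
      using compactE_image[OF \<open>compact S\<close>, of T A] A(1) by metis
    have "Y \<noteq> {}" using Y \<open>S \<noteq> {}\<close> by auto
    have "\<exists>y\<in>Y. f x y > c" if x: "x \<in> S" for x
    proof -
      obtain y where "y \<in> Y" "x \<in> A y" using Y x by blast
      then show ?thesis using A(2)[of y] x Y by auto
    qed
    then obtain y where y: "y \<in> T" "\<And>x. x \<in> S \<Longrightarrow> f x y > c"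
      using convex_concave_finite[OF Y(2) \<open>Y \<noteq> {}\<close> Y(1) assms(1,2) cont conv conc \<open>convex T\<close>, of c]
      by blast
    have "c \<le> (INF x\<in>S. f x y)"
      using y \<open>S \<noteq> {}\<close> by (intro cINF_greatest) (auto intro: less_imp_le)
    also have "\<dots> \<le> (SUP y\<in>T. INF x\<in>S. f x y)"
      using y ba2 by (intro cSUP_upper)
    finally show False using c by simp
  qed
qed

subsection \<open>Second-order expansions with uniform cubic remainder\<close>

text \<open>The decreasing logistic function, a smooth stand-in for the indicator of the negative
  half-line. It solves s' = - s (1 - s), so every derivative is a polynomial in a value from (0,
  1).\<close>

definition sigm :: "real \<Rightarrow> real" where
  "sigm x = 1 / (1 + exp x)"

lemma sigm_pos: "0 < sigm x" and sigm_less_1: "sigm x < 1"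
  by (auto simp: sigm_def add_pos_pos)

lemma sigm_at_top: "(sigm \<longlongrightarrow> 0) at_top"
  unfolding sigm_def
  by (intro tendsto_divide_0[OF tendsto_const] filterlim_at_top_imp_at_infinity
      filterlim_tendsto_add_at_top[OF tendsto_const] exp_at_top)

lemma sigm_at_bot: "(sigm \<longlongrightarrow> 1) at_bot"
proof -
  have "((\<lambda>x::real. 1 / (1 + exp x)) \<longlongrightarrow> 1 / (1 + 0)) at_bot"
    by (intro tendsto_intros exp_at_bot) auto
  then show ?thesis by (simp add: sigm_def[abs_def])
qed

lemma sigm_deriv: "(sigm has_real_derivative - (sigm x * (1 - sigm x))) (at x within A)"
proof -
  have "1 + exp x \<noteq> 0" by (smt (verit) exp_gt_zero)
  then show ?thesis
    unfolding sigm_def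
    by (auto intro!: derivative_eq_intros simp: field_simps power2_eq_square)
qed

text \<open>Lagrange remainder with a third derivative bounded by 1 + 6 + 6 = 13; the factor 1/6 is
  given away.\<close>

lemma sigm_taylor:
  defines "D1 \<equiv> \<lambda>x. - (sigm x * (1 - sigm x))"
    and "D2 \<equiv> \<lambda>x. sigm x * (1 - sigm x) * (1 - 2 * sigm x)"
  shows "\<bar>sigm (x + h) - (sigm x + D1 x * h + D2 x * h\<^sup>2 / 2)\<bar> \<le> 13 * \<bar>h\<bar> ^ 3"
proof (cases "h = 0")
  case False
  define D3 where "D3 x = - (sigm x * (1 - sigm x) * (1 - 6 * sigm x + 6 * (sigm x)\<^sup>2))" for x
  define diff where "diff m = (if m = 0 then sigm else if m = 1 then D1 else if m = 2 then D2 else D3)"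
    for m :: nat
  have der: "DERIV (diff m) t :> diff (Suc m) t" if m3: "m < 3" for m t
  proof -
    consider "m = 0" | "m = 1" | "m = 2" using m3 by linarith
    then show ?thesis
    proof cases
      case 1 then show ?thesis using sigm_deriv by (simp add: diff_def D1_def)
    next
      case 2 then show ?thesis
        by (auto simp: diff_def D1_def[abs_def] D2_def intro!: derivative_eq_intros sigm_deriv)
           (simp add: algebra_simps)
    next
      case 3 then show ?thesis
        by (auto simp: diff_def D2_def[abs_def] D3_def intro!: derivative_eq_intros sigm_deriv)
           (simp add: algebra_simps power2_eq_square)
    qed
  qed
  have "\<exists>t. (if x + h < x then x + h < t \<and> t < x else x < t \<and> t < x + h) \<and>
          sigm (x + h) = (\<Sum>m<3. diff m x / fact m * (x + h - x) ^ m) + diff 3 t / fact 3 * (x + h - x) ^ 3"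
    by (rule Taylor[where a = "min x (x + h)" and b = "max x (x + h)"])
       (use False der in \<open>auto simp: diff_def\<close>)
  then obtain t where "sigm (x + h) = (\<Sum>m<3. diff m x / fact m * h ^ m) + D3 t / 6 * h ^ 3"
    by (auto simp: diff_def fact_numeral)
  then have "sigm (x + h) - (sigm x + D1 x * h + D2 x * h\<^sup>2 / 2) = D3 t / 6 * h ^ 3"
    by (simp add: diff_def numeral_3_eq_3 fact_numeral power2_eq_square)
  moreover have "\<bar>D3 t\<bar> \<le> 13"
  proof -
    have s: "0 < sigm t" "sigm t < 1" by (rule sigm_pos sigm_less_1)+
    then have "0 \<le> (sigm t)\<^sup>2" "(sigm t)\<^sup>2 \<le> 1" by (auto simp: power_le_one)
    then have 1: "\<bar>1 - 6 * sigm t + 6 * (sigm t)\<^sup>2\<bar> \<le> 13" using s by linarith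
    have 2: "\<bar>sigm t * (1 - sigm t)\<bar> \<le> 1" using s by (simp add: abs_mult mult_le_one)
    show ?thesis unfolding D3_def using mult_mono[OF 2 1] by (simp add: abs_mult)
  qed
  then have "\<bar>D3 t / 6\<bar> * \<bar>h ^ 3\<bar> \<le> 13 * \<bar>h ^ 3\<bar>" by (intro mult_right_mono) auto
  ultimately show ?thesis by (simp only: abs_mult power_abs)
qed simp

text \<open>
  Second-order expansion with coefficients \<open>c\<close> (gradient) and \<open>e\<close> (Hessian) and a cubic remainder
  that is uniform in the base point. Together with the boundedness of \<open>f\<close>, \<open>c\<close> and \<open>e\<close> the
  notion is closed under products, so no derivatives in several variables are needed.
\<close>

definition jet ::
  "'p set \<Rightarrow> (('p \<Rightarrow> real) \<Rightarrow> real) \<Rightarrow> (('p \<Rightarrow> real) \<Rightarrow> 'p \<Rightarrow> real) \<Rightarrow> (('p \<Rightarrow> real) \<Rightarrow> 'p \<Rightarrow> 'p \<Rightarrow> real) \<Rightarrow> bool"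
where
  "jet P f c e \<longleftrightarrow> (\<exists>C\<ge>0. \<forall>u. \<bar>f u\<bar> \<le> C \<and> (\<forall>p\<in>P. \<bar>c u p\<bar> \<le> C) \<and> (\<forall>p\<in>P. \<forall>q\<in>P. \<bar>e u p q\<bar> \<le> C) \<and>
     (\<forall>z. \<bar>f (\<lambda>p. u p + z p) - (f u + (\<Sum>p\<in>P. c u p * z p) + (\<Sum>p\<in>P. \<Sum>q\<in>P. e u p q * z p * z q) / 2)\<bar>
          \<le> C * (\<Sum>p\<in>P. \<bar>z p\<bar>) ^ 3))"

lemma jet_const: "jet P (\<lambda>_. a) (\<lambda>_ _. 0) (\<lambda>_ _ _. 0)"
  unfolding jet_def by (rule exI[of _ "\<bar>a\<bar>"]) (auto intro!: mult_nonneg_nonneg sum_nonneg)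

lemma jet_one_minus:
  assumes "jet P f c e"
  shows "jet P (\<lambda>u. 1 - f u) (\<lambda>u p. - c u p) (\<lambda>u p q. - e u p q)"
proof -
  obtain C where C: "C \<ge> 0" "\<And>u. \<bar>f u\<bar> \<le> C" "\<And>u p. p \<in> P \<Longrightarrow> \<bar>c u p\<bar> \<le> C"
    "\<And>u p q. p \<in> P \<Longrightarrow> q \<in> P \<Longrightarrow> \<bar>e u p q\<bar> \<le> C"
    "\<And>u z. \<bar>f (\<lambda>p. u p + z p) - (f u + (\<Sum>p\<in>P. c u p * z p) + (\<Sum>p\<in>P. \<Sum>q\<in>P. e u p q * z p * z q) / 2)\<bar>
          \<le> C * (\<Sum>p\<in>P. \<bar>z p\<bar>) ^ 3"
    using assms unfolding jet_def by blast
  show ?thesis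
    unfolding jet_def
  proof (rule exI[of _ "C + 1"], intro conjI allI ballI)
    fix u z :: "'a \<Rightarrow> real"
    have "C * (\<Sum>p\<in>P. \<bar>z p\<bar>) ^ 3 \<le> (C + 1) * (\<Sum>p\<in>P. \<bar>z p\<bar>) ^ 3"
      by (intro mult_right_mono) (auto intro!: sum_nonneg)
    then show "\<bar>1 - f (\<lambda>p. u p + z p) - (1 - f u + (\<Sum>p\<in>P. - c u p * z p) + (\<Sum>p\<in>P. \<Sum>q\<in>P. - e u p q * z p * z q) / 2)\<bar>
          \<le> (C + 1) * (\<Sum>p\<in>P. \<bar>z p\<bar>) ^ 3"
      using C(5)[of u z] by (simp add: sum_negf abs_le_iff)
    show "\<bar>1 - f u\<bar> \<le> C + 1" using C(2)[of u] by linarith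
    show "\<bar>- c u p\<bar> \<le> C + 1" if "p \<in> P" for p using C(3)[OF that, of u] by linarith
    show "\<bar>- e u p q\<bar> \<le> C + 1" if "p \<in> P" "q \<in> P" for p q using C(4)[OF that, of u] by linarith
  qed (use C in auto)
qed

text \<open>The absolute weights are 1, 1, 1, 1, 1/2, 1/2 and 1, with sum 6.\<close>

lemma abs_combination_le:
  fixes K :: real
  assumes "\<bar>a1\<bar> \<le> K" "\<bar>a2\<bar> \<le> K" "\<bar>a3\<bar> \<le> K" "\<bar>a4\<bar> \<le> K" "\<bar>a5\<bar> \<le> K" "\<bar>a6\<bar> \<le> K" "\<bar>a7\<bar> \<le> K"
  shows "\<bar>a1 - (a2 + (a3 + a4) + (a5 + a6 + 2 * a7) / 2)\<bar> \<le> 6 * K"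
proof -
  have "a1 \<le> K" "a2 \<le> K" "a3 \<le> K" "a4 \<le> K" "a5 \<le> K" "a6 \<le> K" "a7 \<le> K"
    "- K \<le> a1" "- K \<le> a2" "- K \<le> a3" "- K \<le> a4" "- K \<le> a5" "- K \<le> a6" "- K \<le> a7"
    using assms by (auto simp: abs_le_iff)
  then show ?thesis by (intro abs_leI) (simp_all add: field_simps)
qed

text \<open>\<open>F1\<close> and \<open>F2\<close> stand for the terms of order one and two in a
  displacement of size \<open>s\<close>. For \<open>s\<close> at most 1 the error splits into the
  two remainders, each times a bounded factor, and products of total order at least three; for
  larger \<open>s\<close> every single term is already at most \<open>C\<^sup>2 * s ^ 3\<close>,
  because its order is at most two.\<close>

lemma taylor_product_bound:
  fixes s C :: real
  assumes s: "0 \<le> s" and b: "\<bar>F\<bar> \<le> C" "\<bar>G\<bar> \<le> C" "\<bar>f\<bar> \<le> C" "\<bar>g\<bar> \<le> C"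
    and b1: "\<bar>F1\<bar> \<le> C * s" "\<bar>G1\<bar> \<le> C * s" and b2: "\<bar>F2\<bar> \<le> C * s\<^sup>2" "\<bar>G2\<bar> \<le> C * s\<^sup>2"
    and rf: "\<bar>f - (F + F1 + F2 / 2)\<bar> \<le> C * s ^ 3" and rg: "\<bar>g - (G + G1 + G2 / 2)\<bar> \<le> C * s ^ 3"
  shows "\<bar>f * g - (F * G + (F * G1 + G * F1) + (F * G2 + G * F2 + 2 * (F1 * G1)) / 2)\<bar> \<le> 6 * C\<^sup>2 * s ^ 3"
proof -
  have C: "C \<ge> 0" using b by linarith
  have m: "\<bar>x * y\<bar> \<le> C\<^sup>2 * s ^ (i + j)" if "\<bar>x\<bar> \<le> C * s ^ i" "\<bar>y\<bar> \<le> C * s ^ j" for x y i j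
    using mult_mono[OF that] s C by (simp add: abs_mult power2_eq_square power_add mult_ac)
  show ?thesis
  proof (cases "s \<le> 1")
    case True
    have p: "s ^ i \<le> s ^ 3" if "i \<ge> 3" for i using True s that by (simp add: power_decreasing)
    have "\<bar>(f - (F + F1 + F2 / 2)) * g\<bar> \<le> C\<^sup>2 * s ^ 3"
      using m[of _ 3 _ 0] rf b by simp
    moreover have "\<bar>(F + F1 + F2 / 2) * (g - (G + G1 + G2 / 2))\<bar> \<le> (3 * C) * (C * s ^ 3)"
    proof -
      have "C * s \<le> C" "C * s\<^sup>2 \<le> C" using True s C by (auto simp: mult_left_le power_le_one)
      then have "\<bar>F + F1 + F2 / 2\<bar> \<le> 3 * C" using b b1 b2 by linarith
      then show ?thesis using rg s C by (simp only: abs_mult) (intro mult_mono, auto)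
    qed
    moreover have "\<bar>F1 * G2\<bar> \<le> C\<^sup>2 * s ^ 3" "\<bar>F2 * G1\<bar> \<le> C\<^sup>2 * s ^ 3"
      using m[of F1 1 G2 2] m[of F2 2 G1 1] b1 b2 by (simp_all add: eval_nat_numeral)
    moreover have "\<bar>F2 * G2\<bar> \<le> C\<^sup>2 * s ^ 3"
    proof -
      have "\<bar>F2 * G2\<bar> \<le> C\<^sup>2 * s ^ 4" using m[of F2 2 G2 2] b2 by simp
      also have "\<dots> \<le> C\<^sup>2 * s ^ 3" using p[of 4] by (intro mult_left_mono) auto
      finally show ?thesis .
    qed
    \<comment> \<open>The contributions are at most 1, 3, 1/2, 1/2 and 1/4 times
      \<open>C\<^sup>2 * s ^ 3\<close>, which stays below 6.\<close>
    moreover have "f * g - (F * G + (F * G1 + G * F1) + (F * G2 + G * F2 + 2 * (F1 * G1)) / 2)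
      = (f - (F + F1 + F2 / 2)) * g + (F + F1 + F2 / 2) * (g - (G + G1 + G2 / 2))
        + F1 * G2 / 2 + F2 * G1 / 2 + F2 * G2 / 4"
      by (simp add: field_simps)
    moreover have "0 \<le> C\<^sup>2 * s ^ 3" using s by simp
    ultimately show ?thesis by (simp add: power2_eq_square abs_le_iff) 
  next
    case False
    have m3: "\<bar>x * y\<bar> \<le> C\<^sup>2 * s ^ 3" if "\<bar>x\<bar> \<le> C * s ^ i" "\<bar>y\<bar> \<le> C * s ^ j" "i + j \<le> 3" for x y i j
    proof -
      have "s ^ (i + j) \<le> s ^ 3" using False that by (intro power_increasing) auto
      then have "C\<^sup>2 * s ^ (i + j) \<le> C\<^sup>2 * s ^ 3" by (intro mult_left_mono) auto
      then show ?thesis using m[OF that(1,2)] by simp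
    qed
    have B0: "\<bar>F\<bar> \<le> C * s ^ 0" "\<bar>G\<bar> \<le> C * s ^ 0" "\<bar>f\<bar> \<le> C * s ^ 0" "\<bar>g\<bar> \<le> C * s ^ 0"
      unfolding power_0 mult_1_right by fact+
    have B1: "\<bar>F1\<bar> \<le> C * s ^ 1" "\<bar>G1\<bar> \<le> C * s ^ 1" unfolding power_one_right by fact+
    have "\<bar>f * g\<bar> \<le> C\<^sup>2 * s ^ 3"
      by (rule m3[OF B0(3) B0(4)]) simp
    moreover have "\<bar>F * G\<bar> \<le> C\<^sup>2 * s ^ 3"
      by (rule m3[OF B0(1) B0(2)]) simp
    moreover have "\<bar>F * G1\<bar> \<le> C\<^sup>2 * s ^ 3"
      by (rule m3[OF B0(1) B1(2)]) simp
    moreover have "\<bar>G * F1\<bar> \<le> C\<^sup>2 * s ^ 3"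
      by (rule m3[OF B0(2) B1(1)]) simp
    moreover have "\<bar>F * G2\<bar> \<le> C\<^sup>2 * s ^ 3"
      by (rule m3[OF B0(1) b2(2)]) simp
    moreover have "\<bar>G * F2\<bar> \<le> C\<^sup>2 * s ^ 3"
      by (rule m3[OF B0(2) b2(1)]) simp
    moreover have "\<bar>F1 * G1\<bar> \<le> C\<^sup>2 * s ^ 3"
      by (rule m3[OF B1(1) B1(2)]) simp
    ultimately show ?thesis unfolding mult.assoc by (rule abs_combination_le)
  qed
qed

text \<open>The Leibniz rule up to second order. The mixed term of the gradients is symmetrised,
  since a Hessian entry receives both orders of differentiation.\<close>

lemma jet_mult:
  assumes "finite P" "jet P f c e" "jet P g c' e'"
  shows "jet P (\<lambda>u. f u * g u) (\<lambda>u p. f u * c' u p + g u * c u p)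
    (\<lambda>u p q. f u * e' u p q + g u * e u p q + c u p * c' u q + c u q * c' u p)"
proof -
  obtain C1 where C1: "C1 \<ge> 0" "\<And>u. \<bar>f u\<bar> \<le> C1" "\<And>u p. p \<in> P \<Longrightarrow> \<bar>c u p\<bar> \<le> C1"
    "\<And>u p q. p \<in> P \<Longrightarrow> q \<in> P \<Longrightarrow> \<bar>e u p q\<bar> \<le> C1"
    "\<And>u z. \<bar>f (\<lambda>p. u p + z p) - (f u + (\<Sum>p\<in>P. c u p * z p) + (\<Sum>p\<in>P. \<Sum>q\<in>P. e u p q * z p * z q) / 2)\<bar>
          \<le> C1 * (\<Sum>p\<in>P. \<bar>z p\<bar>) ^ 3"
    using assms(2) unfolding jet_def by blast
  obtain C2 where C2: "C2 \<ge> 0" "\<And>u. \<bar>g u\<bar> \<le> C2" "\<And>u p. p \<in> P \<Longrightarrow> \<bar>c' u p\<bar> \<le> C2"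
    "\<And>u p q. p \<in> P \<Longrightarrow> q \<in> P \<Longrightarrow> \<bar>e' u p q\<bar> \<le> C2"
    "\<And>u z. \<bar>g (\<lambda>p. u p + z p) - (g u + (\<Sum>p\<in>P. c' u p * z p) + (\<Sum>p\<in>P. \<Sum>q\<in>P. e' u p q * z p * z q) / 2)\<bar>
          \<le> C2 * (\<Sum>p\<in>P. \<bar>z p\<bar>) ^ 3"
    using assms(3) unfolding jet_def by blast
  define C where "C = max C1 C2"
  have C0: "C \<ge> 0" using C1 by (simp add: C_def)
  have s0: "0 \<le> (\<Sum>p\<in>P. \<bar>z p\<bar>)" for z :: "'a \<Rightarrow> real" by (intro sum_nonneg) auto
  have Cf: "\<bar>f u\<bar> \<le> C" "\<bar>g u\<bar> \<le> C" for u using C1(2) C2(2) by (auto simp: C_def le_max_iff_disj)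
  have Cc: "\<bar>c u p\<bar> \<le> C" "\<bar>c' u p\<bar> \<le> C" if "p \<in> P" for u p
    using C1(3) C2(3) that by (auto simp: C_def le_max_iff_disj)
  have Ce: "\<bar>e u p q\<bar> \<le> C" "\<bar>e' u p q\<bar> \<le> C" if "p \<in> P" "q \<in> P" for u p q
    using C1(4) C2(4) that by (auto simp: C_def le_max_iff_disj)
  have lin: "\<bar>\<Sum>p\<in>P. a p * z p\<bar> \<le> C * (\<Sum>p\<in>P. \<bar>z p\<bar>)" if "\<And>p. p \<in> P \<Longrightarrow> \<bar>a p\<bar> \<le> C" for a z :: "'a \<Rightarrow> real"
    unfolding sum_distrib_left
    by (rule order_trans[OF sum_abs sum_mono]) (auto simp: abs_mult intro!: mult_right_mono that)
  have quad: "\<bar>\<Sum>p\<in>P. \<Sum>q\<in>P. a p q * z p * z q\<bar> \<le> C * (\<Sum>p\<in>P. \<bar>z p\<bar>)\<^sup>2"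
    if "\<And>p q. p \<in> P \<Longrightarrow> q \<in> P \<Longrightarrow> \<bar>a p q\<bar> \<le> C" for a and z :: "'a \<Rightarrow> real"
  proof -
    have "\<bar>\<Sum>p\<in>P. \<Sum>q\<in>P. a p q * z p * z q\<bar> \<le> (\<Sum>p\<in>P. \<Sum>q\<in>P. C * (\<bar>z p\<bar> * \<bar>z q\<bar>))"
      by (intro order_trans[OF sum_abs] sum_mono)
         (auto simp: abs_mult mult.assoc intro!: mult_right_mono that)
    also have "\<dots> = C * (\<Sum>p\<in>P. \<bar>z p\<bar>)\<^sup>2"
      by (simp only: power2_eq_square sum_product) (simp add: sum_distrib_left)
    finally show ?thesis .
  qed
  show ?thesis
    unfolding jet_def
  proof (rule exI[of _ "6 * C\<^sup>2"], intro conjI allI ballI)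
    fix u
    have m: "\<bar>x * y\<bar> \<le> C\<^sup>2" if "\<bar>x\<bar> \<le> C" "\<bar>y\<bar> \<le> C" for x y
      using mult_mono[OF that] C0 by (simp add: abs_mult power2_eq_square)
    have C20: "0 \<le> C\<^sup>2" by simp
    show "\<bar>f u * g u\<bar> \<le> 6 * C\<^sup>2" using m[OF Cf, of u u] C20 by linarith
    show "\<bar>f u * c' u p + g u * c u p\<bar> \<le> 6 * C\<^sup>2" if "p \<in> P" for p
      using m[OF Cf(1) Cc(2)[OF that], of u u] m[OF Cf(2) Cc(1)[OF that], of u u] C20 by linarith
    show "\<bar>f u * e' u p q + g u * e u p q + c u p * c' u q + c u q * c' u p\<bar> \<le> 6 * C\<^sup>2"
      if "p \<in> P" "q \<in> P" for p q
      using m[OF Cf(1) Ce(2)[OF that], of u u] m[OF Cf(2) Ce(1)[OF that], of u u]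
        m[OF Cc(1)[OF that(1)] Cc(2)[OF that(2)], of u u]
        m[OF Cc(1)[OF that(2)] Cc(2)[OF that(1)], of u u] C20 by linarith
    fix z :: "'a \<Rightarrow> real"
    define s where "s = (\<Sum>p\<in>P. \<bar>z p\<bar>)"
    have s: "s \<ge> 0" using s0 by (simp add: s_def)
    have r: "C1 * s ^ 3 \<le> C * s ^ 3" "C2 * s ^ 3 \<le> C * s ^ 3"
      using s by (auto simp: C_def intro!: mult_right_mono)
    have e1: "(\<Sum>p\<in>P. (f u * c' u p + g u * c u p) * z p)
      = f u * (\<Sum>p\<in>P. c' u p * z p) + g u * (\<Sum>p\<in>P. c u p * z p)"
      by (simp add: sum.distrib sum_distrib_left algebra_simps)
    \<comment> \<open>As quadratic forms both mixed terms equal the product of the two linear terms;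
      this gives the \<open>2 * (F1 * G1)\<close> of the scalar estimate.\<close>
    have "(\<Sum>p\<in>P. \<Sum>q\<in>P. c u p * c' u q * z p * z q) = (\<Sum>p\<in>P. c u p * z p) * (\<Sum>p\<in>P. c' u p * z p)"
      "(\<Sum>p\<in>P. \<Sum>q\<in>P. c u q * c' u p * z p * z q) = (\<Sum>p\<in>P. c' u p * z p) * (\<Sum>p\<in>P. c u p * z p)"
      unfolding sum_product by (auto intro!: sum.cong simp: mult_ac)
    moreover have "(\<Sum>p\<in>P. \<Sum>q\<in>P. (f u * e' u p q + g u * e u p q + c u p * c' u q + c u q * c' u p) * z p * z q)
      = f u * (\<Sum>p\<in>P. \<Sum>q\<in>P. e' u p q * z p * z q) + g u * (\<Sum>p\<in>P. \<Sum>q\<in>P. e u p q * z p * z q)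
        + (\<Sum>p\<in>P. \<Sum>q\<in>P. c u p * c' u q * z p * z q) + (\<Sum>p\<in>P. \<Sum>q\<in>P. c u q * c' u p * z p * z q)"
      by (simp add: distrib_right sum.distrib sum_distrib_left mult.assoc)
    ultimately have e2: "(\<Sum>p\<in>P. \<Sum>q\<in>P. (f u * e' u p q + g u * e u p q + c u p * c' u q + c u q * c' u p) * z p * z q)
      = f u * (\<Sum>p\<in>P. \<Sum>q\<in>P. e' u p q * z p * z q) + g u * (\<Sum>p\<in>P. \<Sum>q\<in>P. e u p q * z p * z q)
        + 2 * ((\<Sum>p\<in>P. c u p * z p) * (\<Sum>p\<in>P. c' u p * z p))"
      by (simp only: mult.commute[of "\<Sum>p\<in>P. c' u p * z p"])
    show "\<bar>f (\<lambda>p. u p + z p) * g (\<lambda>p. u p + z p) -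
         (f u * g u + (\<Sum>p\<in>P. (f u * c' u p + g u * c u p) * z p) +
          (\<Sum>p\<in>P. \<Sum>q\<in>P. (f u * e' u p q + g u * e u p q + c u p * c' u q + c u q * c' u p) * z p * z q) / 2)\<bar>
        \<le> 6 * C\<^sup>2 * (\<Sum>p\<in>P. \<bar>z p\<bar>) ^ 3"
      unfolding e1 e2 s_def[symmetric]
      by (rule taylor_product_bound[OF s Cf Cf])
         (use C1(5)[of u z] C2(5)[of u z] r lin quad Cc Ce in \<open>auto simp: s_def\<close>)
  qed (use C0 in auto)
qed

section \<open>Signs of the derivatives of products of logistic functions\<close>

lemma jet_sigm:
  assumes "finite P" "p \<in> P"
  shows "jet P (\<lambda>u. sigm (u p)) (\<lambda>u q. if q = p then - (sigm (u p) * (1 - sigm (u p))) else 0)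
    (\<lambda>u q r. if q = p \<and> r = p then sigm (u p) * (1 - sigm (u p)) * (1 - 2 * sigm (u p)) else 0)"
  unfolding jet_def
proof (rule exI[of _ 13], intro conjI allI ballI)
  fix u :: "'a \<Rightarrow> real"
  have s: "0 < sigm (u p)" "sigm (u p) < 1" by (rule sigm_pos sigm_less_1)+
  have b1: "\<bar>sigm (u p) * (1 - sigm (u p))\<bar> \<le> 1" using s by (simp add: abs_mult mult_le_one)
  have b2: "\<bar>sigm (u p) * (1 - sigm (u p)) * (1 - 2 * sigm (u p))\<bar> \<le> 1"
    using s b1 by (subst abs_mult) (intro mult_le_one, auto)
  show "\<bar>sigm (u p)\<bar> \<le> 13" using s by simp
  show "\<bar>if q = p then - (sigm (u p) * (1 - sigm (u p))) else 0\<bar> \<le> 13" for q using b1 by auto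
  show "\<bar>if q = p \<and> r = p then sigm (u p) * (1 - sigm (u p)) * (1 - 2 * sigm (u p)) else 0\<bar> \<le> 13"
    for q r using b2 by auto
  fix z :: "'a \<Rightarrow> real"
  define D1 where "D1 = - (sigm (u p) * (1 - sigm (u p)))"
  define D2 where "D2 = sigm (u p) * (1 - sigm (u p)) * (1 - 2 * sigm (u p))"
  have e1: "(\<Sum>q\<in>P. (if q = p then D1 else 0) * z q) = D1 * z p"
    using assms by (simp add: if_distrib[of "\<lambda>x. x * _"] sum.delta cong: if_cong)
  have "(\<Sum>q\<in>P. \<Sum>r\<in>P. (if q = p \<and> r = p then D2 else 0) * z q * z r)
      = (\<Sum>q\<in>P. if q = p then D2 * z p * z p else 0)"
    using assms by (intro sum.cong) (auto simp: if_distrib[of "\<lambda>x. x * _"] sum.delta cong: if_cong)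
  also have "\<dots> = D2 * (z p)\<^sup>2" using assms by (simp add: power2_eq_square)
  finally have e2: "(\<Sum>q\<in>P. \<Sum>r\<in>P. (if q = p \<and> r = p then D2 else 0) * z q * z r) = D2 * (z p)\<^sup>2" .
  have "\<bar>z p\<bar> \<le> (\<Sum>p\<in>P. \<bar>z p\<bar>)" using assms by (intro member_le_sum) auto
  then have "\<bar>z p\<bar> ^ 3 \<le> (\<Sum>p\<in>P. \<bar>z p\<bar>) ^ 3" by (intro power_mono) auto
  then show "\<bar>sigm (u p + z p) -
          (sigm (u p) + (\<Sum>q\<in>P. (if q = p then - (sigm (u p) * (1 - sigm (u p))) else 0) * z q) +
           (\<Sum>q\<in>P. \<Sum>r\<in>P. (if q = p \<and> r = p then sigm (u p) * (1 - sigm (u p)) * (1 - 2 * sigm (u p)) else 0) * z q * z r) / 2)\<bar>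
        \<le> 13 * (\<Sum>p\<in>P. \<bar>z p\<bar>) ^ 3"
    using sigm_taylor[of "u p" "z p"] unfolding D1_def[symmetric] D2_def[symmetric] e1 e2 by linarith
qed auto

text \<open>A product of decreasing functions of the entries of row \<open>w\<close> has a
  nonpositive gradient, and its first and second derivatives live on that row. These facts are
  carried along because \<open>jet\<close> itself records no signs.\<close>

lemma jet_prod_sigm:
  assumes "finite P" "finite V" "\<And>v. v \<in> V \<Longrightarrow> (w, v) \<in> P"
  shows "\<exists>c e. jet P (\<lambda>u. \<Prod>v\<in>V. sigm (u (w, v))) c e \<and> (\<forall>u p. c u p \<le> 0) \<and>
    (\<forall>u p. fst p \<noteq> w \<longrightarrow> c u p = 0) \<and> (\<forall>u p q. \<not> (fst p = w \<and> fst q = w) \<longrightarrow> e u p q = 0)"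
  using assms(2,3)
proof (induction V rule: finite_induct)
  case empty
  show ?case
    using jet_const[of P 1] by (intro exI[of _ "\<lambda>_ _. 0"] exI[of _ "\<lambda>_ _ _. 0"]) auto
next
  case (insert v V)
  from insert obtain c e where ce: "jet P (\<lambda>u. \<Prod>v\<in>V. sigm (u (w, v))) c e" "\<And>u p. c u p \<le> 0"
    "\<And>u p. fst p \<noteq> w \<Longrightarrow> c u p = 0" "\<And>u p q. \<not> (fst p = w \<and> fst q = w) \<Longrightarrow> e u p q = 0" by auto
  have n: "0 \<le> (\<Prod>v\<in>V. sigm (u (w, v)))" for u by (intro prod_nonneg) (auto intro: less_imp_le sigm_pos)
  have s: "0 \<le> sigm x" "sigm x \<le> 1" for x by (auto intro: less_imp_le sigm_pos sigm_less_1)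
  have "(w, v) \<in> P" using insert by auto
  from jet_mult[OF \<open>finite P\<close> jet_sigm[OF \<open>finite P\<close> this] ce(1)] show ?case
    by (rule_tac exI, rule_tac exI, intro conjI)
       (use insert(1,2) in \<open>auto simp: ce n s mult_nonneg_nonneg mult_nonneg_nonpos intro!: add_nonpos_nonpos\<close>)
qed

text \<open>Each factor depends on one row only and is nondecreasing. A second derivative across two
  different rows therefore comes from differentiating two different factors once each, and is
  nonnegative. This is the sign condition of Gordon's inequality.\<close>

lemma jet_prod_one_minus_prod_sigm:
  assumes "finite P" "finite W" "finite V" "W \<times> V \<subseteq> P"
  shows "\<exists>c e. jet P (\<lambda>u. \<Prod>w\<in>W. 1 - (\<Prod>v\<in>V. sigm (u (w, v)))) c e \<and> (\<forall>u p. c u p \<ge> 0) \<and>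
    (\<forall>u p q. fst p \<noteq> fst q \<longrightarrow> e u p q \<ge> 0)"
  using assms(2,4)
proof (induction W rule: finite_induct)
  case empty
  show ?case
    using jet_const[of P 1] by (intro exI[of _ "\<lambda>_ _. 0"] exI[of _ "\<lambda>_ _ _. 0"]) auto
next
  case (insert w W)
  have "W \<times> V \<subseteq> P" using insert.prems by blast
  from insert.IH[OF this] obtain c e where ce: "jet P (\<lambda>u. \<Prod>w\<in>W. 1 - (\<Prod>v\<in>V. sigm (u (w, v)))) c e"
    "\<And>u p. c u p \<ge> 0" "\<And>u p q. fst p \<noteq> fst q \<Longrightarrow> e u p q \<ge> 0" by blast
  have "\<exists>c e. jet P (\<lambda>u. \<Prod>v\<in>V. sigm (u (w, v))) c e \<and> (\<forall>u p. c u p \<le> 0) \<and>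
    (\<forall>u p. fst p \<noteq> w \<longrightarrow> c u p = 0) \<and> (\<forall>u p q. \<not> (fst p = w \<and> fst q = w) \<longrightarrow> e u p q = 0)"
    using insert.prems by (intro jet_prod_sigm[OF \<open>finite P\<close> \<open>finite V\<close>]) auto
  then obtain c' e' where ce': "jet P (\<lambda>u. \<Prod>v\<in>V. sigm (u (w, v))) c' e'" "\<And>u p. c' u p \<le> 0"
    "\<And>u p q. \<not> (fst p = w \<and> fst q = w) \<Longrightarrow> e' u p q = 0"
    by blast
  have l: "(\<Prod>v\<in>V. sigm (u (w, v))) \<le> 1" for u w
    by (intro prod_le_1) (auto intro: less_imp_le sigm_pos sigm_less_1)
  have n: "0 \<le> (\<Prod>w\<in>W. 1 - (\<Prod>v\<in>V. sigm (u (w, v))))" for u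
    using l by (intro prod_nonneg) auto
  define c2 where "c2 = (\<lambda>u p. (1 - (\<Prod>v\<in>V. sigm (u (w, v)))) * c u p
    + (\<Prod>w\<in>W. 1 - (\<Prod>v\<in>V. sigm (u (w, v)))) * - c' u p)"
  define e2 where "e2 = (\<lambda>u p q. (1 - (\<Prod>v\<in>V. sigm (u (w, v)))) * e u p q
    + (\<Prod>w\<in>W. 1 - (\<Prod>v\<in>V. sigm (u (w, v)))) * - e' u p q + - c' u p * c u q + - c' u q * c u p)"
  have "jet P (\<lambda>u. \<Prod>w\<in>insert w W. 1 - (\<Prod>v\<in>V. sigm (u (w, v)))) c2 e2"
    using jet_mult[OF \<open>finite P\<close> jet_one_minus[OF ce'(1)] ce(1)] insert(1,2)
    by (simp add: c2_def e2_def)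
  moreover have "c2 u p \<ge> 0" for u p
    unfolding c2_def using l n ce ce' by (intro add_nonneg_nonneg mult_nonneg_nonneg) auto
  moreover have "e2 u p q \<ge> 0" if "fst p \<noteq> fst q" for u p q
  proof -
    \<comment> \<open>Indices with different first components cannot both lie in row
      \<open>w\<close>.\<close>
    have "e' u p q = 0" using ce'(3) that by metis
    then show ?thesis
      unfolding e2_def using l n ce(2) ce(3)[OF that] ce'(2)
      by (intro add_nonneg_nonneg mult_nonneg_nonneg) (simp_all add: mult_nonpos_nonneg)
  qed
  ultimately show ?case by blast
qed

subsection \<open>Standard Gaussian vectors\<close>

definition stdn :: "real measure" where
  "stdn = density lborel (\<lambda>x. ennreal (std_normal_density x))"

lemma sets_stdn [measurable_cong, simp]: "sets stdn = sets borel"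
  and space_stdn [simp]: "space stdn = UNIV"
  by (auto simp: stdn_def)

interpretation stdn: prob_space stdn
  unfolding stdn_def by (rule prob_space_normal_density) simp

lemma integrable_stdn_power: "integrable stdn (\<lambda>x. x ^ k)"
  and integrable_stdn_abs_power: "integrable stdn (\<lambda>x. \<bar>x\<bar> ^ k)"
  unfolding stdn_def
  using integrable_std_normal_moment[of k] integrable_std_normal_moment_abs[of k]
  by (auto simp: integrable_density normal_density_nonneg)

lemma integral_stdn_1: "(\<integral>x. x \<partial>stdn) = 0"
  and integral_stdn_2: "(\<integral>x. x\<^sup>2 \<partial>stdn) = 1"
  unfolding stdn_def
  using integral_std_normal_moment_odd[of 0] integral_std_normal_moment_even[of 1]
  by (auto simp: integral_density normal_density_nonneg)

lemma distr_stdn_scale: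
  assumes "0 < a"
  shows "distr stdn borel (\<lambda>x. a * x) = density lborel (\<lambda>x. ennreal (normal_density 0 a x))"
proof -
  have "distributed stdn lborel (\<lambda>x. x) std_normal_density"
    by (auto simp: distributed_def stdn_def distr_id2)
  from stdn.normal_density_affine[OF this, of a 0] assms
  have "distributed stdn lborel (\<lambda>x. a * x) (normal_density 0 a)" by simp
  then have "distr stdn lborel (\<lambda>x. a * x) = density lborel (\<lambda>x. ennreal (normal_density 0 a x))"
    by (simp add: distributed_def)
  moreover have "distr stdn lborel (\<lambda>x. a * x) = distr stdn borel (\<lambda>x. a * x)"
    by (rule distr_cong) auto
  ultimately show ?thesis by simp
qed

text \<open>The sum of two independent centred normal variables is normal, by convolution of
  densities. Zero coefficients are treated apart because a normal law of variance zero has no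
  density.\<close>

lemma nn_integral_stdn_combination:
  assumes [measurable]: "F \<in> borel_measurable borel" and "0 \<le> a" "0 \<le> b"
  shows "(\<integral>\<^sup>+x. \<integral>\<^sup>+y. F (a * x + b * y) \<partial>stdn \<partial>stdn) = (\<integral>\<^sup>+x. F (sqrt (a\<^sup>2 + b\<^sup>2) * x) \<partial>stdn)"
proof -
  consider "a = 0" | "b = 0" | "0 < a" "0 < b" using assms by linarith
  then show ?thesis
  proof cases
    case 1
    then show ?thesis using assms using stdn.emeasure_space_1 by simp
  next
    case 2
    then show ?thesis using assms using stdn.emeasure_space_1 by simp
  next
    case 3
    let ?N = "\<lambda>s. density lborel (\<lambda>x. ennreal (normal_density 0 s x))"
    have c: "0 < sqrt (a\<^sup>2 + b\<^sup>2)" using 3 by (simp add: add_pos_pos)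
    interpret A: prob_space "?N a" by (rule prob_space_normal_density) fact
    interpret B: prob_space "?N b" by (rule prob_space_normal_density) fact
    have "(\<integral>\<^sup>+x. F (sqrt (a\<^sup>2 + b\<^sup>2) * x) \<partial>stdn) = (\<integral>\<^sup>+x. F x \<partial>?N (sqrt (a\<^sup>2 + b\<^sup>2)))"
      by (simp flip: distr_stdn_scale[OF c] add: nn_integral_distr)
    also have "?N (sqrt (a\<^sup>2 + b\<^sup>2)) = (?N a \<star> ?N b)"
    proof -
      have "(?N a \<star> ?N b)
        = density lborel (\<lambda>x. \<integral>\<^sup>+y. ennreal (normal_density 0 a (x - y)) * ennreal (normal_density 0 b y) \<partial>lborel)"
        by (rule convolution_density) (auto intro!: A.finite_measure_axioms B.finite_measure_axioms)
      also have "\<dots> = ?N (sqrt (a\<^sup>2 + b\<^sup>2))"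
        using conv_normal_density_zero_mean[OF 3]
        by (simp add: ennreal_mult'[symmetric] normal_density_nonneg fun_eq_iff)
      finally show ?thesis by simp
    qed
    also have "(\<integral>\<^sup>+x. F x \<partial>(?N a \<star> ?N b)) = (\<integral>\<^sup>+x. \<integral>\<^sup>+y. F (x + y) \<partial>?N b \<partial>?N a)"
      by (rule nn_integral_convolution)
        (auto intro: A.finite_measure_axioms B.finite_measure_axioms)
    also have "\<dots> = (\<integral>\<^sup>+x. \<integral>\<^sup>+y. F (a * x + b * y) \<partial>stdn \<partial>stdn)"
      by (simp flip: distr_stdn_scale[OF 3(1)] distr_stdn_scale[OF 3(2)] add: nn_integral_distr)
    finally show ?thesis by simp
  qed
qed

section \<open>Gaussian vectors as product measures\<close>

definition gauss :: "'i set \<Rightarrow> ('i \<Rightarrow> real) measure" where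
  "gauss I = PiM I (\<lambda>_. stdn)"

lemma sets_gauss [measurable_cong]: "sets (gauss I) = sets (PiM I (\<lambda>_. borel))"
  unfolding gauss_def by (rule sets_PiM_cong) auto

text \<open>Points of the product space are undefined outside \<open>I\<close>; hence the
  restrictions \<open>\<lambda>i\<in>I\<close> in the statements about images of Gaussian
  vectors.\<close>

lemma space_gauss: "space (gauss I) = extensional I"
  by (auto simp: gauss_def space_PiM PiE_UNIV_domain PiE_def)

lemma prob_space_gauss: "prob_space (gauss I)"
  unfolding gauss_def by (rule prob_space_PiM) (rule stdn.prob_space_axioms)

lemma product_sigma_finite_stdn: "product_sigma_finite (\<lambda>_. stdn)"
  by standard

lemma gauss_component: "i \<in> I \<Longrightarrow> (\<lambda>x. x i) \<in> borel_measurable (gauss I)"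
  unfolding measurable_cong_sets[OF sets_gauss refl] by measurable

lemma
  assumes "finite I" "\<And>i. i \<in> I \<Longrightarrow> integrable stdn (g i)"
  shows integrable_gauss_prod: "integrable (gauss I) (\<lambda>x. \<Prod>i\<in>I. g i (x i) :: real)"
    and integral_gauss_prod: "(\<integral>x. (\<Prod>i\<in>I. g i (x i)) \<partial>gauss I) = (\<Prod>i\<in>I. \<integral>x. g i x \<partial>stdn)"
  unfolding gauss_def
  using product_sigma_finite.product_integrable_prod[OF product_sigma_finite_stdn assms]
    product_sigma_finite.product_integral_prod[OF product_sigma_finite_stdn assms] by auto

lemma
  assumes "finite I" "i \<in> I"
  shows integrable_gauss_component: "integrable stdn f \<Longrightarrow> integrable (gauss I) (\<lambda>x. f (x i) :: real)"
    and integral_gauss_component: "integrable stdn f \<Longrightarrow> (\<integral>x. f (x i) \<partial>gauss I) = (\<integral>x. f x \<partial>stdn)"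
proof -
  assume f: "integrable stdn f"
  let ?g = "\<lambda>j x. if j = i then f x else 1"
  have g: "integrable stdn (?g j)" for j using f by (cases "j = i") simp_all
  have 1: "(\<Prod>j\<in>I. ?g j (x j)) = f (x i)" for x
    using assms by (simp add: prod.delta)
  have 2: "(\<Prod>j\<in>I. \<integral>x. ?g j x \<partial>stdn) = (\<integral>x. f x \<partial>stdn)"
    using assms by (subst prod.remove[OF assms]) (auto simp: stdn.prob_space[simplified] intro!: prod.neutral)
  show "integrable (gauss I) (\<lambda>x. f (x i))" "(\<integral>x. f (x i) \<partial>gauss I) = (\<integral>x. f x \<partial>stdn)"
    using integrable_gauss_prod[where g = ?g, OF assms(1) g] integral_gauss_prod[where g = ?g, OF assms(1) g]
    by (simp_all only: 1 2)
qed

text \<open>The product \<open>x i * x j\<close> is written as a product over all coordinates of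
  functions of one coordinate. With two separate conditional factors the case \<open>i = j\<close>
  yields the square, so variance and covariance are treated together.\<close>

lemma
  assumes "finite I" "i \<in> I" "j \<in> I"
  shows integrable_gauss_mult: "integrable (gauss I) (\<lambda>x. x i * x j)"
    and integral_gauss_mult: "(\<integral>x. x i * x j \<partial>gauss I) = (if i = j then 1 else 0)"
proof -
  let ?g = "\<lambda>k x. (if k = i then x else 1) * (if k = j then x else 1) :: real"
  have g: "integrable stdn (?g k)" for k
    using integrable_stdn_power[of 1] integrable_stdn_power[of 2]
    by (cases "k = i"; cases "k = j") (simp_all add: power2_eq_square)
  have 1: "(\<Prod>k\<in>I. ?g k (x k)) = x i * x j" for x
    unfolding prod.distrib using assms by (simp add: prod.delta)
  have 2: "(\<Prod>k\<in>I. \<integral>x. ?g k x \<partial>stdn) = (if i = j then 1 else 0)"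
  proof (cases "i = j")
    case True
    have "(\<integral>x. ?g k x \<partial>stdn) = 1" for k
      using True integral_stdn_2 by (cases "k = j") (simp_all add: stdn.prob_space[simplified] power2_eq_square)
    then show ?thesis using True by (simp del: mult_cancel_left)
  next
    case False
    then have "(\<integral>x. ?g i x \<partial>stdn) = 0" using integral_stdn_1 by simp
    then show ?thesis using False assms by (auto intro!: prod_zero bexI[of _ i])
  qed
  show "integrable (gauss I) (\<lambda>x. x i * x j)" "(\<integral>x. x i * x j \<partial>gauss I) = (if i = j then 1 else 0)"
    using integrable_gauss_prod[where g = ?g, OF assms(1) g] integral_gauss_prod[where g = ?g, OF assms(1) g]
    by (simp_all only: 1 2)
qed

text \<open>Both sides agree on boxes: there the double integral factors over the coordinates, and
  each factor is the one-dimensional stability of the normal law.\<close>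

lemma distr_gauss_combination:
  assumes "finite I" "0 \<le> a" "0 \<le> b"
  shows "distr (gauss I \<Otimes>\<^sub>M gauss I) (PiM I (\<lambda>_. borel)) (\<lambda>(x, y). \<lambda>i\<in>I. a * x i + b * y i)
    = PiM I (\<lambda>_. distr stdn borel (\<lambda>x. sqrt (a\<^sup>2 + b\<^sup>2) * x))" (is "?L = PiM I (\<lambda>_. ?D)")
proof -
  interpret D: prob_space ?D by (rule stdn.prob_space_distr) simp
  interpret P: product_sigma_finite "\<lambda>_. ?D" by standard
  interpret S: product_sigma_finite "\<lambda>_. stdn" by (rule product_sigma_finite_stdn)
  interpret G: prob_space "gauss I" by (rule prob_space_gauss)
  have meas [measurable]: "(\<lambda>(x, y). \<lambda>i\<in>I. a * x i + b * y i) \<in> gauss I \<Otimes>\<^sub>M gauss I \<rightarrow>\<^sub>M PiM I (\<lambda>_. borel)"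
    unfolding case_prod_unfold by (intro measurable_restrict) measurable
  show ?thesis
  proof (rule P.PiM_eqI[OF \<open>finite I\<close>])
    show "sets ?L = sets (PiM I (\<lambda>_. ?D))" by (auto intro!: sets_PiM_cong)
    fix A assume "\<And>i. i \<in> I \<Longrightarrow> A i \<in> sets ?D"
    then have A [measurable]: "\<And>i. i \<in> I \<Longrightarrow> A i \<in> sets borel" by simp
    have box: "Pi\<^sub>E I A \<in> sets (PiM I (\<lambda>_. borel))"
      using A by (intro sets_PiM_I_finite[OF \<open>finite I\<close>]) auto
    have ind: "indicator (Pi\<^sub>E I A) (\<lambda>i\<in>I. z i) = (\<Prod>i\<in>I. indicator (A i) (z i) :: ennreal)" for z
    proof (cases "\<forall>i\<in>I. z i \<in> A i")
      case True
      then show ?thesis by (auto simp: PiE_iff intro!: prod.neutral)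
    next
      case False
      then have "(\<Prod>i\<in>I. indicator (A i) (z i) :: ennreal) = 0"
        using \<open>finite I\<close> by (intro prod_zero) (auto simp: indicator_def)
      then show ?thesis using False by (auto simp: PiE_iff)
    qed
    have "emeasure ?L (Pi\<^sub>E I A) = (\<integral>\<^sup>+z. indicator (Pi\<^sub>E I A) z \<partial>?L)"
      by (rule nn_integral_indicator[symmetric]) (simp add: box)
    also have "\<dots> = (\<integral>\<^sup>+z. indicator (Pi\<^sub>E I A) ((\<lambda>(x, y). \<lambda>i\<in>I. a * x i + b * y i) z) \<partial>(gauss I \<Otimes>\<^sub>M gauss I))"
      by (rule nn_integral_distr[OF meas]) (intro borel_measurable_indicator, simp add: box)
    also have "\<dots> = (\<integral>\<^sup>+x. \<integral>\<^sup>+y. indicator (Pi\<^sub>E I A) (\<lambda>i\<in>I. a * x i + b * y i) \<partial>gauss I \<partial>gauss I)"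
      using box by (subst G.nn_integral_fst[symmetric]) (auto intro!: measurable_compose[OF meas])
    also have "\<dots> = (\<integral>\<^sup>+x. \<integral>\<^sup>+y. (\<Prod>i\<in>I. indicator (A i) (a * x i + b * y i)) \<partial>gauss I \<partial>gauss I)"
      by (simp only: ind)
    also have "\<dots> = (\<integral>\<^sup>+x. (\<Prod>i\<in>I. \<integral>\<^sup>+y. indicator (A i) (a * x i + b * y) \<partial>stdn) \<partial>gauss I)"
      unfolding gauss_def
      by (intro nn_integral_cong S.product_nn_integral_prod \<open>finite I\<close>) measurable
    also have "\<dots> = (\<Prod>i\<in>I. \<integral>\<^sup>+x. \<integral>\<^sup>+y. indicator (A i) (a * x + b * y) \<partial>stdn \<partial>stdn)"
      unfolding gauss_def
      by (intro S.product_nn_integral_prod \<open>finite I\<close>) measurable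
    also have "\<dots> = (\<Prod>i\<in>I. emeasure ?D (A i))"
    proof (intro prod.cong refl)
      fix i assume i: "i \<in> I"
      have "(\<integral>\<^sup>+x. \<integral>\<^sup>+y. indicator (A i) (a * x + b * y) \<partial>stdn \<partial>stdn)
        = (\<integral>\<^sup>+x. indicator (A i) (sqrt (a\<^sup>2 + b\<^sup>2) * x) \<partial>stdn)"
        using i assms by (intro nn_integral_stdn_combination) measurable
      also have "\<dots> = (\<integral>\<^sup>+x. indicator (A i) x \<partial>?D)"
        using i by (subst nn_integral_distr) auto
      also have "\<dots> = emeasure ?D (A i)" using A[OF i] by simp
      finally show "(\<integral>\<^sup>+x. \<integral>\<^sup>+y. indicator (A i) (a * x + b * y) \<partial>stdn \<partial>stdn) = emeasure ?D (A i)" .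
    qed
    finally show "emeasure ?L (Pi\<^sub>E I A) = (\<Prod>i\<in>I. emeasure ?D (A i))" .
  qed
qed

lemma distr_gauss_scale:
  assumes "finite I" "0 \<le> c"
  shows "distr (gauss I) (PiM I (\<lambda>_. borel)) (\<lambda>x. \<lambda>i\<in>I. c * x i) = PiM I (\<lambda>_. distr stdn borel (\<lambda>x. c * x))"
proof -
  interpret G: prob_space "gauss I" by (rule prob_space_gauss)
  have m: "(\<lambda>x. \<lambda>i\<in>I. c * x i) \<in> gauss I \<rightarrow>\<^sub>M PiM I (\<lambda>_. borel)"
    by (intro measurable_restrict) measurable
  \<comment> \<open>The case of second coefficient 0 in the combination; the second vector then
    disappears by projection to the first marginal.\<close>
  have "PiM I (\<lambda>_. distr stdn borel (\<lambda>x. c * x))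
    = distr (gauss I \<Otimes>\<^sub>M gauss I) (PiM I (\<lambda>_. borel)) (\<lambda>z. \<lambda>i\<in>I. c * fst z i)"
    using distr_gauss_combination[OF \<open>finite I\<close> \<open>0 \<le> c\<close>, of 0] \<open>0 \<le> c\<close>
    by (simp add: case_prod_unfold del: restrict_apply)
  also have "\<dots> = distr (distr (gauss I \<Otimes>\<^sub>M gauss I) (gauss I) fst) (PiM I (\<lambda>_. borel)) (\<lambda>x. \<lambda>i\<in>I. c * x i)"
    by (subst distr_distr[OF m measurable_fst]) (simp add: comp_def del: restrict_apply)
  also have "distr (gauss I \<Otimes>\<^sub>M gauss I) (gauss I) fst = gauss I"
    by (rule G.distr_pair_fst)
  finally show ?thesis by (rule sym)
qed

text \<open>Read from left to right, this splits a Gaussian vector into two independent parts with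
  variances \<open>a\<^sup>2\<close> and \<open>b\<^sup>2\<close>. Boundedness of \<open>F\<close>
  supplies the integrability for Fubini.\<close>

lemma integral_gauss_combination:
  fixes F :: "('i \<Rightarrow> real) \<Rightarrow> real"
  assumes "finite I" "0 \<le> a" "0 \<le> b"
    and F [measurable]: "F \<in> borel_measurable (PiM I (\<lambda>_. borel))" and bdd: "\<And>x. \<bar>F x\<bar> \<le> K"
  shows "(\<integral>x. F (\<lambda>i\<in>I. sqrt (a\<^sup>2 + b\<^sup>2) * x i) \<partial>gauss I)
    = (\<integral>x. \<integral>y. F (\<lambda>i\<in>I. a * x i + b * y i) \<partial>gauss I \<partial>gauss I)"
proof -
  interpret G: prob_space "gauss I" by (rule prob_space_gauss)
  interpret GG: pair_prob_space "gauss I" "gauss I" by standard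
  have m1: "(\<lambda>x. \<lambda>i\<in>I. c * x i) \<in> gauss I \<rightarrow>\<^sub>M PiM I (\<lambda>_. borel)" for c
    by (intro measurable_restrict) measurable
  have m2: "(\<lambda>(x, y). \<lambda>i\<in>I. a * x i + b * y i) \<in> gauss I \<Otimes>\<^sub>M gauss I \<rightarrow>\<^sub>M PiM I (\<lambda>_. borel)"
    unfolding case_prod_unfold by (intro measurable_restrict) measurable
  have "(\<integral>x. F (\<lambda>i\<in>I. sqrt (a\<^sup>2 + b\<^sup>2) * x i) \<partial>gauss I)
    = (\<integral>z. F z \<partial>PiM I (\<lambda>_. distr stdn borel (\<lambda>x. sqrt (a\<^sup>2 + b\<^sup>2) * x)))"
    using assms m1 by (subst distr_gauss_scale[symmetric]) (auto simp: integral_distr)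
  also have "\<dots> = (\<integral>z. F (\<lambda>i\<in>I. a * fst z i + b * snd z i) \<partial>(gauss I \<Otimes>\<^sub>M gauss I))"
    using assms m2 by (subst distr_gauss_combination[symmetric]) (auto simp: integral_distr case_prod_unfold)
  also have "\<dots> = (\<integral>x. \<integral>y. F (\<lambda>i\<in>I. a * x i + b * y i) \<partial>gauss I \<partial>gauss I)"
  proof (subst GG.integral_fst'[symmetric])
    show "integrable (gauss I \<Otimes>\<^sub>M gauss I) (\<lambda>z. F (\<lambda>i\<in>I. a * fst z i + b * snd z i))"
      using measurable_compose[OF m2 F] bdd
      by (intro GG.integrable_const_bound[of _ K]) (auto simp: case_prod_unfold)
  qed simp
  finally show ?thesis .
qed

subsection \<open>Gordon's comparison inequality\<close>

text \<open>The integral of a non-integrable function is 0 by convention, and \<open>K\<close> is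
  nonnegative, so the bound can be applied without measurability conditions.\<close>

lemma (in prob_space) abs_integral_le:
  fixes f :: "'a \<Rightarrow> real"
  assumes "\<And>x. \<bar>f x\<bar> \<le> K"
  shows "\<bar>\<integral>x. f x \<partial>M\<bar> \<le> K"
proof (cases "integrable M f")
  case True
  have "\<bar>\<integral>x. f x \<partial>M\<bar> \<le> (\<integral>x. \<bar>f x\<bar> \<partial>M)" by (rule integral_abs_bound)
  also have "\<dots> \<le> K" using True assms by (intro integral_le_const) auto
  finally show ?thesis .
next
  case False
  have "0 \<le> K" using assms order_trans[OF abs_ge_zero] by blast
  then show ?thesis using False by (simp add: not_integrable_integral_eq)
qed

text \<open>A centred Gaussian process in \<open>p\<close>, driven by the vector \<open>x\<close>.
  Its covariance at \<open>p\<close> and \<open>q\<close> is the inner product of the coefficient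
  rows \<open>a p\<close> and \<open>a q\<close>, so covariances can be compared as finite
  sums.\<close>

definition lin :: "'i set \<Rightarrow> ('p \<Rightarrow> 'i \<Rightarrow> real) \<Rightarrow> ('i \<Rightarrow> real) \<Rightarrow> 'p \<Rightarrow> real" where
  "lin I a x p = (\<Sum>i\<in>I. a p i * x i)"

lemma lin_restrict: "lin I a (\<lambda>i\<in>I. x i) p = lin I a x p"
  by (simp add: lin_def)

lemma lin_add: "lin I a (\<lambda>i. x i + y i) p = lin I a x p + lin I a y p"
  by (simp add: lin_def algebra_simps sum.distrib)

lemma lin_mult: "lin I a (\<lambda>i. c * x i) p = c * lin I a x p"
  by (simp add: lin_def algebra_simps sum_distrib_left)

lemma measurable_lin:
  assumes "\<And>i. i \<in> I \<Longrightarrow> (\<lambda>z. g z i) \<in> borel_measurable N"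
  shows "(\<lambda>z. lin I a (g z) p) \<in> borel_measurable N"
  unfolding lin_def using assms by measurable

lemma measurable_gauss_component:
  assumes "g \<in> N \<rightarrow>\<^sub>M gauss I" "i \<in> I"
  shows "(\<lambda>z. g z i) \<in> borel_measurable N"
  using measurable_compose[OF assms(1) gauss_component[OF assms(2)]] .

text \<open>
  A smooth version of the indicator of \<open>\<forall>w\<in>W. \<exists>v\<in>V. u (w, v) > 0\<close>; its mixed second derivatives
  for distinct \<open>w\<close> are nonnegative.
\<close>

definition soft :: "'w set \<Rightarrow> 'v set \<Rightarrow> ('w \<times> 'v \<Rightarrow> real) \<Rightarrow> real" where
  "soft W V u = (\<Prod>w\<in>W. 1 - (\<Prod>v\<in>V. sigm (u (w, v))))"

lemma measurable_soft:
  assumes [measurable]: "\<And>p. (\<lambda>z. Y z p) \<in> borel_measurable N"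
  shows "(\<lambda>z. soft W V (Y z)) \<in> borel_measurable N"
  unfolding soft_def sigm_def by measurable

lemma soft_nonneg: "0 \<le> soft W V u" and soft_le_1: "soft W V u \<le> 1"
proof -
  have 1: "0 \<le> (\<Prod>v\<in>V. sigm (u (w, v)))" "(\<Prod>v\<in>V. sigm (u (w, v))) \<le> 1" for w
    by (auto intro!: prod_nonneg prod_le_1 intro: less_imp_le sigm_pos sigm_less_1)
  show "0 \<le> soft W V u" "soft W V u \<le> 1"
    unfolding soft_def using 1 by (auto intro!: prod_nonneg prod_le_1)
qed

lemma abs_soft: "\<bar>soft W V u\<bar> \<le> 1"
  using soft_nonneg[of W V u] soft_le_1[of W V u] by simp

section \<open>Moments of linear forms and expansion of Gaussian expectations\<close>

lemma has_integral_lin: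
  assumes "finite I"
  shows "has_bochner_integral (gauss I) (\<lambda>x. lin I a x p) 0"
proof -
  have "has_bochner_integral (gauss I) (\<lambda>x. x i) 0" if "i \<in> I" for i
    using integrable_gauss_component[OF assms that, of "\<lambda>x. x"]
      integral_gauss_component[OF assms that, of "\<lambda>x. x"] integrable_stdn_power[of 1] integral_stdn_1
    by (simp add: has_bochner_integral_iff)
  then have "has_bochner_integral (gauss I) (\<lambda>x. lin I a x p) (\<Sum>i\<in>I. a p i * 0)"
    unfolding lin_def by (intro has_bochner_integral_sum has_bochner_integral_mult_right)
  then show ?thesis by simp
qed

lemma has_integral_lin_mult:
  assumes "finite I"
  shows "has_bochner_integral (gauss I) (\<lambda>x. lin I a x p * lin I a x q) (\<Sum>i\<in>I. a p i * a q i)"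
proof -
  have "has_bochner_integral (gauss I) (\<lambda>x. x i * x j) (if i = j then 1 else 0)" if "i \<in> I" "j \<in> I" for i j
    using integrable_gauss_mult[OF assms that] integral_gauss_mult[OF assms that]
    by (simp add: has_bochner_integral_iff)
  then have "has_bochner_integral (gauss I) (\<lambda>x. \<Sum>i\<in>I. \<Sum>j\<in>I. (a p i * a q j) * (x i * x j))
    (\<Sum>i\<in>I. \<Sum>j\<in>I. (a p i * a q j) * (if i = j then 1 else 0))"
    by (intro has_bochner_integral_sum has_bochner_integral_mult_right)
  also have "(\<lambda>x. \<Sum>i\<in>I. \<Sum>j\<in>I. (a p i * a q j) * (x i * x j)) = (\<lambda>x. lin I a x p * lin I a x q)"
    by (simp add: lin_def sum_product mult_ac)
  also have "(\<Sum>i\<in>I. \<Sum>j\<in>I. (a p i * a q j) * (if i = j then 1 else 0)) = (\<Sum>i\<in>I. a p i * a q i)"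
    using assms by (simp add: if_distrib cong: if_cong)
  finally show ?thesis .
qed

lemma integrable_cube_sum_lin:
  assumes "finite I"
  shows "integrable (gauss I) (\<lambda>x. (\<Sum>p\<in>P. \<bar>lin I a x p\<bar>) ^ 3)"
proof -
  define A where "A = (\<Sum>p\<in>P. \<Sum>i\<in>I. \<bar>a p i\<bar>)"
  have A: "A \<ge> 0" by (auto simp: A_def intro!: sum_nonneg)
  have "integrable (gauss I) (\<lambda>x. \<bar>x i\<bar> ^ 3)" if "i \<in> I" for i
    using integrable_gauss_component[OF assms that integrable_stdn_abs_power] .
  then have int: "integrable (gauss I) (\<lambda>x. A ^ 3 * (\<Sum>i\<in>I. \<bar>x i\<bar> ^ 3))" by simp
  show ?thesis
  proof (rule Bochner_Integration.integrable_bound[OF int])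
    show "(\<lambda>x. (\<Sum>p\<in>P. \<bar>lin I a x p\<bar>) ^ 3) \<in> borel_measurable (gauss I)"
      by (intro borel_measurable_power borel_measurable_sum borel_measurable_abs measurable_lin gauss_component)
    show "AE x in gauss I. norm ((\<Sum>p\<in>P. \<bar>lin I a x p\<bar>) ^ 3) \<le> norm (A ^ 3 * (\<Sum>i\<in>I. \<bar>x i\<bar> ^ 3))"
    proof (rule AE_I2)
      fix x
      show "norm ((\<Sum>p\<in>P. \<bar>lin I a x p\<bar>) ^ 3) \<le> norm (A ^ 3 * (\<Sum>i\<in>I. \<bar>x i\<bar> ^ 3))"
      proof (cases "I = {}")
        case True then show ?thesis by (simp add: lin_def)
      next
        case False
        \<comment> \<open>The sum is at most \<open>A\<close> times the largest coordinate, and the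
          cube of that coordinate is one summand of the sum of cubes. An empty \<open>I\<close> has
          no maximum, hence the case distinction.\<close>
        define m where "m = Max ((\<lambda>i. \<bar>x i\<bar>) ` I)"
        have mI: "m \<in> (\<lambda>i. \<bar>x i\<bar>) ` I" unfolding m_def using False assms by (intro Max_in) auto
        have m: "\<bar>x i\<bar> \<le> m" if "i \<in> I" for i unfolding m_def using assms that by simp
        have "(\<Sum>p\<in>P. \<bar>lin I a x p\<bar>) \<le> A * m"
          unfolding lin_def A_def sum_distrib_right
          by (intro sum_mono order_trans[OF sum_abs]) (auto simp: abs_mult intro!: mult_left_mono m)
        then have "(\<Sum>p\<in>P. \<bar>lin I a x p\<bar>) ^ 3 \<le> (A * m) ^ 3"
          by (intro power_mono sum_nonneg) auto
        also have "\<dots> = A ^ 3 * m ^ 3" by (simp add: power_mult_distrib)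
        also have "m ^ 3 \<le> (\<Sum>i\<in>I. \<bar>x i\<bar> ^ 3)"
        proof -
          obtain i where "i \<in> I" "m = \<bar>x i\<bar>" using mI by blast
          then show ?thesis using assms by (auto intro!: member_le_sum[of i I "\<lambda>i. \<bar>x i\<bar> ^ 3"])
        qed
        finally have "(\<Sum>p\<in>P. \<bar>lin I a x p\<bar>) ^ 3 \<le> A ^ 3 * (\<Sum>i\<in>I. \<bar>x i\<bar> ^ 3)"
          using A by (simp add: mult_left_mono)
        then show ?thesis using A by (simp add: sum_nonneg)
      qed
    qed
  qed
qed

text \<open>Integrating the second-order expansion kills the gradient term and turns the Hessian
  term into a pairing with the covariance. The constant is the jet constant times the third moment
  \<open>m\<close>; it depends neither on \<open>u\<close> nor on \<open>s\<close>.\<close>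

lemma gauss_expansion:
  fixes f :: "('p \<Rightarrow> real) \<Rightarrow> real" and a :: "'p \<Rightarrow> 'i \<Rightarrow> real"
  assumes "finite I" "jet P f c e"
    and meas: "\<And>u s. (\<lambda>x. f (\<lambda>p. u p + s * lin I a x p)) \<in> borel_measurable (gauss I)"
  shows "\<exists>K\<ge>0. \<forall>u. \<forall>s\<ge>0. \<bar>(\<integral>x. f (\<lambda>p. u p + s * lin I a x p) \<partial>gauss I)
     - (f u + s\<^sup>2 / 2 * (\<Sum>p\<in>P. \<Sum>q\<in>P. e u p q * (\<Sum>i\<in>I. a p i * a q i)))\<bar> \<le> K * s ^ 3"
proof -
  interpret G: prob_space "gauss I" by (rule prob_space_gauss)
  obtain C where C: "C \<ge> 0" "\<And>u. \<bar>f u\<bar> \<le> C"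
    "\<And>u z. \<bar>f (\<lambda>p. u p + z p) - (f u + (\<Sum>p\<in>P. c u p * z p) + (\<Sum>p\<in>P. \<Sum>q\<in>P. e u p q * z p * z q) / 2)\<bar>
          \<le> C * (\<Sum>p\<in>P. \<bar>z p\<bar>) ^ 3"
    using assms(2) unfolding jet_def by blast
  define m where "m = (\<integral>x. (\<Sum>p\<in>P. \<bar>lin I a x p\<bar>) ^ 3 \<partial>gauss I)"
  have m: "m \<ge> 0" unfolding m_def by (intro integral_nonneg_AE AE_I2) (auto intro: sum_nonneg)
  show ?thesis
  proof (intro exI[of _ "C * m"] conjI allI impI)
    fix u and s :: real assume s: "s \<ge> 0"
    define poly where "poly x = f u + (\<Sum>p\<in>P. (c u p * s) * lin I a x p)
      + (\<Sum>p\<in>P. \<Sum>q\<in>P. (e u p q * s\<^sup>2 / 2) * (lin I a x p * lin I a x q))" for x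
    have "has_bochner_integral (gauss I) poly (f u + (\<Sum>p\<in>P. (c u p * s) * 0)
      + (\<Sum>p\<in>P. \<Sum>q\<in>P. (e u p q * s\<^sup>2 / 2) * (\<Sum>i\<in>I. a p i * a q i)))"
      unfolding poly_def
      by (intro has_bochner_integral_add has_bochner_integral_sum has_bochner_integral_mult_right
          has_integral_lin has_integral_lin_mult \<open>finite I\<close>)
        (simp add: has_bochner_integral_iff G.prob_space)
    moreover have "f u + (\<Sum>p\<in>P. (c u p * s) * 0)
      + (\<Sum>p\<in>P. \<Sum>q\<in>P. (e u p q * s\<^sup>2 / 2) * (\<Sum>i\<in>I. a p i * a q i))
      = f u + s\<^sup>2 / 2 * (\<Sum>p\<in>P. \<Sum>q\<in>P. e u p q * (\<Sum>i\<in>I. a p i * a q i))"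
      by (simp add: sum_distrib_left sum_divide_distrib mult_ac)
    ultimately have poly: "integrable (gauss I) poly" "(\<integral>x. poly x \<partial>gauss I)
      = f u + s\<^sup>2 / 2 * (\<Sum>p\<in>P. \<Sum>q\<in>P. e u p q * (\<Sum>i\<in>I. a p i * a q i))"
      by (auto simp: has_bochner_integral_iff)
    have intf: "integrable (gauss I) (\<lambda>x. f (\<lambda>p. u p + s * lin I a x p))"
      using meas C by (intro G.integrable_const_bound[of _ C]) auto
    have bd: "\<bar>f (\<lambda>p. u p + s * lin I a x p) - poly x\<bar> \<le> C * s ^ 3 * (\<Sum>p\<in>P. \<bar>lin I a x p\<bar>) ^ 3" for x
    proof -
      have "(\<Sum>p\<in>P. \<bar>s * lin I a x p\<bar>) = s * (\<Sum>p\<in>P. \<bar>lin I a x p\<bar>)"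
        using s by (simp add: abs_mult sum_distrib_left)
      moreover have "(\<Sum>p\<in>P. c u p * (s * lin I a x p)) = (\<Sum>p\<in>P. (c u p * s) * lin I a x p)"
        by (simp add: mult_ac)
      moreover have "(\<Sum>p\<in>P. \<Sum>q\<in>P. e u p q * (s * lin I a x p) * (s * lin I a x q)) / 2
        = (\<Sum>p\<in>P. \<Sum>q\<in>P. (e u p q * s\<^sup>2 / 2) * (lin I a x p * lin I a x q))"
        by (simp add: sum_divide_distrib power2_eq_square mult_ac)
      ultimately show ?thesis
        using C(3)[of u "\<lambda>p. s * lin I a x p"] by (simp add: poly_def power_mult_distrib mult_ac)
    qed
    have "\<bar>(\<integral>x. f (\<lambda>p. u p + s * lin I a x p) \<partial>gauss I) - (\<integral>x. poly x \<partial>gauss I)\<bar>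
      = \<bar>\<integral>x. f (\<lambda>p. u p + s * lin I a x p) - poly x \<partial>gauss I\<bar>"
      using intf poly by simp
    also have "\<dots> \<le> (\<integral>x. \<bar>f (\<lambda>p. u p + s * lin I a x p) - poly x\<bar> \<partial>gauss I)"
      by (rule integral_abs_bound)
    also have "\<dots> \<le> (\<integral>x. C * s ^ 3 * (\<Sum>p\<in>P. \<bar>lin I a x p\<bar>) ^ 3 \<partial>gauss I)"
      using intf poly bd integrable_cube_sum_lin[OF \<open>finite I\<close>]
      by (intro integral_mono) auto
    also have "\<dots> = C * m * s ^ 3" by (simp add: m_def)
    finally show "\<bar>(\<integral>x. f (\<lambda>p. u p + s * lin I a x p) \<partial>gauss I)
     - (f u + s\<^sup>2 / 2 * (\<Sum>p\<in>P. \<Sum>q\<in>P. e u p q * (\<Sum>i\<in>I. a p i * a q i)))\<bar> \<le> C * m * s ^ 3"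
      by (simp only: poly)
  qed (use C m in auto)
qed

text \<open>Only index pairs from different rows contribute to the difference of the two quadratic
  terms, and there the larger covariance meets a nonnegative second derivative. The cubic remainders
  of both expansions make up \<open>K\<close>.\<close>

lemma gordon_increment:
  fixes a :: "'w \<times> 'v \<Rightarrow> 'i \<Rightarrow> real" and b :: "'w \<times> 'v \<Rightarrow> 'j \<Rightarrow> real"
  assumes fin: "finite I" "finite J" "finite W" "finite V"
    and le: "\<And>p q. p \<in> W \<times> V \<Longrightarrow> q \<in> W \<times> V \<Longrightarrow> (\<Sum>j\<in>J. b p j * b q j) \<le> (\<Sum>i\<in>I. a p i * a q i)"
    and eq: "\<And>p q. p \<in> W \<times> V \<Longrightarrow> q \<in> W \<times> V \<Longrightarrow> fst p = fst q \<Longrightarrow>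
      (\<Sum>j\<in>J. b p j * b q j) = (\<Sum>i\<in>I. a p i * a q i)"
  shows "\<exists>K\<ge>0. \<forall>u. \<forall>s\<ge>0. (\<integral>y. soft W V (\<lambda>p. u p + s * lin J b y p) \<partial>gauss J)
    \<le> (\<integral>x. soft W V (\<lambda>p. u p + s * lin I a x p) \<partial>gauss I) + K * s ^ 3"
proof -
  obtain c e where jet: "jet (W \<times> V) (soft W V) c e" and e: "\<And>u p q. fst p \<noteq> fst q \<Longrightarrow> e u p q \<ge> 0"
    using jet_prod_one_minus_prod_sigm[of "W \<times> V" W V] fin unfolding soft_def[abs_def] by blast
  have meas: "(\<lambda>x. soft W V (\<lambda>p. u p + s * lin K d x p)) \<in> borel_measurable (gauss K)"
    for u s and K :: "'k set" and d
    by (intro measurable_soft borel_measurable_add borel_measurable_times borel_measurable_const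
        measurable_lin gauss_component)
  obtain K1 where K1: "K1 \<ge> 0" "\<And>u s. s \<ge> 0 \<Longrightarrow>
      \<bar>(\<integral>x. soft W V (\<lambda>p. u p + s * lin I a x p) \<partial>gauss I)
       - (soft W V u + s\<^sup>2 / 2 * (\<Sum>p\<in>W \<times> V. \<Sum>q\<in>W \<times> V. e u p q * (\<Sum>i\<in>I. a p i * a q i)))\<bar> \<le> K1 * s ^ 3"
    using gauss_expansion[OF fin(1) jet meas] by blast
  obtain K2 where K2: "K2 \<ge> 0" "\<And>u s. s \<ge> 0 \<Longrightarrow>
      \<bar>(\<integral>x. soft W V (\<lambda>p. u p + s * lin J b x p) \<partial>gauss J)
       - (soft W V u + s\<^sup>2 / 2 * (\<Sum>p\<in>W \<times> V. \<Sum>q\<in>W \<times> V. e u p q * (\<Sum>i\<in>J. b p i * b q i)))\<bar> \<le> K2 * s ^ 3"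
    using gauss_expansion[OF fin(2) jet meas] by blast
  show ?thesis
  proof (intro exI[of _ "K1 + K2"] conjI allI impI)
    fix u and s :: real assume s: "s \<ge> 0"
    have "(\<Sum>p\<in>W \<times> V. \<Sum>q\<in>W \<times> V. e u p q * (\<Sum>i\<in>J. b p i * b q i))
      \<le> (\<Sum>p\<in>W \<times> V. \<Sum>q\<in>W \<times> V. e u p q * (\<Sum>i\<in>I. a p i * a q i))"
    proof (intro sum_mono)
      fix p q assume pq: "p \<in> W \<times> V" "q \<in> W \<times> V"
      show "e u p q * (\<Sum>i\<in>J. b p i * b q i) \<le> e u p q * (\<Sum>i\<in>I. a p i * a q i)"
        using eq[OF pq] le[OF pq] e[of p q u] by (cases "fst p = fst q") (auto intro: mult_left_mono)
    qed
    then have "s\<^sup>2 / 2 * (\<Sum>p\<in>W \<times> V. \<Sum>q\<in>W \<times> V. e u p q * (\<Sum>i\<in>J. b p i * b q i))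
      \<le> s\<^sup>2 / 2 * (\<Sum>p\<in>W \<times> V. \<Sum>q\<in>W \<times> V. e u p q * (\<Sum>i\<in>I. a p i * a q i))"
      by (intro mult_left_mono) auto
    then show "(\<integral>y. soft W V (\<lambda>p. u p + s * lin J b y p) \<partial>gauss J)
      \<le> (\<integral>x. soft W V (\<lambda>p. u p + s * lin I a x p) \<partial>gauss I) + (K1 + K2) * s ^ 3"
      using K1(2)[OF s, of u] K2(2)[OF s, of u] unfolding distrib_right by linarith
  qed (use K1 K2 in auto)
qed


section \<open>Interpolation between the two processes\<close>

lemma integrable_soft:
  assumes "finite_measure N" "\<And>p. (\<lambda>z. Y z p) \<in> borel_measurable N"
  shows "integrable N (\<lambda>z. soft W V (Y z))"
  using measurable_soft[OF assms(2)] abs_soft[of W V]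
  by (intro finite_measure.integrable_const_bound[OF assms(1), of _ 1]) auto

lemma gordon_smooth:
  fixes a :: "'w \<times> 'v \<Rightarrow> 'i \<Rightarrow> real" and b :: "'w \<times> 'v \<Rightarrow> 'j \<Rightarrow> real"
  assumes fin: "finite I" "finite J" "finite W" "finite V"
    and le: "\<And>p q. p \<in> W \<times> V \<Longrightarrow> q \<in> W \<times> V \<Longrightarrow> (\<Sum>j\<in>J. b p j * b q j) \<le> (\<Sum>i\<in>I. a p i * a q i)"
    and eq: "\<And>p q. p \<in> W \<times> V \<Longrightarrow> q \<in> W \<times> V \<Longrightarrow> fst p = fst q \<Longrightarrow>
      (\<Sum>j\<in>J. b p j * b q j) = (\<Sum>i\<in>I. a p i * a q i)"
  shows "(\<integral>y. soft W V (\<lambda>p. u p + lin J b y p) \<partial>gauss J) \<le> (\<integral>x. soft W V (\<lambda>p. u p + lin I a x p) \<partial>gauss I)"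
proof -
  interpret I: prob_space "gauss I" by (rule prob_space_gauss)
  interpret J: prob_space "gauss J" by (rule prob_space_gauss)
  interpret IJ: pair_prob_space "gauss I" "gauss J" by standard
  interpret JI: pair_prob_space "gauss J" "gauss I" by standard
  \<comment> \<open>Variance \<open>t\<close> sits on the first process and \<open>1 - t\<close> on
    the second, so \<open>h 0\<close> and \<open>h 1\<close> are the two sides of the claim.\<close>
  define h where "h t = (\<integral>x. \<integral>y. soft W V (\<lambda>p. u p + sqrt t * lin I a x p + sqrt (1 - t) * lin J b y p)
    \<partial>gauss J \<partial>gauss I)" for t
  have "\<exists>K\<ge>0. \<forall>u. \<forall>s\<ge>0. (\<integral>y. soft W V (\<lambda>p. u p + s * lin J b y p) \<partial>gauss J)
    \<le> (\<integral>x. soft W V (\<lambda>p. u p + s * lin I a x p) \<partial>gauss I) + K * s ^ 3"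
    by (rule gordon_increment[OF fin]) (erule (1) le, erule (2) eq)
  then obtain K where K: "K \<ge> 0" "\<And>u s. s \<ge> 0 \<Longrightarrow> (\<integral>y. soft W V (\<lambda>p. u p + s * lin J b y p) \<partial>gauss J)
    \<le> (\<integral>x. soft W V (\<lambda>p. u p + s * lin I a x p) \<partial>gauss I) + K * s ^ 3"
    by (elim exE conjE) (rule that, assumption, drule spec, drule spec, erule (1) mp)
  note mi = borel_measurable_add borel_measurable_times borel_measurable_const measurable_lin
  have step: "h t \<le> h (t + s) + K * sqrt s ^ 3" if ts: "0 \<le> t" "0 \<le> s" "t + s \<le> 1" for t s
  proof -
    \<comment> \<open>\<open>r\<close> is the variance of the second process common to times
      \<open>t\<close> and \<open>t + s\<close>, and \<open>D\<close> collects everything the two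
      times share; they differ by who supplies the increment of variance \<open>s\<close>.\<close>
    define r where "r = 1 - t - s"
    have r: "r \<ge> 0" "1 - (t + s) = r" "1 - t = r + s" using ts by (auto simp: r_def)
    define D where "D = (\<lambda>x y u p. u p + sqrt t * lin I a x p + sqrt r * lin J b y p)"
    define F where "F z = (\<integral>y. soft W V (\<lambda>p. u p + lin I a z p + sqrt r * lin J b y p) \<partial>gauss J)" for z
    have "F \<in> borel_measurable (PiM I (\<lambda>_. borel))"
      unfolding F_def
      by (intro J.borel_measurable_lebesgue_integral, unfold case_prod_unfold, intro measurable_soft mi)
        (auto intro!: measurable_compose[OF measurable_fst] measurable_gauss_component[OF measurable_snd])
    moreover have "\<bar>F z\<bar> \<le> 1" for z unfolding F_def by (intro J.abs_integral_le abs_soft)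
    ultimately have "(\<integral>x. F (\<lambda>i\<in>I. sqrt ((sqrt t)\<^sup>2 + (sqrt s)\<^sup>2) * x i) \<partial>gauss I)
      = (\<integral>x. \<integral>x'. F (\<lambda>i\<in>I. sqrt t * x i + sqrt s * x' i) \<partial>gauss I \<partial>gauss I)"
      using ts by (intro integral_gauss_combination fin) auto
    moreover have "h (t + s) = (\<integral>x. F (\<lambda>i\<in>I. sqrt ((sqrt t)\<^sup>2 + (sqrt s)\<^sup>2) * x i) \<partial>gauss I)"
      unfolding h_def r(2) F_def lin_restrict lin_mult using ts by simp
    ultimately have "h (t + s) = (\<integral>x. \<integral>x'. \<integral>y. soft W V (\<lambda>p. D x y u p + sqrt s * lin I a x' p)
        \<partial>gauss J \<partial>gauss I \<partial>gauss I)"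
      by (simp add: F_def D_def lin_restrict lin_add lin_mult add_ac)
    \<comment> \<open>Fubini moves the increment innermost, so that the increment bound applies with
      the base point \<open>D x y u\<close> held fixed.\<close>
    also have "\<dots> = (\<integral>x. \<integral>y. \<integral>x'. soft W V (\<lambda>p. D x y u p + sqrt s * lin I a x' p)
        \<partial>gauss I \<partial>gauss J \<partial>gauss I)"
    proof (rule Bochner_Integration.integral_cong[OF refl])
      fix x
      show "(\<integral>x'. \<integral>y. soft W V (\<lambda>p. D x y u p + sqrt s * lin I a x' p) \<partial>gauss J \<partial>gauss I)
        = (\<integral>y. \<integral>x'. soft W V (\<lambda>p. D x y u p + sqrt s * lin I a x' p) \<partial>gauss I \<partial>gauss J)"
        unfolding D_def
        by (rule JI.Fubini_integral, unfold case_prod_unfold, intro integrable_soft mi JI.finite_measure_axioms)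
           (auto intro!: measurable_gauss_component[OF measurable_snd] measurable_gauss_component[OF measurable_fst])
    qed
    finally have h1: "h (t + s) = \<dots>" .
    have "h t = (\<integral>x. \<integral>y. \<integral>y'. soft W V (\<lambda>p. D x y u p + sqrt s * lin J b y' p)
        \<partial>gauss J \<partial>gauss J \<partial>gauss I)"
      unfolding h_def
    proof (rule Bochner_Integration.integral_cong[OF refl])
      fix x
      define F' where "F' z = soft W V (\<lambda>p. u p + sqrt t * lin I a x p + lin J b z p)" for z
      have "F' \<in> borel_measurable (PiM J (\<lambda>_. borel))"
        unfolding F'_def by (intro measurable_soft mi) auto
      moreover have "\<bar>F' z\<bar> \<le> 1" for z unfolding F'_def by (rule abs_soft)
      ultimately have "(\<integral>y. F' (\<lambda>j\<in>J. sqrt ((sqrt r)\<^sup>2 + (sqrt s)\<^sup>2) * y j) \<partial>gauss J)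
        = (\<integral>y. \<integral>y'. F' (\<lambda>j\<in>J. sqrt r * y j + sqrt s * y' j) \<partial>gauss J \<partial>gauss J)"
        using ts r by (intro integral_gauss_combination fin) auto
      then show "(\<integral>y. soft W V (\<lambda>p. u p + sqrt t * lin I a x p + sqrt (1 - t) * lin J b y p) \<partial>gauss J)
        = (\<integral>y. \<integral>y'. soft W V (\<lambda>p. D x y u p + sqrt s * lin J b y' p) \<partial>gauss J \<partial>gauss J)"
        using ts r by (simp add: F'_def D_def lin_restrict lin_add lin_mult add_ac)
    qed
    also have "\<dots> \<le> (\<integral>x. \<integral>y. (\<integral>x'. soft W V (\<lambda>p. D x y u p + sqrt s * lin I a x' p) \<partial>gauss I) + K * sqrt s ^ 3
        \<partial>gauss J \<partial>gauss I)"
    proof -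
      have m1: "(\<lambda>(x, y). \<integral>y'. soft W V (\<lambda>p. D x y u p + sqrt s * lin J b y' p) \<partial>gauss J)
        \<in> borel_measurable (gauss I \<Otimes>\<^sub>M gauss J)"
        unfolding D_def case_prod_unfold
        by (intro J.borel_measurable_lebesgue_integral, unfold case_prod_unfold, intro measurable_soft mi)
          (auto intro!: measurable_gauss_component)
      have m2: "(\<lambda>(x, y). (\<integral>y'. soft W V (\<lambda>p. D x y u p + sqrt s * lin I a y' p) \<partial>gauss I) + K * sqrt s ^ 3)
        \<in> borel_measurable (gauss I \<Otimes>\<^sub>M gauss J)"
        unfolding D_def case_prod_unfold
        by (intro borel_measurable_add borel_measurable_const I.borel_measurable_lebesgue_integral,
            unfold case_prod_unfold, intro measurable_soft mi)
          (auto intro!: measurable_gauss_component)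
      have b1: "\<bar>\<integral>y'. soft W V (\<lambda>p. D x y u p + sqrt s * lin J b y' p) \<partial>gauss J\<bar> \<le> 1" for x y
        by (intro J.abs_integral_le abs_soft)
      have b2: "\<bar>(\<integral>y'. soft W V (\<lambda>p. D x y u p + sqrt s * lin I a y' p) \<partial>gauss I) + K * sqrt s ^ 3\<bar>
          \<le> 1 + \<bar>K * sqrt s ^ 3\<bar>" for x y
        by (rule order_trans[OF abs_triangle_ineq], intro add_mono I.abs_integral_le abs_soft) simp
      have i1: "integrable (gauss I \<Otimes>\<^sub>M gauss J) (\<lambda>(x, y). \<integral>y'. soft W V (\<lambda>p. D x y u p + sqrt s * lin J b y' p) \<partial>gauss J)"
        using b1 m1 by (intro IJ.integrable_const_bound[of _ 1]) auto
      have i2: "integrable (gauss I \<Otimes>\<^sub>M gauss J)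
        (\<lambda>(x, y). (\<integral>y'. soft W V (\<lambda>p. D x y u p + sqrt s * lin I a y' p) \<partial>gauss I) + K * sqrt s ^ 3)"
        using b2 m2 by (intro IJ.integrable_const_bound[of _ "1 + \<bar>K * sqrt s ^ 3\<bar>"]) auto
      have "(\<integral>z. (\<lambda>(x, y). \<integral>y'. soft W V (\<lambda>p. D x y u p + sqrt s * lin J b y' p) \<partial>gauss J) z \<partial>(gauss I \<Otimes>\<^sub>M gauss J))
        \<le> (\<integral>z. (\<lambda>(x, y). (\<integral>y'. soft W V (\<lambda>p. D x y u p + sqrt s * lin I a y' p) \<partial>gauss I) + K * sqrt s ^ 3) z
            \<partial>(gauss I \<Otimes>\<^sub>M gauss J))"
        using i1 i2 ts K(2) by (intro integral_mono) auto
      then show ?thesis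
        using IJ.integral_fst'[OF i1] IJ.integral_fst'[OF i2] by simp
    qed
    also have "\<dots> = h (t + s) + K * sqrt s ^ 3"
    proof -
      have m: "(\<lambda>(x, y). \<integral>y'. soft W V (\<lambda>p. D x y u p + sqrt s * lin I a y' p) \<partial>gauss I)
        \<in> borel_measurable (gauss I \<Otimes>\<^sub>M gauss J)"
        unfolding D_def case_prod_unfold
        by (intro I.borel_measurable_lebesgue_integral, unfold case_prod_unfold, intro measurable_soft mi)
          (auto intro!: measurable_gauss_component)
      have b: "\<bar>\<integral>y'. soft W V (\<lambda>p. D x y u p + sqrt s * lin I a y' p) \<partial>gauss I\<bar> \<le> 1" for x y
        by (intro I.abs_integral_le abs_soft)
      have i: "integrable (gauss I \<Otimes>\<^sub>M gauss J) (\<lambda>(x, y). \<integral>y'. soft W V (\<lambda>p. D x y u p + sqrt s * lin I a y' p) \<partial>gauss I)"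
        using b m by (intro IJ.integrable_const_bound[of _ 1]) auto
      have "integrable (gauss J) (\<lambda>y. \<integral>y'. soft W V (\<lambda>p. D x y u p + sqrt s * lin I a y' p) \<partial>gauss I)" if "x \<in> space (gauss I)" for x
        using measurable_compose[OF measurable_Pair1'[OF that] m] b
        by (intro J.integrable_const_bound[of _ 1]) auto
      then show ?thesis
        unfolding h1 using IJ.integrable_fst'[OF i]
        by (simp add: J.prob_space I.prob_space cong: Bochner_Integration.integral_cong)
    qed
    finally show ?thesis .
  qed
  \<comment> \<open>Telescoping over steps of variance \<open>1 / N\<close>. The total loss after
    \<open>N\<close> steps is \<open>K * sqrt (1 / N)\<close>, which tends to 0.\<close>
  have tel: "h 0 \<le> h (real m / real N) + real m * (K * sqrt (1 / real N) ^ 3)" if "m \<le> N" "N > 0" for m N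
    using that
  proof (induction m)
    case (Suc m)
    have "real m / real N + 1 / real N = real (Suc m) / real N" by (simp add: add_divide_distrib)
    then show ?case
      using step[of "real m / real N" "1 / real N"] Suc by (simp add: algebra_simps)
  qed simp
  have "h 0 \<le> h 1 + K * sqrt (1 / real (Suc N))" for N
  proof -
    have "sqrt (1 / real (Suc N)) ^ 3 = sqrt (1 / real (Suc N)) * (1 / real (Suc N))"
      by (simp add: power3_eq_cube)
    then have "real (Suc N) * (K * sqrt (1 / real (Suc N)) ^ 3) = K * sqrt (1 / real (Suc N))"
      by simp
    moreover have "h 0 \<le> h (real (Suc N) / real (Suc N)) + real (Suc N) * (K * sqrt (1 / real (Suc N)) ^ 3)"
      by (rule tel) auto
    moreover have "real (Suc N) / real (Suc N) = 1" by simp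
    ultimately show ?thesis by (simp only:)
  qed
  moreover have "(\<lambda>N. h 1 + K * sqrt (1 / real (Suc N))) \<longlonglongrightarrow> h 1 + K * sqrt 0"
    by (intro tendsto_intros LIMSEQ_inverse_real_of_nat[unfolded inverse_eq_divide])
  ultimately have "h 0 \<le> h 1 + K * sqrt 0"
    by (intro LIMSEQ_le_const) auto
  moreover have "h 1 = (\<integral>x. soft W V (\<lambda>p. u p + lin I a x p) \<partial>gauss I)"
    "h 0 = (\<integral>y. soft W V (\<lambda>p. u p + lin J b y p) \<partial>gauss J)"
    by (simp_all add: h_def I.prob_space J.prob_space)
  ultimately show ?thesis by simp
qed

section \<open>From the smooth test function to indicators\<close>

definition step_fun :: "real \<Rightarrow> real" where
  "step_fun x = (if x > 0 then 0 else if x < 0 then 1 else 1 / 2)"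

text \<open>At 0 the sequence is constantly \<open>sigm 0\<close>, which is 1/2; this is the middle
  value of \<open>step_fun\<close>.\<close>

lemma sigm_scale_tendsto: "(\<lambda>N. sigm (real N * x)) \<longlonglongrightarrow> step_fun x"
proof -
  consider "x > 0" | "x < 0" | "x = 0" by linarith
  then show ?thesis
  proof cases
    case 1
    then have "filterlim (\<lambda>N. real N * x) at_top sequentially"
      by (intro filterlim_at_top_mult_tendsto_pos[OF tendsto_const] filterlim_real_sequentially) 
    then show ?thesis
      using filterlim_compose[OF sigm_at_top] 1 by (simp add: step_fun_def)
  next
    case 2
    then have "filterlim (\<lambda>N. real N * (- x)) at_top sequentially"
      by (intro filterlim_at_top_mult_tendsto_pos[OF tendsto_const] filterlim_real_sequentially) auto
    then have "filterlim (\<lambda>N. real N * x) at_bot sequentially"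
      by (simp add: filterlim_uminus_at_bot)
    then show ?thesis
      using filterlim_compose[OF sigm_at_bot] 2 by (simp add: step_fun_def)
  next
    case 3
    then show ?thesis by (simp add: step_fun_def sigm_def)
  qed
qed

text \<open>Scaling mean and coefficients by \<open>N\<close> multiplies all covariances by the same
  factor, so the smooth inequality persists and its test function converges to \<open>L\<close>. The
  limit is 0 on the strict event and 1 off the nonstrict event, with values in between at ties;
  hence the strict sign on the left and the nonstrict one on the right.\<close>

lemma gordon_finite:
  fixes a :: "'w \<times> 'v \<Rightarrow> 'i \<Rightarrow> real" and b :: "'w \<times> 'v \<Rightarrow> 'j \<Rightarrow> real"
  assumes fin: "finite I" "finite J" "finite W" "finite V"
    and le: "\<And>p q. p \<in> W \<times> V \<Longrightarrow> q \<in> W \<times> V \<Longrightarrow> (\<Sum>j\<in>J. b p j * b q j) \<le> (\<Sum>i\<in>I. a p i * a q i)"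
    and eq: "\<And>p q. p \<in> W \<times> V \<Longrightarrow> q \<in> W \<times> V \<Longrightarrow> fst p = fst q \<Longrightarrow>
      (\<Sum>j\<in>J. b p j * b q j) = (\<Sum>i\<in>I. a p i * a q i)"
  shows "measure (gauss I) {x\<in>space (gauss I). \<exists>w\<in>W. \<forall>v\<in>V. u (w, v) + lin I a x (w, v) < 0}
    \<le> measure (gauss J) {y\<in>space (gauss J). \<exists>w\<in>W. \<forall>v\<in>V. u (w, v) + lin J b y (w, v) \<le> 0}"
proof -
  interpret I: prob_space "gauss I" by (rule prob_space_gauss)
  interpret J: prob_space "gauss J" by (rule prob_space_gauss)
  define L where "L z = (\<Prod>w\<in>W. 1 - (\<Prod>v\<in>V. step_fun (z (w, v))))" for z
  have sf: "0 \<le> step_fun x" "step_fun x \<le> 1" for x by (auto simp: step_fun_def)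
  have pr: "0 \<le> (\<Prod>v\<in>V. step_fun (z (w, v)))" "(\<Prod>v\<in>V. step_fun (z (w, v))) \<le> 1" for z :: "'w \<times> 'v \<Rightarrow> real" and w
    using sf by (auto intro!: prod_nonneg prod_le_1)
  have L01: "0 \<le> L z" "L z \<le> 1" for z
    unfolding L_def using pr by (auto intro!: prod_nonneg prod_le_1)
  have L0: "L z = 0" if "w \<in> W" "\<And>v. v \<in> V \<Longrightarrow> z (w, v) < 0" for z w
  proof -
    have "(\<Prod>v\<in>V. step_fun (z (w, v))) = 1" using that by (intro prod.neutral) (simp add: step_fun_def not_less_iff_gr_or_eq)
    then show ?thesis unfolding L_def using that(1) fin by (intro prod_zero) auto
  qed
  have L1: "L z = 1" if z: "\<And>w. w \<in> W \<Longrightarrow> \<exists>v\<in>V. z (w, v) > 0" for z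
    unfolding L_def
  proof (intro prod.neutral ballI)
    fix w assume "w \<in> W"
    then obtain v where "v \<in> V" "z (w, v) > 0" using z by blast
    then have "(\<Prod>v\<in>V. step_fun (z (w, v))) = 0"
      using fin by (intro prod_zero bexI[of _ v]) (auto simp: step_fun_def)
    then show "1 - (\<Prod>v\<in>V. step_fun (z (w, v))) = 1" by simp
  qed
  have lim: "(\<lambda>N. \<integral>x. soft W V (\<lambda>p. real N * u p + lin K (\<lambda>p i. real N * d p i) x p) \<partial>gauss K)
      \<longlonglongrightarrow> (\<integral>x. L (\<lambda>p. u p + lin K d x p) \<partial>gauss K)" 
    and int: "integrable (gauss K) (\<lambda>x. L (\<lambda>p. u p + lin K d x p))"
    for K :: "'k set" and d :: "'w \<times> 'v \<Rightarrow> 'k \<Rightarrow> real"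
  proof -
    interpret K: prob_space "gauss K" by (rule prob_space_gauss)
    have m: "(\<lambda>x. lin K d x p) \<in> borel_measurable (gauss K)" for d p
      by (intro measurable_lin gauss_component)
    have mL: "(\<lambda>x. L (\<lambda>p. u p + lin K d x p)) \<in> borel_measurable (gauss K)"
      unfolding L_def step_fun_def using m[measurable] by measurable
    show "integrable (gauss K) (\<lambda>x. L (\<lambda>p. u p + lin K d x p))"
      using mL L01 by (intro K.integrable_const_bound[of _ 1]) auto
    show "(\<lambda>N. \<integral>x. soft W V (\<lambda>p. real N * u p + lin K (\<lambda>p i. real N * d p i) x p) \<partial>gauss K)
      \<longlonglongrightarrow> (\<integral>x. L (\<lambda>p. u p + lin K d x p) \<partial>gauss K)"
    proof (rule integral_dominated_convergence[where w = "\<lambda>_. 1"])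
      show "AE x in gauss K. (\<lambda>N. soft W V (\<lambda>p. real N * u p + lin K (\<lambda>p i. real N * d p i) x p))
        \<longlonglongrightarrow> L (\<lambda>p. u p + lin K d x p)"
      proof (rule AE_I2)
        fix x
        have "lin K (\<lambda>p i. c * d p i) x p = c * lin K d x p" for p c
          by (simp add: lin_def sum_distrib_left mult_ac)
        then have e: "real N * u p + lin K (\<lambda>p i. real N * d p i) x p = real N * (u p + lin K d x p)" for N p
          by (simp add: distrib_left)
        show "(\<lambda>N. soft W V (\<lambda>p. real N * u p + lin K (\<lambda>p i. real N * d p i) x p))
            \<longlonglongrightarrow> L (\<lambda>p. u p + lin K d x p)"
          unfolding soft_def L_def e by (intro tendsto_intros sigm_scale_tendsto)
      qed
    qed (use mL abs_soft in \<open>auto intro!: measurable_soft borel_measurable_add m\<close>)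
  qed
  have "(\<integral>y. L (\<lambda>p. u p + lin J b y p) \<partial>gauss J) \<le> (\<integral>x. L (\<lambda>p. u p + lin I a x p) \<partial>gauss I)"
  proof (rule LIMSEQ_le[OF lim lim], intro exI allI impI)
    fix N :: nat
    have 1: "(\<Sum>i\<in>K. (real N * d p i) * (real N * d q i)) = (real N)\<^sup>2 * (\<Sum>i\<in>K. d p i * d q i)"
      for K :: "'k set" and d p q by (simp add: sum_distrib_left power2_eq_square mult_ac)
    show "(\<integral>x. soft W V (\<lambda>p. real N * u p + lin J (\<lambda>p i. real N * b p i) x p) \<partial>gauss J)
      \<le> (\<integral>x. soft W V (\<lambda>p. real N * u p + lin I (\<lambda>p i. real N * a p i) x p) \<partial>gauss I)"
    proof (rule gordon_smooth[OF fin])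
      fix p q assume pq: "p \<in> W \<times> V" "q \<in> W \<times> V"
      show "(\<Sum>j\<in>J. real N * b p j * (real N * b q j)) \<le> (\<Sum>i\<in>I. real N * a p i * (real N * a q i))"
        unfolding 1 using le[OF pq] by (intro mult_left_mono) auto
      show "(\<Sum>j\<in>J. real N * b p j * (real N * b q j)) = (\<Sum>i\<in>I. real N * a p i * (real N * a q i))"
        if "fst p = fst q" unfolding 1 using eq[OF pq that] by simp
    qed
  qed
  define A where "A = {x\<in>space (gauss I). \<exists>w\<in>W. \<forall>v\<in>V. u (w, v) + lin I a x (w, v) < 0}"
  define B where "B = {y\<in>space (gauss J). \<exists>w\<in>W. \<forall>v\<in>V. u (w, v) + lin J b y (w, v) \<le> 0}"
  have mI: "(\<lambda>x. lin I a x p) \<in> borel_measurable (gauss I)" for p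
    by (intro measurable_lin gauss_component)
  have mJ: "(\<lambda>x. lin J b x p) \<in> borel_measurable (gauss J)" for p
    by (intro measurable_lin gauss_component)
  have A: "A \<in> sets (gauss I)" unfolding A_def using mI[measurable] fin
    by (intro sets.sets_Collect_finite_Ex sets.sets_Collect_finite_All) auto
  have B: "B \<in> sets (gauss J)" unfolding B_def using mJ[measurable] fin
    by (intro sets.sets_Collect_finite_Ex sets.sets_Collect_finite_All) auto
  have "measure (gauss I) A = (\<integral>x. indicator A x \<partial>gauss I)" using A by simp
  also have "\<dots> \<le> (\<integral>x. 1 - L (\<lambda>p. u p + lin I a x p) \<partial>gauss I)"
  proof (rule integral_mono)
    show "indicator A x \<le> 1 - L (\<lambda>p. u p + lin I a x p)" for x
      using L0[of _ "\<lambda>p. u p + lin I a x p"] L01 by (auto simp: A_def indicator_def)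
  qed (use A in \<open>auto intro!: int integrable_real_indicator simp: I.emeasure_eq_measure\<close>)
  also have "\<dots> = 1 - (\<integral>x. L (\<lambda>p. u p + lin I a x p) \<partial>gauss I)"
    by (subst Bochner_Integration.integral_diff[OF _ int]) (simp_all add: I.prob_space)
  also have "\<dots> \<le> 1 - (\<integral>y. L (\<lambda>p. u p + lin J b y p) \<partial>gauss J)"
    using \<open>(\<integral>y. L (\<lambda>p. u p + lin J b y p) \<partial>gauss J) \<le> _\<close> by simp
  also have "\<dots> = (\<integral>y. 1 - L (\<lambda>p. u p + lin J b y p) \<partial>gauss J)"
    by (subst Bochner_Integration.integral_diff[OF _ int]) (simp_all add: J.prob_space)
  also have "\<dots> \<le> (\<integral>y. indicator B y \<partial>gauss J)"
  proof (rule integral_mono)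
    show "1 - L (\<lambda>p. u p + lin J b y p) \<le> indicator B y" if "y \<in> space (gauss J)" for y
    proof (cases "y \<in> B")
      case False
      then have "L (\<lambda>p. u p + lin J b y p) = 1"
        using that by (intro L1) (auto simp: B_def not_le)
      then show ?thesis using False by simp
    qed (use L01 in auto)
  qed (use B in \<open>auto intro!: int integrable_real_indicator simp: J.emeasure_eq_measure\<close>)
  also have "\<dots> = measure (gauss J) B" using B by simp
  finally show ?thesis unfolding A_def B_def .
qed

section \<open>The additional normal variables and the cost of fixing their signs\<close>

lemma measure_stdn_atMost_0: "measure stdn {..0} \<ge> 1 / 2"
proof -
  have "emeasure stdn {..0} = (\<integral>\<^sup>+x. ennreal (std_normal_density x) * indicator {..0} x \<partial>lborel)"
    by (simp add: stdn_def emeasure_density)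
  also have "\<dots> = (\<integral>\<^sup>+x. ennreal (std_normal_density x) * indicator {..0} x \<partial>distr lborel borel uminus)"
    by (simp add: lborel_distr_uminus)
  also have "\<dots> = (\<integral>\<^sup>+x. ennreal (std_normal_density (- x)) * indicator {..0} (- x) \<partial>lborel)"
    by (subst nn_integral_distr) auto
  also have "\<dots> = (\<integral>\<^sup>+x. ennreal (std_normal_density x) * indicator {0..} x \<partial>lborel)"
    by (intro nn_integral_cong) (auto simp: normal_density_def indicator_def)
  also have "\<dots> = emeasure stdn {0..}"
    by (simp add: stdn_def emeasure_density)
  finally have "measure stdn {..0} = measure stdn {0..}" by (simp add: measure_def)
  \<comment> \<open>By symmetry the closed half-lines have equal measure; they cover the line, so
    each has at least half of it.\<close>
  moreover have "1 \<le> measure stdn {..0} + measure stdn {0..}"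
  proof -
    have "{..0} \<union> {0..} = (UNIV :: real set)" by auto
    then have "1 = measure stdn ({..0} \<union> {0..})" using stdn.prob_space by simp
    also have "\<dots> \<le> measure stdn {..0} + measure stdn {0..}"
      by (intro measure_Un_le) auto
    finally show ?thesis .
  qed
  ultimately show ?thesis by simp
qed

lemma measure_gauss_nonpos:
  assumes "finite K"
  shows "measure (gauss K) {x\<in>space (gauss K). \<forall>i\<in>K. x i \<le> 0} \<ge> (1 / 2) ^ card K"
proof -
  interpret P: finite_product_prob_space "\<lambda>_. stdn" K
    using assms by unfold_locales
  have "{x\<in>space (gauss K). \<forall>i\<in>K. x i \<le> 0} = Pi\<^sub>E K (\<lambda>_. {..0})"
    by (auto simp: space_gauss PiE_def)
  then have "measure (gauss K) {x\<in>space (gauss K). \<forall>i\<in>K. x i \<le> 0} = (\<Prod>i\<in>K. measure stdn {..0})"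
    using P.prob_times[of "\<lambda>_. {..0}"] by (simp add: gauss_def)
  also have "\<dots> \<ge> (\<Prod>i\<in>K. 1 / 2)"
    using measure_stdn_atMost_0 by (intro prod_mono) auto
  finally show ?thesis by simp
qed

text \<open>Independence of events that look at disjoint blocks of coordinates: merging two vectors
  maps the product of the laws to the joint law, and the preimage of the joint event is a
  rectangle.\<close>

lemma measure_gauss_Un:
  assumes "finite I" "finite K" "I \<inter> K = {}"
    and A: "{x\<in>space (gauss I). P x} \<in> sets (gauss I)" and B: "{x\<in>space (gauss K). Q x} \<in> sets (gauss K)"
    and AB: "{x\<in>space (gauss (I \<union> K)). P x \<and> Q x} \<in> sets (gauss (I \<union> K))"
    and P: "\<And>x y. (\<And>i. i \<in> I \<Longrightarrow> x i = y i) \<Longrightarrow> P x = P y"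
    and Q: "\<And>x y. (\<And>i. i \<in> K \<Longrightarrow> x i = y i) \<Longrightarrow> Q x = Q y"
  shows "measure (gauss (I \<union> K)) {x\<in>space (gauss (I \<union> K)). P x \<and> Q x}
    = measure (gauss I) {x\<in>space (gauss I). P x} * measure (gauss K) {x\<in>space (gauss K). Q x}"
proof -
  interpret S: product_sigma_finite "\<lambda>_. stdn" by (rule product_sigma_finite_stdn)
  interpret I: prob_space "gauss I" by (rule prob_space_gauss)
  interpret K: prob_space "gauss K" by (rule prob_space_gauss)
  interpret IK: pair_prob_space "gauss I" "gauss K" by standard
  have m: "merge I K \<in> gauss I \<Otimes>\<^sub>M gauss K \<rightarrow>\<^sub>M gauss (I \<union> K)"
    unfolding gauss_def by (rule measurable_merge)
  have "gauss (I \<union> K) = distr (gauss I \<Otimes>\<^sub>M gauss K) (gauss (I \<union> K)) (merge I K)"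
    unfolding gauss_def by (rule S.distr_merge[symmetric]) fact+
  then have "measure (gauss (I \<union> K)) {x\<in>space (gauss (I \<union> K)). P x \<and> Q x}
    = measure (gauss I \<Otimes>\<^sub>M gauss K)
      (merge I K -` {x\<in>space (gauss (I \<union> K)). P x \<and> Q x} \<inter> space (gauss I \<Otimes>\<^sub>M gauss K))"
    using measure_distr[OF m AB] by simp
  also have "merge I K -` {x\<in>space (gauss (I \<union> K)). P x \<and> Q x} \<inter> space (gauss I \<Otimes>\<^sub>M gauss K)
    = {x\<in>space (gauss I). P x} \<times> {x\<in>space (gauss K). Q x}"
  proof -
    have "P (merge I K (x, y)) = P x" for x y by (rule P) (simp add: merge_def)
    moreover have "Q (merge I K (x, y)) = Q y" for x y
      using assms(3) by (intro Q) (auto simp: merge_def)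
    ultimately show ?thesis
      using measurable_space[OF m] by (auto simp: space_pair_measure)
  qed
  also have "measure (gauss I \<Otimes>\<^sub>M gauss K) \<dots>
    = measure (gauss I) {x\<in>space (gauss I). P x} * measure (gauss K) {x\<in>space (gauss K). Q x}"
    using A B by (simp add: measure_def K.emeasure_pair_measure_Times enn2real_mult)
  finally show ?thesis .
qed

text \<open>Only the law of the variables matters, so the computation takes place on
  \<open>gauss (I \<union> K)\<close> and the auxiliary coordinates in \<open>K\<close> need not
  exist on \<open>M\<close>. On the event that these are all nonpositive, their nonnegative
  coefficients can only lower the form.\<close>

theorem (in prob_space) gordon_comparison:
  fixes X :: "'i \<Rightarrow> 'a \<Rightarrow> real" and c b :: "'w \<times> 'v \<Rightarrow> 'i \<Rightarrow> real"
  assumes fin: "finite I" "finite K" "finite W" "finite V" and "I \<noteq> {}" "I \<inter> K = {}"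
    and indep: "indep_vars (\<lambda>_. borel) X I"
    and normal: "\<And>i. i \<in> I \<Longrightarrow> distributed M lborel (X i) std_normal_density"
    and nonneg: "\<And>p i. p \<in> W \<times> V \<Longrightarrow> i \<in> K \<Longrightarrow> 0 \<le> c p i"
    and le: "\<And>p q. p \<in> W \<times> V \<Longrightarrow> q \<in> W \<times> V \<Longrightarrow> (\<Sum>i\<in>I. b p i * b q i) \<le> (\<Sum>i\<in>I \<union> K. c p i * c q i)"
    and eq: "\<And>p q. p \<in> W \<times> V \<Longrightarrow> q \<in> W \<times> V \<Longrightarrow> fst p = fst q \<Longrightarrow>
      (\<Sum>i\<in>I. b p i * b q i) = (\<Sum>i\<in>I \<union> K. c p i * c q i)"
  shows "prob {\<omega>\<in>space M. \<exists>w\<in>W. \<forall>v\<in>V. u (w, v) + (\<Sum>i\<in>I. c (w, v) i * X i \<omega>) < 0}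
    \<le> 2 ^ card K * prob {\<omega>\<in>space M. \<exists>w\<in>W. \<forall>v\<in>V. u (w, v) + (\<Sum>i\<in>I. b (w, v) i * X i \<omega>) \<le> 0}"
proof -
  interpret IK: prob_space "gauss (I \<union> K)" by (rule prob_space_gauss)
  have X: "X i \<in> borel_measurable M" if "i \<in> I" for i
    using distributed_measurable[OF normal[OF that]] by simp
  have "distr M (PiM I (\<lambda>_. borel)) (\<lambda>\<omega>. \<lambda>i\<in>I. X i \<omega>) = PiM I (\<lambda>i. distr M borel (X i))"
    using indep_vars_iff_distr_eq_PiM'[where M' = "\<lambda>_. borel" and X = X, OF \<open>I \<noteq> {}\<close>] X indep by simp
  also have "\<dots> = gauss I"
    unfolding gauss_def
  proof (rule PiM_cong[OF refl])
    fix i assume "i \<in> I"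
    have "distr M borel (X i) = distr M lborel (X i)" by (rule distr_cong) auto
    then show "distr M borel (X i) = stdn"
      using distributed_distr_eq_density[OF normal[OF \<open>i \<in> I\<close>]] by (simp add: stdn_def)
  qed
  finally have law: "distr M (PiM I (\<lambda>_. borel)) (\<lambda>\<omega>. \<lambda>i\<in>I. X i \<omega>) = gauss I" .
  have mX: "(\<lambda>\<omega>. \<lambda>i\<in>I. X i \<omega>) \<in> M \<rightarrow>\<^sub>M PiM I (\<lambda>_. borel)"
    using X by (intro measurable_restrict) auto
  \<comment> \<open>Predicates that look only at coordinates in \<open>I\<close> have the same
    probability on \<open>M\<close> and on the product space.\<close>
  have transfer: "prob {\<omega>\<in>space M. Q (\<lambda>i. X i \<omega>)} = measure (gauss I) {x\<in>space (gauss I). Q x}"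
    if S: "{x\<in>space (gauss I). Q x} \<in> sets (gauss I)" and Q: "\<And>x. Q (\<lambda>i\<in>I. x i) = Q x" for Q
  proof -
    have "measure (gauss I) {x\<in>space (gauss I). Q x}
      = prob ((\<lambda>\<omega>. \<lambda>i\<in>I. X i \<omega>) -` {x\<in>space (gauss I). Q x} \<inter> space M)"
      using measure_distr[OF mX, of "{x\<in>space (gauss I). Q x}"] S unfolding law sets_gauss by simp
    also have "(\<lambda>\<omega>. \<lambda>i\<in>I. X i \<omega>) -` {x\<in>space (gauss I). Q x} \<inter> space M = {\<omega>\<in>space M. Q (\<lambda>i. X i \<omega>)}"
      using Q by (auto simp: space_gauss)
    finally show ?thesis by simp
  qed
  have m: "(\<lambda>x. lin I d x p) \<in> borel_measurable (gauss J)" if "I \<subseteq> J" for d :: "'w \<times> 'v \<Rightarrow> 'i \<Rightarrow> real" and p I J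
    using that by (intro measurable_lin gauss_component) auto
  define A where "A x \<longleftrightarrow> (\<exists>w\<in>W. \<forall>v\<in>V. u (w, v) + lin I c x (w, v) < 0)" for x
  have sA: "{x\<in>space (gauss J). A x} \<in> sets (gauss J)" if "I \<subseteq> J" for J
    unfolding A_def using m[OF that, measurable] fin
    by (intro sets.sets_Collect_finite_Ex sets.sets_Collect_finite_All) auto
  have sN: "{x\<in>space (gauss J). \<forall>i\<in>K. x i \<le> 0} \<in> sets (gauss J)" if "K \<subseteq> J" for J
    using that fin by (intro sets.sets_Collect_finite_All borel_measurable_le gauss_component) auto
  \<comment> \<open>From here on: pay \<open>(1 / 2) ^ card K\<close> for the signs, use
    independence, drop the signed terms into the full form, and apply the finite comparison.\<close>
  have "(1 / 2) ^ card K * measure (gauss I) {x\<in>space (gauss I). A x}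
    \<le> measure (gauss I) {x\<in>space (gauss I). A x} * measure (gauss K) {x\<in>space (gauss K). \<forall>i\<in>K. x i \<le> 0}"
    using measure_gauss_nonpos[OF fin(2)] by (subst mult.commute) (intro mult_left_mono, auto)
  also have "\<dots> = measure (gauss (I \<union> K)) {x\<in>space (gauss (I \<union> K)). A x \<and> (\<forall>i\<in>K. x i \<le> 0)}"
  proof (rule measure_gauss_Un[symmetric])
    show "{x\<in>space (gauss (I \<union> K)). A x \<and> (\<forall>i\<in>K. x i \<le> 0)} \<in> sets (gauss (I \<union> K))"
      using sA sN by (intro sets.sets_Collect_conj) auto
    show "A x = A y" if "\<And>i. i \<in> I \<Longrightarrow> x i = y i" for x y
      using that by (simp add: A_def lin_def cong: sum.cong)
  qed (use assms sA sN in auto)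
  also have "\<dots> \<le> measure (gauss (I \<union> K))
      {x\<in>space (gauss (I \<union> K)). \<exists>w\<in>W. \<forall>v\<in>V. u (w, v) + lin (I \<union> K) c x (w, v) < 0}"
  proof (rule IK.finite_measure_mono)
    show "{x\<in>space (gauss (I \<union> K)). \<exists>w\<in>W. \<forall>v\<in>V. u (w, v) + lin (I \<union> K) c x (w, v) < 0} \<in> sets (gauss (I \<union> K))"
      using m[OF order_refl, measurable] fin
      by (intro sets.sets_Collect_finite_Ex sets.sets_Collect_finite_All) auto
    have "lin (I \<union> K) c x p \<le> lin I c x p" if "\<forall>i\<in>K. x i \<le> 0" "p \<in> W \<times> V" for x p
    proof -
      have "lin (I \<union> K) c x p = lin I c x p + (\<Sum>i\<in>K. c p i * x i)"
        unfolding lin_def using assms by (intro sum.union_disjoint) auto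
      moreover have "(\<Sum>i\<in>K. c p i * x i) \<le> 0"
        using that nonneg by (intro sum_nonpos mult_nonneg_nonpos) auto
      ultimately show ?thesis by simp
    qed
    then have "u p + lin (I \<union> K) c x p < 0" if "\<forall>i\<in>K. x i \<le> 0" "p \<in> W \<times> V" "u p + lin I c x p < 0" for x p
      using that by (smt (verit))
    then show "{x\<in>space (gauss (I \<union> K)). A x \<and> (\<forall>i\<in>K. x i \<le> 0)}
      \<subseteq> {x\<in>space (gauss (I \<union> K)). \<exists>w\<in>W. \<forall>v\<in>V. u (w, v) + lin (I \<union> K) c x (w, v) < 0}"
      unfolding A_def by blast
  qed
  also have "\<dots> \<le> measure (gauss I) {y\<in>space (gauss I). \<exists>w\<in>W. \<forall>v\<in>V. u (w, v) + lin I b y (w, v) \<le> 0}"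
    by (rule gordon_finite) (use fin in \<open>auto intro: le eq\<close>)
  also have "\<dots> = prob {\<omega>\<in>space M. \<exists>w\<in>W. \<forall>v\<in>V. u (w, v) + lin I b (\<lambda>i. X i \<omega>) (w, v) \<le> 0}"
    using m[OF order_refl, measurable] fin
    by (intro transfer[symmetric] sets.sets_Collect_finite_Ex sets.sets_Collect_finite_All)
      (auto simp: lin_restrict)
  finally have "measure (gauss I) {x\<in>space (gauss I). A x}
    \<le> 2 ^ card K * prob {\<omega>\<in>space M. \<exists>w\<in>W. \<forall>v\<in>V. u (w, v) + lin I b (\<lambda>i. X i \<omega>) (w, v) \<le> 0}"
    by (simp add: power_divide field_simps)
  moreover have "prob {\<omega>\<in>space M. A (\<lambda>i. X i \<omega>)} = measure (gauss I) {x\<in>space (gauss I). A x}"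
    using sA by (intro transfer) (auto simp: A_def lin_restrict)
  ultimately show ?thesis by (simp add: A_def lin_def)
qed

subsection \<open>From finite index sets to compact sets\<close>

definition minmax :: "'a set \<Rightarrow> 'b set \<Rightarrow> ('a \<Rightarrow> 'b \<Rightarrow> real) \<Rightarrow> real" where
  "minmax S T f = (INF x\<in>S. SUP y\<in>T. f x y)"

lemma minmax_finite:
  assumes "finite S" "S \<noteq> {}" "finite T" "T \<noteq> {}"
  shows "minmax S T f < c \<longleftrightarrow> (\<exists>x\<in>S. \<forall>y\<in>T. f x y < c)"
    and "minmax S T f \<le> c \<longleftrightarrow> (\<exists>x\<in>S. \<forall>y\<in>T. f x y \<le> c)"
  using assms by (auto simp: minmax_def cInf_eq_Min cSup_eq_Max Min_less_iff Min_le_iff)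

text \<open>A choice \<open>x\<close> of the minimiser is imitated by an \<open>x'\<close> such that
  every reply \<open>y'\<close> to \<open>x'\<close> is matched, up to \<open>e\<close>, by a reply
  \<open>y\<close> to \<open>x\<close>. The asymmetric form serves both directions between a compact
  set and its net.\<close>

lemma minmax_le_add:
  assumes ne: "S \<noteq> {}" "S' \<noteq> {}" "T \<noteq> {}" "T' \<noteq> {}"
    and bdd: "\<And>x y. x \<in> S \<union> S' \<Longrightarrow> y \<in> T \<union> T' \<Longrightarrow> \<bar>f x y\<bar> \<le> K"
    and close: "\<And>x. x \<in> S \<Longrightarrow> \<exists>x'\<in>S'. \<forall>y'\<in>T'. \<exists>y\<in>T. f x' y' \<le> f x y + e"
  shows "minmax S' T' f \<le> minmax S T f + e"
proof -
  have ba: "bdd_above (f x ` U)" if "x \<in> S \<union> S'" "U \<subseteq> T \<union> T'" for x U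
    using bdd[OF that(1)] that(2) by (intro bdd_aboveI[of _ K]) (fastforce simp: abs_le_iff)
  have bb: "bdd_below ((\<lambda>x. SUP y\<in>T'. f x y) ` S')"
  proof (intro bdd_belowI2[of _ "- K"])
    fix x assume x: "x \<in> S'"
    obtain y where y: "y \<in> T'" using ne by blast
    then have "f x y \<le> (SUP y\<in>T'. f x y)" using x by (intro cSUP_upper ba) auto
    then show "- K \<le> (SUP y\<in>T'. f x y)" using bdd[of x y] x y by (auto simp: abs_le_iff)
  qed
  have "minmax S' T' f - e \<le> (SUP y\<in>T. f x y)" if x: "x \<in> S" for x
  proof -
    obtain x' where x': "x' \<in> S'" "\<And>y'. y' \<in> T' \<Longrightarrow> \<exists>y\<in>T. f x' y' \<le> f x y + e"
      using close[OF x] by blast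
    have "minmax S' T' f \<le> (SUP y\<in>T'. f x' y)"
      unfolding minmax_def by (rule cINF_lower[OF bb x'(1)])
    also have "\<dots> \<le> (SUP y\<in>T. f x y) + e"
    proof (rule cSUP_least[OF ne(4)])
      fix y' assume "y' \<in> T'"
      then obtain y where y: "y \<in> T" "f x' y' \<le> f x y + e" using x' by blast
      have "f x y \<le> (SUP y\<in>T. f x y)" using x y by (intro cSUP_upper ba) auto
      then show "f x' y' \<le> (SUP y\<in>T. f x y) + e" using y by linarith
    qed
    finally show ?thesis by simp
  qed
  then have "minmax S' T' f - e \<le> minmax S T f"
    unfolding minmax_def[of S T] using ne by (intro cINF_greatest)
  then show ?thesis by simp
qed

lemma compact_nets:
  fixes S :: "'a::metric_space set"
  assumes "compact S" "S \<noteq> {}"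
  obtains N where "\<And>m::nat. finite (N m)" "\<And>m. N m \<subseteq> S" "\<And>m. N m \<noteq> {}"
    "\<And>m x. x \<in> S \<Longrightarrow> \<exists>y\<in>N m. dist x y < inverse (real (Suc m))"
proof -
  have "\<forall>m::nat. \<exists>k. finite k \<and> k \<subseteq> S \<and> S \<subseteq> (\<Union>x\<in>k. ball x (inverse (real (Suc m))))"
    using seq_compact_imp_totally_bounded[of S] assms(1)
    by (simp add: compact_eq_seq_compact_metric del: of_nat_Suc)
  then obtain N where N: "\<And>m. finite (N m)" "\<And>m. N m \<subseteq> S"
      "\<And>m. S \<subseteq> (\<Union>x\<in>N m. ball x (inverse (real (Suc m))))" by metis
  show ?thesis
  proof (rule that[of N])
    show "N m \<noteq> {}" for m using N(3)[of m] assms(2) by auto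
    show "\<exists>y\<in>N m. dist x y < inverse (real (Suc m))" if "x \<in> S" for m x
    proof -
      have "x \<in> (\<Union>x\<in>N m. ball x (inverse (real (Suc m))))" using N(3) that by blast
      then show ?thesis by (auto simp: dist_commute simp del: of_nat_Suc)
    qed
  qed (use N in auto)
qed

lemma continuous_bounded:
  fixes f :: "'a::metric_space \<Rightarrow> 'b::metric_space \<Rightarrow> real"
  assumes "compact S" "compact T" "continuous_on (S \<times> T) (\<lambda>(x, y). f x y)"
  obtains K where "\<And>x y. x \<in> S \<Longrightarrow> y \<in> T \<Longrightarrow> \<bar>f x y\<bar> \<le> K"
proof -
  have "bounded ((\<lambda>(x, y). f x y) ` (S \<times> T))"
    using assms by (intro compact_imp_bounded compact_continuous_image compact_Times)
  then obtain K where "\<And>z. z \<in> (\<lambda>(x, y). f x y) ` (S \<times> T) \<Longrightarrow> norm z \<le> K"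
    unfolding bounded_iff by blast
  then show ?thesis using that[of K] by force
qed

text \<open>Uniform continuity on the product makes a fine net lose at most \<open>e\<close>: from
  the full sets to the nets the minimiser is rounded, in the other direction the maximiser.
  \<open>e\<close> is half of \<open>r\<close> because the comparison gives a nonstrict bound and a
  strict one is wanted.\<close>

lemma minmax_nets_tendsto:
  fixes f :: "'a::metric_space \<Rightarrow> 'b::metric_space \<Rightarrow> real"
  assumes "compact S" "compact T" and cont: "continuous_on (S \<times> T) (\<lambda>(x, y). f x y)"
    and ne: "S \<noteq> {}" "T \<noteq> {}"
    and N: "\<And>m. N m \<subseteq> S" "\<And>m. N m \<noteq> {}" "\<And>m x. x \<in> S \<Longrightarrow> \<exists>y\<in>N m. dist x y < inverse (real (Suc m))"
    and L: "\<And>m. L m \<subseteq> T" "\<And>m. L m \<noteq> {}" "\<And>m x. x \<in> T \<Longrightarrow> \<exists>y\<in>L m. dist x y < inverse (real (Suc m))"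
  shows "(\<lambda>m. minmax (N m) (L m) f) \<longlonglongrightarrow> minmax S T f"
proof (rule LIMSEQ_I)
  fix r :: real assume "r > 0"
  define e where "e = r / 2"
  have e: "e > 0" "e < r" using \<open>r > 0\<close> by (auto simp: e_def)
  obtain K where K: "\<And>x y. x \<in> S \<Longrightarrow> y \<in> T \<Longrightarrow> \<bar>f x y\<bar> \<le> K"
    using continuous_bounded assms(1-3) by blast
  have "uniformly_continuous_on (S \<times> T) (\<lambda>(x, y). f x y)"
    using assms by (intro compact_uniformly_continuous compact_Times)
  then obtain \<delta> where \<delta>: "\<delta> > 0" "\<And>z z'. z \<in> S \<times> T \<Longrightarrow> z' \<in> S \<times> T \<Longrightarrow> dist z' z < \<delta> \<Longrightarrow>
      dist ((\<lambda>(x, y). f x y) z') ((\<lambda>(x, y). f x y) z) < e"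
    unfolding uniformly_continuous_on_def using e(1) by metis
  have d1: "\<bar>f x' y - f x y\<bar> < e" if "x \<in> S" "x' \<in> S" "y \<in> T" "dist x' x < \<delta>" for x x' y
    using \<delta>(2)[of "(x, y)" "(x', y)"] that by (simp add: dist_Pair_Pair dist_real_def)
  have d2: "\<bar>f x y' - f x y\<bar> < e" if "x \<in> S" "y' \<in> T" "y \<in> T" "dist y' y < \<delta>" for x y' y
    using \<delta>(2)[of "(x, y)" "(x, y')"] that by (simp add: dist_Pair_Pair dist_real_def)
  obtain m0 where m0: "inverse (real (Suc m0)) < \<delta>" using reals_Archimedean[OF \<delta>(1)] by blast
  show "\<exists>no. \<forall>m\<ge>no. norm (minmax (N m) (L m) f - minmax S T f) < r"
  proof (intro exI[of _ m0] allI impI)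
    fix m assume "m \<ge> m0"
    then have "inverse (real (Suc m)) \<le> inverse (real (Suc m0))" by simp
    then have m: "inverse (real (Suc m)) < \<delta>" using m0 by linarith
    have "minmax (N m) (L m) f \<le> minmax S T f + e"
    proof (rule minmax_le_add)
      fix x assume x: "x \<in> S"
      obtain x' where x': "x' \<in> N m" "dist x x' < \<delta>" using N(3)[OF x, of m] m by force
      have "f x' y \<le> f x y + e" if "y \<in> L m" for y
        using d1[of x x' y] x x' N(1) L(1) that by (force simp: dist_commute)
      then show "\<exists>x'\<in>N m. \<forall>y'\<in>L m. \<exists>y\<in>T. f x' y' \<le> f x y + e"
        using x' L(1) by blast
    qed (use N L ne K in blast)+
    moreover have "minmax S T f \<le> minmax (N m) (L m) f + e"
    proof (rule minmax_le_add)
      fix x assume x: "x \<in> N m"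
      have "\<exists>y\<in>L m. f x y' \<le> f x y + e" if y': "y' \<in> T" for y'
      proof -
        obtain y where y: "y \<in> L m" "dist y' y < \<delta>" using L(3)[OF y', of m] m by force
        then have "f x y' \<le> f x y + e" using d2[of x y' y] x y' N(1) L(1) by force
        then show ?thesis using y by blast
      qed
      then show "\<exists>x'\<in>S. \<forall>y'\<in>T. \<exists>y\<in>L m. f x' y' \<le> f x y + e"
        using x N(1) by blast
    qed (use N L ne K in blast)+
    ultimately show "norm (minmax (N m) (L m) f - minmax S T f) < r"
      using e by (simp add: abs_less_iff)
  qed
qed

text \<open>Continuous sample paths and measurability at fixed arguments are what carries a
  statement from nets to compact sets. The locale is instantiated for both objectives and for their
  negatives with exchanged players.\<close>

locale random_minmax = prob_space M for M :: "'s measure" +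
  fixes S :: "'a::metric_space set" and T :: "'b::metric_space set" and F :: "'a \<Rightarrow> 'b \<Rightarrow> 's \<Rightarrow> real"
  assumes compact: "compact S" "compact T" and ne: "S \<noteq> {}" "T \<noteq> {}"
    and cont: "\<And>\<omega>. \<omega> \<in> space M \<Longrightarrow> continuous_on (S \<times> T) (\<lambda>(x, y). F x y \<omega>)"
    and meas: "\<And>x y. x \<in> S \<Longrightarrow> y \<in> T \<Longrightarrow> F x y \<in> borel_measurable M"
begin

lemma measurable_minmax_finite:
  assumes "finite W" "W \<noteq> {}" "W \<subseteq> S" "finite V" "V \<noteq> {}" "V \<subseteq> T"
  shows "(\<lambda>\<omega>. minmax W V (\<lambda>x y. F x y \<omega>)) \<in> borel_measurable M"
  unfolding borel_measurable_iff_less minmax_finite[OF assms(1,2,4,5)]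
  using assms meas
  by (intro allI sets.sets_Collect_finite_Ex sets.sets_Collect_finite_All borel_measurable_less) auto

text \<open>The infimum and supremum may run over uncountable sets, so measurability comes from the
  pointwise limit of values on finite nets.\<close>

lemma measurable_minmax [measurable]: "(\<lambda>\<omega>. minmax S T (\<lambda>x y. F x y \<omega>)) \<in> borel_measurable M"
proof -
  obtain N where N: "\<And>m::nat. finite (N m)" "\<And>m. N m \<subseteq> S" "\<And>m. N m \<noteq> {}"
    "\<And>m x. x \<in> S \<Longrightarrow> \<exists>y\<in>N m. dist x y < inverse (real (Suc m))"
    using compact_nets[OF compact(1) ne(1)] by blast
  obtain L where L: "\<And>m::nat. finite (L m)" "\<And>m. L m \<subseteq> T" "\<And>m. L m \<noteq> {}"
    "\<And>m x. x \<in> T \<Longrightarrow> \<exists>y\<in>L m. dist x y < inverse (real (Suc m))"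
    using compact_nets[OF compact(2) ne(2)] by blast
  show ?thesis
    by (rule borel_measurable_LIMSEQ_real[OF minmax_nets_tendsto[OF compact cont ne N(2-4) L(2-4)]
        measurable_minmax_finite[OF N(1,3,2) L(1,3,2)]])
qed

end

text \<open>Limits along nets preserve only "strict on the left, nonstrict on the right". Since that
  holds at every threshold, approaching \<open>c\<close> from below makes both events
  strict.\<close>

lemma (in prob_space) minmax_comparison:
  fixes S :: "'b::metric_space set" and T :: "'c::metric_space set"
  assumes "random_minmax M S T F" "random_minmax M S T H" and q: "q \<ge> 0"
    and fin: "\<And>W V c. finite W \<Longrightarrow> W \<subseteq> S \<Longrightarrow> finite V \<Longrightarrow> V \<subseteq> T \<Longrightarrow>
      prob {\<omega>\<in>space M. \<exists>x\<in>W. \<forall>y\<in>V. F x y \<omega> < c} \<le> q * prob {\<omega>\<in>space M. \<exists>x\<in>W. \<forall>y\<in>V. H x y \<omega> \<le> c}"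
  shows "prob {\<omega>\<in>space M. minmax S T (\<lambda>x y. F x y \<omega>) < c}
    \<le> q * prob {\<omega>\<in>space M. minmax S T (\<lambda>x y. H x y \<omega>) < c}"
proof -
  interpret F: random_minmax M S T F by fact
  interpret H: random_minmax M S T H by fact
  obtain N where N: "\<And>m::nat. finite (N m)" "\<And>m. N m \<subseteq> S" "\<And>m. N m \<noteq> {}"
    "\<And>m x. x \<in> S \<Longrightarrow> \<exists>y\<in>N m. dist x y < inverse (real (Suc m))"
    using compact_nets[OF F.compact(1) F.ne(1)] by blast
  obtain L where L: "\<And>m::nat. finite (L m)" "\<And>m. L m \<subseteq> T" "\<And>m. L m \<noteq> {}"
    "\<And>m x. x \<in> T \<Longrightarrow> \<exists>y\<in>L m. dist x y < inverse (real (Suc m))"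
    using compact_nets[OF F.compact(2) F.ne(2)] by blast
  let ?F = "\<lambda>\<omega>. minmax S T (\<lambda>x y. F x y \<omega>)" and ?H = "\<lambda>\<omega>. minmax S T (\<lambda>x y. H x y \<omega>)"
  let ?Fm = "\<lambda>m \<omega>. minmax (N m) (L m) (\<lambda>x y. F x y \<omega>)" and ?Hm = "\<lambda>m \<omega>. minmax (N m) (L m) (\<lambda>x y. H x y \<omega>)"
  have [measurable]: "?Fm m \<in> borel_measurable M" "?Hm m \<in> borel_measurable M" for m
    using F.measurable_minmax_finite[OF N(1,3,2) L(1,3,2)] H.measurable_minmax_finite[OF N(1,3,2) L(1,3,2)] by auto
  have limF: "(\<lambda>m. ?Fm m \<omega>) \<longlonglongrightarrow> ?F \<omega>" if "\<omega> \<in> space M" for \<omega>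
    using minmax_nets_tendsto[OF F.compact F.cont[OF that] F.ne N(2-4) L(2-4)] .
  have limH: "(\<lambda>m. ?Hm m \<omega>) \<longlonglongrightarrow> ?H \<omega>" if "\<omega> \<in> space M" for \<omega>
    using minmax_nets_tendsto[OF F.compact H.cont[OF that] F.ne N(2-4) L(2-4)] .
  have weak: "prob {\<omega>\<in>space M. ?F \<omega> < c} \<le> q * prob {\<omega>\<in>space M. ?H \<omega> \<le> c}" for c
  proof -
    \<comment> \<open>The sets \<open>E n\<close> increase and contain the event for
      \<open>F\<close> in the limit, the sets \<open>C n\<close> decrease to a part of the event for
      \<open>H\<close>. At level \<open>n\<close> both are tied to the same net, where
      \<open>fin\<close> applies.\<close>
    define E where "E n = {\<omega>\<in>space M. \<forall>m\<ge>n. ?Fm m \<omega> < c}" for n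
    define C where "C n = {\<omega>\<in>space M. \<exists>m\<ge>n. ?Hm m \<omega> \<le> c}" for n
    have [measurable]: "E n \<in> sets M" "C n \<in> sets M" for n unfolding E_def C_def by measurable
    have "prob (E n) \<le> q * prob (C n)" for n
    proof -
      have "prob (E n) \<le> prob {\<omega>\<in>space M. ?Fm n \<omega> < c}"
        by (intro finite_measure_mono) (auto simp: E_def)
      also have "\<dots> \<le> q * prob {\<omega>\<in>space M. ?Hm n \<omega> \<le> c}"
        using fin[OF N(1,2) L(1,2)] N L by (simp add: minmax_finite)
      also have "\<dots> \<le> q * prob (C n)"
        using q by (intro mult_left_mono finite_measure_mono) (auto simp: C_def)
      finally show ?thesis .
    qed
    moreover have "(\<lambda>n. prob (E n)) \<longlonglongrightarrow> prob (\<Union>n. E n)"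
      by (intro finite_Lim_measure_incseq) (auto simp: E_def incseq_def)
    moreover have "(\<lambda>n. q * prob (C n)) \<longlonglongrightarrow> q * prob (\<Inter>n. C n)"
      by (intro tendsto_mult_left finite_Lim_measure_decseq) (auto simp: C_def decseq_def intro: order_trans)
    ultimately have le: "prob (\<Union>n. E n) \<le> q * prob (\<Inter>n. C n)"
      by (intro LIMSEQ_le[of "\<lambda>n. prob (E n)" _ "\<lambda>n. q * prob (C n)"]) auto
    have "prob {\<omega>\<in>space M. ?F \<omega> < c} \<le> prob (\<Union>n. E n)"
    proof (intro finite_measure_mono subsetI)
      fix \<omega> assume "\<omega> \<in> {\<omega>\<in>space M. ?F \<omega> < c}"
      then have \<omega>: "\<omega> \<in> space M" "?F \<omega> < c" by auto
      then have "\<forall>\<^sub>F m in sequentially. ?Fm m \<omega> < c"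
        using order_tendstoD(2)[OF limF] by blast
      then show "\<omega> \<in> (\<Union>n. E n)" using \<omega> by (auto simp: E_def eventually_sequentially)
    qed measurable
    moreover have "prob (\<Inter>n. C n) \<le> prob {\<omega>\<in>space M. ?H \<omega> \<le> c}"
    proof (intro finite_measure_mono subsetI)
      fix \<omega> assume *: "\<omega> \<in> (\<Inter>n. C n)"
      then have \<omega>: "\<omega> \<in> space M" by (auto simp: C_def)
      have "\<not> ?H \<omega> > c"
      proof
        assume "?H \<omega> > c"
        then have "\<forall>\<^sub>F m in sequentially. ?Hm m \<omega> > c"
          using order_tendstoD(1)[OF limH[OF \<omega>]] by blast
        then obtain n where "\<And>m. m \<ge> n \<Longrightarrow> ?Hm m \<omega> > c" by (auto simp: eventually_sequentially)
        moreover have "\<exists>m\<ge>n. ?Hm m \<omega> \<le> c" using * by (auto simp: C_def)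
        ultimately show False by force
      qed
      then show "\<omega> \<in> {\<omega>\<in>space M. ?H \<omega> \<le> c}" using \<omega> by simp
    qed measurable
    ultimately show ?thesis using le q by (meson mult_left_mono order_trans)
  qed
  \<comment> \<open>The strict event is the union of these; on the right, being at most the lowered
    threshold implies being below \<open>c\<close>.\<close>
  define E where "E n = {\<omega>\<in>space M. ?F \<omega> < c - inverse (real (Suc n))}" for n
  have [measurable]: "E n \<in> sets M" for n unfolding E_def by measurable
  have "(\<lambda>n. prob (E n)) \<longlonglongrightarrow> prob (\<Union>n. E n)"
  proof (rule finite_Lim_measure_incseq)
    show "incseq E"
    proof (intro monoI subsetI)
      fix m n :: nat and \<omega> assume "m \<le> n" and \<omega>: "\<omega> \<in> E m"
      then have *: "inverse (real (Suc n)) \<le> inverse (real (Suc m))" by simp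
      have "\<omega> \<in> space M" "?F \<omega> < c - inverse (real (Suc m))"
        using \<omega> unfolding E_def by blast+
      then show "\<omega> \<in> E n" unfolding E_def mem_Collect_eq using * by linarith
    qed
  qed auto
  moreover have "prob (E n) \<le> q * prob {\<omega>\<in>space M. ?H \<omega> < c}" for n
  proof -
    have "prob (E n) \<le> q * prob {\<omega>\<in>space M. ?H \<omega> \<le> c - inverse (real (Suc n))}"
      unfolding E_def by (rule weak)
    also have "\<dots> \<le> q * prob {\<omega>\<in>space M. ?H \<omega> < c}"
    proof (intro mult_left_mono finite_measure_mono subsetI q)
      fix \<omega> assume "\<omega> \<in> {\<omega>\<in>space M. ?H \<omega> \<le> c - inverse (real (Suc n))}"
      moreover have "inverse (real (Suc n)) > 0" by simp
      ultimately show "\<omega> \<in> {\<omega>\<in>space M. ?H \<omega> < c}" unfolding mem_Collect_eq by linarith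
    qed measurable
    finally show ?thesis .
  qed
  ultimately have "prob (\<Union>n. E n) \<le> q * prob {\<omega>\<in>space M. ?H \<omega> < c}"
    by (intro LIMSEQ_le_const2) auto
  moreover have "(\<Union>n. E n) = {\<omega>\<in>space M. ?F \<omega> < c}"
  proof (intro subset_antisym subsetI)
    fix \<omega> assume "\<omega> \<in> (\<Union>n. E n)"
    then obtain n where "\<omega> \<in> space M" "?F \<omega> < c - inverse (real (Suc n))"
      unfolding E_def by blast
    moreover have "inverse (real (Suc n)) > 0" by simp
    ultimately show "\<omega> \<in> {\<omega>\<in>space M. ?F \<omega> < c}" unfolding mem_Collect_eq by linarith
  next
    fix \<omega> assume "\<omega> \<in> {\<omega>\<in>space M. ?F \<omega> < c}"
    then have \<omega>: "\<omega> \<in> space M" "c - ?F \<omega> > 0" by auto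
    obtain n where "inverse (real (Suc n)) < c - ?F \<omega>" using reals_Archimedean[OF \<omega>(2)] by blast
    then have "\<omega> \<in> E n" unfolding E_def mem_Collect_eq using \<omega> by linarith
    then show "\<omega> \<in> (\<Union>n. E n)" by blast
  qed
  ultimately show ?thesis by simp
qed

subsection \<open>The multivariate convex Gaussian min-max theorem\<close>

lemma
  fixes f :: "gidx \<Rightarrow> real"
  shows finite_gindices: "finite (gindices k d n)"
    and sum_gindices: "(\<Sum>x\<in>gindices k d n. f x) =
      (\<Sum>l<k. (\<Sum>i<n l. \<Sum>j<d. f (GG l i j)) + (\<Sum>j<d. f (gg l j)) + (\<Sum>i<n l. f (hh l i)))"
proof -
  let ?A = "(\<lambda>(l, i, j). GG l i j) ` (SIGMA l:{..<k}. {..<n l} \<times> {..<d})"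
  let ?B = "(\<lambda>(l, j). gg l j) ` ({..<k} \<times> {..<d})"
  let ?C = "(\<lambda>(l, i). hh l i) ` (SIGMA l:{..<k}. {..<n l})"
  have "{GG l i j |l i j. l < k \<and> i < n l \<and> j < d} = ?A" "{gg l j |l j. l < k \<and> j < d} = ?B"
    "{hh l i |l i. l < k \<and> i < n l} = ?C"
    by (force simp: image_iff)+
  then have eq: "gindices k d n = (?A \<union> ?B) \<union> ?C" by (simp only: gindices_def)
  show "finite (gindices k d n)" unfolding eq by simp
  have "(\<Sum>x\<in>gindices k d n. f x) = sum f (?A \<union> ?B) + sum f ?C"
    unfolding eq by (rule sum.union_disjoint) auto
  also have "sum f (?A \<union> ?B) = sum f ?A + sum f ?B"
    by (rule sum.union_disjoint) auto
  also have "sum f ?A = (\<Sum>l<k. \<Sum>i<n l. \<Sum>j<d. f (GG l i j))"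
    by (subst sum.reindex) (auto simp: inj_on_def sum.Sigma split_beta sum.cartesian_product)
  also have "sum f ?B = (\<Sum>l<k. \<Sum>j<d. f (gg l j))"
    by (subst sum.reindex) (auto simp: inj_on_def split_beta sum.cartesian_product)
  also have "sum f ?C = (\<Sum>l<k. \<Sum>i<n l. f (hh l i))"
    by (subst sum.reindex) (auto simp: inj_on_def sum.Sigma split_beta)
  finally show "(\<Sum>x\<in>gindices k d n. f x) =
      (\<Sum>l<k. (\<Sum>i<n l. \<Sum>j<d. f (GG l i j)) + (\<Sum>j<d. f (gg l j)) + (\<Sum>i<n l. f (hh l i)))"
    by (simp add: sum.distrib)
qed

lemma enorm_nonneg: "0 \<le> enorm n x"
  by (simp add: enorm_def sum_nonneg)

lemma dotp_self: "dotp n x x = enorm n x * enorm n x"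
  by (simp add: dotp_def enorm_def sum_nonneg power2_eq_square)

text \<open>Cauchy-Schwarz; together with \<open>dotp_self\<close> it decides the sign and the
  vanishing of the covariance difference.\<close>

lemma dotp_le_enorm: "dotp n x y \<le> enorm n x * enorm n y"
proof -
  have "dotp n x y \<le> (\<Sum>i<n. \<bar>x i\<bar> * \<bar>y i\<bar>)"
    unfolding dotp_def by (intro sum_mono) (simp flip: abs_mult)
  then show ?thesis
    using L2_set_mult_ineq[of x y "{..<n}"] by (simp add: enorm_def L2_set_def)
qed

text \<open>The first component of an index is always the minimiser. Hypothesis \<open>same\<close>
  is symmetric in the two vector families, and the sign \<sigma> is 1 or -1, so one lemma covers the
  game and its negative with exchanged players.\<close>

lemma (in prob_space) gaussian_form_comparison:
  fixes \<alpha> \<beta> :: "'w \<times> 'v \<Rightarrow> nat \<Rightarrow> nat \<Rightarrow> real" and X :: "gidx \<Rightarrow> 'a \<Rightarrow> real" and \<sigma> :: real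
  assumes "k \<ge> 1" "d \<ge> 1" and indep: "indep_vars (\<lambda>_. borel) X (gindices k d n)"
    and normal: "\<And>i. i \<in> gindices k d n \<Longrightarrow> distributed M lborel (X i) std_normal_density"
    and fin: "finite W" "finite V" and \<sigma>: "\<sigma> * \<sigma> = 1"
    and same: "\<And>p q. fst p = fst q \<Longrightarrow> \<alpha> p = \<alpha> q \<or> \<beta> p = \<beta> q"
  shows "prob {\<omega>\<in>space M. \<exists>w\<in>W. \<forall>v\<in>V. u (w, v) + \<sigma> * (\<Sum>l<k. \<Sum>i<n l. \<Sum>j<d.
        \<beta> (w, v) l i * X (GG l i j) \<omega> * \<alpha> (w, v) l j) < 0}
    \<le> 2 ^ k * prob {\<omega>\<in>space M. \<exists>w\<in>W. \<forall>v\<in>V. u (w, v) + \<sigma> * (\<Sum>l<k.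
        enorm (n l) (\<beta> (w, v) l) * dotp d (\<lambda>j. X (gg l j) \<omega>) (\<alpha> (w, v) l)
        + enorm d (\<alpha> (w, v) l) * dotp (n l) (\<lambda>i. X (hh l i) \<omega>) (\<beta> (w, v) l)) \<le> 0}"
proof -
  define I where "I = gindices k d n"
  \<comment> \<open>The indices \<open>GG l (n l) 0\<close> lie outside \<open>gindices k d n\<close> and are used for the
    additional normal variables \<open>\<gamma>\<close>.\<close>
  define K where "K = (\<lambda>l. GG l (n l) 0) ` {..<k}"
  \<comment> \<open>\<sigma> multiplies the bilinear coefficients only: the additional coefficients
    must stay nonnegative for either sign, and \<sigma> cancels in the covariances anyway.\<close>
  define a where "a p x = (case x of
      GG l i j \<Rightarrow> if i = n l then enorm d (\<alpha> p l) * enorm (n l) (\<beta> p l) else \<sigma> * (\<beta> p l i * \<alpha> p l j)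
    | _ \<Rightarrow> 0)" for p x
  define b where "b p x = (case x of
      GG l i j \<Rightarrow> 0
    | gg l j \<Rightarrow> \<sigma> * (enorm (n l) (\<beta> p l) * \<alpha> p l j)
    | hh l i \<Rightarrow> \<sigma> * (enorm d (\<alpha> p l) * \<beta> p l i))" for p x
  have "gg 0 0 \<in> I" using assms(1,2) by (auto simp: I_def gindices_def)
  then have I: "finite I" "I \<noteq> {}" by (auto simp: I_def finite_gindices)
  have K: "finite K" "I \<inter> K = {}" "card K = k"
    unfolding K_def I_def gindices_def by (auto simp: card_image inj_on_def)
  have aa: "(\<Sum>x\<in>I \<union> K. a p x * a q x) = (\<Sum>l<k. dotp (n l) (\<beta> p l) (\<beta> q l) * dotp d (\<alpha> p l) (\<alpha> q l)
      + (enorm (n l) (\<beta> p l) * enorm (n l) (\<beta> q l)) * (enorm d (\<alpha> p l) * enorm d (\<alpha> q l)))" for p q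
  proof -
    have "(\<Sum>x\<in>I. a p x * a q x) = (\<Sum>l<k. dotp (n l) (\<beta> p l) (\<beta> q l) * dotp d (\<alpha> p l) (\<alpha> q l))"
      unfolding I_def sum_gindices
    proof (intro sum.cong refl)
      fix l assume "l \<in> {..<k}"
      have "(\<Sum>i<n l. \<Sum>j<d. a p (GG l i j) * a q (GG l i j))
        = (\<Sum>i<n l. \<Sum>j<d. (\<beta> p l i * \<beta> q l i) * (\<alpha> p l j * \<alpha> q l j))"
      proof (intro sum.cong refl)
        fix i j assume "i \<in> {..<n l}"
        then have "a p (GG l i j) * a q (GG l i j) = (\<sigma> * \<sigma>) * ((\<beta> p l i * \<beta> q l i) * (\<alpha> p l j * \<alpha> q l j))"
          by (simp add: a_def)
        then show "a p (GG l i j) * a q (GG l i j) = (\<beta> p l i * \<beta> q l i) * (\<alpha> p l j * \<alpha> q l j)"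
          by (simp add: \<sigma>)
      qed
      then show "(\<Sum>i<n l. \<Sum>j<d. a p (GG l i j) * a q (GG l i j)) + (\<Sum>j<d. a p (gg l j) * a q (gg l j))
          + (\<Sum>i<n l. a p (hh l i) * a q (hh l i)) = dotp (n l) (\<beta> p l) (\<beta> q l) * dotp d (\<alpha> p l) (\<alpha> q l)"
        unfolding dotp_def sum_product by (simp add: a_def)
    qed
    moreover have "(\<Sum>x\<in>K. a p x * a q x)
      = (\<Sum>l<k. (enorm (n l) (\<beta> p l) * enorm (n l) (\<beta> q l)) * (enorm d (\<alpha> p l) * enorm d (\<alpha> q l)))"
      unfolding K_def by (subst sum.reindex) (auto simp: inj_on_def a_def mult_ac)
    ultimately show ?thesis
      using I K by (simp add: sum.union_disjoint sum.distrib)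
  qed
  have bb: "(\<Sum>x\<in>I. b p x * b q x) = (\<Sum>l<k. (enorm (n l) (\<beta> p l) * enorm (n l) (\<beta> q l)) * dotp d (\<alpha> p l) (\<alpha> q l)
      + dotp (n l) (\<beta> p l) (\<beta> q l) * (enorm d (\<alpha> p l) * enorm d (\<alpha> q l)))" for p q
    unfolding I_def sum_gindices
  proof (intro sum.cong refl)
    fix l assume "l \<in> {..<k}"
    have "(\<Sum>j<d. b p (gg l j) * b q (gg l j))
      = (\<sigma> * \<sigma>) * ((enorm (n l) (\<beta> p l) * enorm (n l) (\<beta> q l)) * dotp d (\<alpha> p l) (\<alpha> q l))"
      by (simp only: dotp_def sum_distrib_left) (simp add: b_def mult_ac)
    moreover have "(\<Sum>i<n l. b p (hh l i) * b q (hh l i))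
      = (\<sigma> * \<sigma>) * (dotp (n l) (\<beta> p l) (\<beta> q l) * (enorm d (\<alpha> p l) * enorm d (\<alpha> q l)))"
      by (simp only: dotp_def sum_distrib_left sum_distrib_right) (simp add: b_def mult_ac)
    ultimately show "(\<Sum>i<n l. \<Sum>j<d. b p (GG l i j) * b q (GG l i j)) + (\<Sum>j<d. b p (gg l j) * b q (gg l j))
          + (\<Sum>i<n l. b p (hh l i) * b q (hh l i))
        = (enorm (n l) (\<beta> p l) * enorm (n l) (\<beta> q l)) * dotp d (\<alpha> p l) (\<alpha> q l)
          + dotp (n l) (\<beta> p l) (\<beta> q l) * (enorm d (\<alpha> p l) * enorm d (\<alpha> q l))"
      by (simp add: \<sigma>) (simp add: b_def)
  qed
  have "prob {\<omega>\<in>space M. \<exists>w\<in>W. \<forall>v\<in>V. u (w, v) + (\<Sum>x\<in>I. a (w, v) x * X x \<omega>) < 0}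
    \<le> 2 ^ card K * prob {\<omega>\<in>space M. \<exists>w\<in>W. \<forall>v\<in>V. u (w, v) + (\<Sum>x\<in>I. b (w, v) x * X x \<omega>) \<le> 0}"
  proof (rule gordon_comparison[OF I(1) K(1) fin I(2) K(2)])
    show "indep_vars (\<lambda>_. borel) X I" "\<And>i. i \<in> I \<Longrightarrow> distributed M lborel (X i) std_normal_density"
      using indep normal by (simp_all add: I_def)
    show "0 \<le> a p x" if "x \<in> K" for p x
      using that by (auto simp: K_def a_def enorm_nonneg)
    fix p q :: "'w \<times> 'v"
    let ?x = "\<lambda>l. enorm (n l) (\<beta> p l) * enorm (n l) (\<beta> q l)" and ?y = "\<lambda>l. enorm d (\<alpha> p l) * enorm d (\<alpha> q l)"
    let ?r = "\<lambda>l. dotp (n l) (\<beta> p l) (\<beta> q l)" and ?s = "\<lambda>l. dotp d (\<alpha> p l) (\<alpha> q l)"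
    show "(\<Sum>x\<in>I. b p x * b q x) \<le> (\<Sum>x\<in>I \<union> K. a p x * a q x)"
      unfolding aa bb
    proof (rule sum_mono)
      fix l
      \<comment> \<open>This product is the \<open>l\<close>-th term of the covariance difference.
        If one of the two vectors is the same for \<open>p\<close> and \<open>q\<close>, one factor
        vanishes.\<close>
      have "0 \<le> (?x l - ?r l) * (?y l - ?s l)"
        using dotp_le_enorm by (intro mult_nonneg_nonneg) auto
      then show "?x l * ?s l + ?r l * ?y l \<le> ?r l * ?s l + ?x l * ?y l" by (simp add: algebra_simps)
    qed
    show "(\<Sum>x\<in>I. b p x * b q x) = (\<Sum>x\<in>I \<union> K. a p x * a q x)" if "fst p = fst q"
      unfolding aa bb using same[OF that] by (auto simp: dotp_self intro!: sum.cong)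
  qed
  moreover have "(\<Sum>x\<in>I. a p x * X x \<omega>) = \<sigma> * (\<Sum>l<k. \<Sum>i<n l. \<Sum>j<d. \<beta> p l i * X (GG l i j) \<omega> * \<alpha> p l j)" for p \<omega>
    unfolding I_def sum_gindices sum_distrib_left
    by (auto simp: a_def mult_ac intro!: sum.cong)
  moreover have "(\<Sum>x\<in>I. b p x * X x \<omega>) = \<sigma> * (\<Sum>l<k.
        enorm (n l) (\<beta> p l) * dotp d (\<lambda>j. X (gg l j) \<omega>) (\<alpha> p l)
        + enorm d (\<alpha> p l) * dotp (n l) (\<lambda>i. X (hh l i) \<omega>) (\<beta> p l))" for p \<omega>
    unfolding I_def sum_gindices dotp_def distrib_left sum_distrib_left
    by (auto simp: b_def mult_ac intro!: sum.cong arg_cong2[where f = "(+)"])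
  ultimately show ?thesis by (simp only: K(3))
qed

section \<open>Continuity, compactness and convexity of the data\<close>

lemma affmap_combination:
  "affmap n M m ((1 - t) *\<^sub>R x + t *\<^sub>R y) i = (1 - t) * affmap n M m x i + t * affmap n M m y i"
  by (simp add: affmap_def plus_fun_def scaleR_fun_def sum.distrib sum_distrib_left algebra_simps sum_subtractf)

lemma continuous_on_affmap:
  assumes "continuous_on S f"
  shows "continuous_on S (\<lambda>z. affmap n M m (f z) i)"
proof -
  have "continuous_on S (\<lambda>z. f z j)" for j
    using assms by (rule continuous_on_product_then_coordinatewise)
  then show ?thesis
    unfolding affmap_def by (cases "i < n") (auto intro!: continuous_intros)
qed

lemma continuous_on_enorm:
  assumes "\<And>i. continuous_on S (\<lambda>z. f z i)"
  shows "continuous_on S (\<lambda>z. enorm n (f z))"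
  unfolding enorm_def by (intro continuous_intros assms)

lemma continuous_on_dotp:
  assumes "\<And>i. continuous_on S (\<lambda>z. f z i)"
  shows "continuous_on S (\<lambda>z. dotp n x (f z))"
  unfolding dotp_def by (intro continuous_intros assms)

lemma compact_PiE_UNIV:
  fixes S :: "'i \<Rightarrow> 'b::topological_space set"
  assumes "\<And>i. compact (S i)"
  shows "compact (Pi\<^sub>E UNIV S)"
  using assms compactin_PiE[of "\<lambda>_. euclidean" UNIV S]
  by (simp flip: compactin_euclidean_iff add: euclidean_product_topology)

text \<open>Coordinates from \<open>k\<close> on are pinned to 0, so the set is a full product over
  the naturals with singleton factors, and Tychonoff's theorem applies to the product topology on
  functions.\<close>

lemma compact_prodset:
  assumes "\<And>l. l < k \<Longrightarrow> compact (S l)"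
  shows "compact (prodset k S)"
proof -
  have "prodset k S = Pi\<^sub>E UNIV (\<lambda>l. if l < k then S l else {0})"
    by (auto simp: prodset_def PiE_UNIV_domain Pi_iff split: if_splits)
  then show ?thesis using assms by (auto intro: compact_PiE_UNIV)
qed

lemma convex_prodset:
  assumes "\<And>l. l < k \<Longrightarrow> convex (S l)"
  shows "convex (prodset k S)"
  using assms unfolding prodset_def convex_alt
  by (auto simp: plus_fun_def scaleR_fun_def zero_fun_def)

text \<open>The real infimum is by definition the negated supremum of the negated set, so the
  identity holds for arbitrary sets and functions.\<close>

lemma minmax_uminus: "minmax T S (\<lambda>y x. - f x y) = - (SUP y\<in>T. INF x\<in>S. f x y)"
  by (simp add: minmax_def Inf_real_def image_image)


theorem theorem4p2:
  fixes k d :: nat and n :: "nat \<Rightarrow> nat"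
    and Sw :: "(nat \<Rightarrow> real) set" and Svl :: "nat \<Rightarrow> (nat \<Rightarrow> real) set"
    and \<psi> :: "(nat \<Rightarrow> real) \<Rightarrow> (nat \<Rightarrow> nat \<Rightarrow> real) \<Rightarrow> real"
    and A :: "nat \<Rightarrow> nat \<Rightarrow> nat \<Rightarrow> real" and a :: "nat \<Rightarrow> nat \<Rightarrow> real"
    and B :: "nat \<Rightarrow> nat \<Rightarrow> nat \<Rightarrow> real" and b :: "nat \<Rightarrow> nat \<Rightarrow> real"
    and M :: "'s measure" and X :: "gidx \<Rightarrow> 's \<Rightarrow> real"
    and c \<eta> :: real
  assumes "k \<ge> 1" and "d \<ge> 1" and "\<forall>l<k. n l \<ge> 1"
    and "Sw \<subseteq> vecs d" and "compact Sw" and "convex Sw"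
    and "\<forall>l<k. Svl l \<subseteq> vecs (n l) \<and> compact (Svl l) \<and> convex (Svl l)"
    and "continuous_on (Sw \<times> prodset k Svl) (\<lambda>(w, v). \<psi> w v)"
    and "\<forall>v\<in>prodset k Svl. convex_on Sw (\<lambda>w. \<psi> w v)"
    and "\<forall>w\<in>Sw. concave_on (prodset k Svl) (\<lambda>v. \<psi> w v)"
    and "prob_space M"
    and "prob_space.indep_vars M (\<lambda>_. borel) X (gindices k d n)"
    and "\<forall>i\<in>gindices k d n. distributed M lborel (X i) std_normal_density"
    and "\<eta> > 0"
  shows
    "measure M {\<omega> \<in> space M.
        \<bar>(INF w\<in>Sw. SUP v\<in>prodset k Svl.
            (\<Sum>l<k. \<Sum>i<n l. \<Sum>j<d.
               affmap (n l) (B l) (b l) (v l) i * X (GG l i j) \<omega> * affmap d (A l) (a l) w j)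
            + \<psi> w v) - c\<bar> > \<eta>}
     \<le> 2 ^ k * measure M {\<omega> \<in> space M.
        \<bar>(INF w\<in>Sw. SUP v\<in>prodset k Svl.
            (\<Sum>l<k.
               enorm (n l) (affmap (n l) (B l) (b l) (v l))
                 * dotp d (\<lambda>j. X (gg l j) \<omega>) (affmap d (A l) (a l) w)
               + enorm d (affmap d (A l) (a l) w)
                 * dotp (n l) (\<lambda>i. X (hh l i) \<omega>) (affmap (n l) (B l) (b l) (v l)))
            + \<psi> w v) - c\<bar> > \<eta>}"
proof -
  interpret prob_space M by fact
  let ?T = "prodset k Svl"
  let ?\<alpha> = "\<lambda>w l. affmap d (A l) (a l) w" and ?\<beta> = "\<lambda>v l. affmap (n l) (B l) (b l) (v l)"
  define P where "P w v \<omega> = (\<Sum>l<k. \<Sum>i<n l. \<Sum>j<d. ?\<beta> v l i * X (GG l i j) \<omega> * ?\<alpha> w l j)" for w v \<omega>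
  define Q where "Q w v \<omega> = (\<Sum>l<k. enorm (n l) (?\<beta> v l) * dotp d (\<lambda>j. X (gg l j) \<omega>) (?\<alpha> w l)
      + enorm d (?\<alpha> w l) * dotp (n l) (\<lambda>i. X (hh l i) \<omega>) (?\<beta> v l))" for w v \<omega>
  define \<Phi> where "\<Phi> \<omega> = minmax Sw ?T (\<lambda>w v. P w v \<omega> + \<psi> w v)" for \<omega>
  define \<phi> where "\<phi> \<omega> = minmax Sw ?T (\<lambda>w v. Q w v \<omega> + \<psi> w v)" for \<omega>
  have "prob {\<omega> \<in> space M. \<bar>\<Phi> \<omega> - c\<bar> > \<eta>} \<le> 2 ^ k * prob {\<omega> \<in> space M. \<bar>\<phi> \<omega> - c\<bar> > \<eta>}"
  proof (cases "Sw = {} \<or> ?T = {}")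
    \<comment> \<open>If one of the sets is empty, both values are the same conventional infimum or
      supremum over the empty set, and the claim reduces to 1 being at most
      \<open>2 ^ k\<close>.\<close>
    case True
    then have "\<Phi> = \<phi>" by (auto simp: \<Phi>_def[abs_def] \<phi>_def[abs_def] minmax_def)
    moreover have "1 * prob {\<omega> \<in> space M. \<bar>\<phi> \<omega> - c\<bar> > \<eta>} \<le> 2 ^ k * prob {\<omega> \<in> space M. \<bar>\<phi> \<omega> - c\<bar> > \<eta>}"
      by (intro mult_right_mono) auto
    ultimately show ?thesis by simp
  next
    case False
    then have ne: "Sw \<noteq> {}" "?T \<noteq> {}" by auto
    have cT: "compact ?T" and vT: "convex ?T"
      using assms(7) by (auto intro: compact_prodset convex_prodset)
    have X: "X i \<in> borel_measurable M" if "i \<in> gindices k d n" for i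
      using distributed_measurable[of M lborel "X i"] assms(13) that by auto
    have mP: "P w v \<in> borel_measurable M" for w v
      unfolding P_def[abs_def]
      by (intro borel_measurable_sum borel_measurable_times borel_measurable_const X) (auto simp: gindices_def)
    have mQ: "Q w v \<in> borel_measurable M" for w v
      unfolding Q_def[abs_def] dotp_def
      by (intro borel_measurable_sum borel_measurable_add borel_measurable_times borel_measurable_const X)
        (auto simp: gindices_def)
    have c\<alpha>: "continuous_on (Sw \<times> ?T) (\<lambda>z. ?\<alpha> (fst z) l j)" for l j
      by (intro continuous_on_affmap continuous_intros)
    have c\<beta>: "continuous_on (Sw \<times> ?T) (\<lambda>z. ?\<beta> (snd z) l i)" for l i
      by (rule continuous_on_affmap[OF continuous_on_product_then_coordinatewise[OF continuous_on_snd[OF continuous_on_id]]])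
    have c\<psi>: "continuous_on (Sw \<times> ?T) (\<lambda>z. \<psi> (fst z) (snd z))"
      using assms(8) by (simp add: split_beta)
    have cP: "continuous_on (Sw \<times> ?T) (\<lambda>(w, v). P w v \<omega> + \<psi> w v)" for \<omega>
      unfolding P_def split_beta by (intro continuous_intros c\<alpha> c\<beta> c\<psi>)
    have cQ: "continuous_on (Sw \<times> ?T) (\<lambda>(w, v). Q w v \<omega> + \<psi> w v)" for \<omega>
      unfolding Q_def split_beta
      by (intro continuous_intros continuous_on_enorm continuous_on_dotp c\<alpha> c\<beta> c\<psi>)
    have swap: "continuous_on (?T \<times> Sw) (\<lambda>(v, w). - f w v)" if "continuous_on (Sw \<times> ?T) (\<lambda>(w, v). f w v)"
      for f :: "(nat \<Rightarrow> real) \<Rightarrow> (nat \<Rightarrow> nat \<Rightarrow> real) \<Rightarrow> real"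
    proof -
      have "continuous_on (?T \<times> Sw) (\<lambda>z. (\<lambda>(w, v). f w v) (snd z, fst z))"
        by (rule continuous_on_compose2[OF that])
          (auto intro!: continuous_on_Pair continuous_on_fst continuous_on_snd continuous_on_id)
      then show ?thesis by (auto simp: split_beta intro: continuous_on_minus)
    qed
    interpret P: random_minmax M Sw ?T "\<lambda>w v \<omega>. P w v \<omega> + \<psi> w v"
      by unfold_locales (use assms cT ne cP mP in auto)
    interpret Q: random_minmax M Sw ?T "\<lambda>w v \<omega>. Q w v \<omega> + \<psi> w v"
      by unfold_locales (use assms cT ne cQ mQ in auto)
    interpret P': random_minmax M ?T Sw "\<lambda>v w \<omega>. - (P w v \<omega> + \<psi> w v)"
      by unfold_locales (use assms cT ne swap[OF cP] mP in auto)
    interpret Q': random_minmax M ?T Sw "\<lambda>v w \<omega>. - (Q w v \<omega> + \<psi> w v)"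
      by unfold_locales (use assms cT ne swap[OF cQ] mQ in auto)
    note cmp = gaussian_form_comparison[OF \<open>k \<ge> 1\<close> \<open>d \<ge> 1\<close> assms(12) bspec[OF assms(13)]]
    have lower: "prob {\<omega>\<in>space M. \<Phi> \<omega> < r} \<le> 2 ^ k * prob {\<omega>\<in>space M. \<phi> \<omega> < r}" for r
      unfolding \<Phi>_def \<phi>_def
    proof (rule minmax_comparison[OF P.random_minmax_axioms Q.random_minmax_axioms])
      fix W :: "(nat \<Rightarrow> real) set" and V :: "(nat \<Rightarrow> nat \<Rightarrow> real) set" and r :: real
      assume "finite W" "finite V"
      \<comment> \<open>The minimiser is \<open>w\<close>, so equal first components force equal
        \<open>\<alpha>\<close>; the threshold is absorbed into the deterministic part.\<close>
      from cmp[OF _ this, of 1 "\<lambda>p l. ?\<alpha> (fst p) l" "\<lambda>p l. ?\<beta> (snd p) l" "\<lambda>p. \<psi> (fst p) (snd p) - r"]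
      show "prob {\<omega>\<in>space M. \<exists>w\<in>W. \<forall>v\<in>V. P w v \<omega> + \<psi> w v < r}
        \<le> 2 ^ k * prob {\<omega>\<in>space M. \<exists>w\<in>W. \<forall>v\<in>V. Q w v \<omega> + \<psi> w v \<le> r}"
        by (simp add: P_def Q_def algebra_simps)
    qed simp
    have "prob {\<omega>\<in>space M. minmax ?T Sw (\<lambda>v w. - (P w v \<omega> + \<psi> w v)) < r}
      \<le> 2 ^ k * prob {\<omega>\<in>space M. minmax ?T Sw (\<lambda>v w. - (Q w v \<omega> + \<psi> w v)) < r}" for r
    proof (rule minmax_comparison[OF P'.random_minmax_axioms Q'.random_minmax_axioms])
      fix V :: "(nat \<Rightarrow> nat \<Rightarrow> real) set" and W :: "(nat \<Rightarrow> real) set" and r :: real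
      assume "finite V" "finite W"
      \<comment> \<open>In the negated game \<open>v\<close> minimises, so equal first components
        force equal \<open>\<beta>\<close>, and \<sigma> is -1.\<close>
      from cmp[OF _ this, of "- 1" "\<lambda>p l. ?\<alpha> (snd p) l" "\<lambda>p l. ?\<beta> (fst p) l" "\<lambda>p. - \<psi> (snd p) (fst p) - r"]
      show "prob {\<omega>\<in>space M. \<exists>v\<in>V. \<forall>w\<in>W. - (P w v \<omega> + \<psi> w v) < r}
        \<le> 2 ^ k * prob {\<omega>\<in>space M. \<exists>v\<in>V. \<forall>w\<in>W. - (Q w v \<omega> + \<psi> w v) \<le> r}"
        by (simp add: P_def Q_def algebra_simps)
    qed simp
    \<comment> \<open>Here convexity enters: the form \<open>P\<close> is affine in each argument,
      so adding it to \<open>\<psi>\<close> keeps the sum convex-concave and the minimax theorem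
      applies for each outcome.\<close>
    moreover have "minmax ?T Sw (\<lambda>v w. - (P w v \<omega> + \<psi> w v)) = - \<Phi> \<omega>" for \<omega>
    proof -
      obtain K where K: "\<And>w v. w \<in> Sw \<Longrightarrow> v \<in> ?T \<Longrightarrow> \<bar>P w v \<omega> + \<psi> w v\<bar> \<le> K"
        using continuous_bounded[OF \<open>compact Sw\<close> cT cP] by blast
      have Pw: "P ((1 - t) *\<^sub>R w + t *\<^sub>R w') v \<omega> = (1 - t) * P w v \<omega> + t * P w' v \<omega>" for t w w' v
        unfolding P_def affmap_combination
        by (simp add: sum_distrib_left sum.distrib[symmetric] algebra_simps)
      have Pv: "P w ((1 - t) *\<^sub>R v + t *\<^sub>R v') \<omega> = (1 - t) * P w v \<omega> + t * P w v' \<omega>" for t v v' w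
      proof -
        have "((1 - t) *\<^sub>R v + t *\<^sub>R v') l = (1 - t) *\<^sub>R v l + t *\<^sub>R v' l" for l
          by (simp add: plus_fun_def scaleR_fun_def)
        then show ?thesis
          unfolding P_def by (simp only: affmap_combination)
            (simp add: sum_distrib_left sum.distrib[symmetric] algebra_simps)
      qed
      have "(INF w\<in>Sw. SUP v\<in>?T. P w v \<omega> + \<psi> w v) = (SUP v\<in>?T. INF w\<in>Sw. P w v \<omega> + \<psi> w v)"
      proof (rule convex_concave_minimax[OF \<open>compact Sw\<close> \<open>convex Sw\<close> vT ne])
        fix v assume v: "v \<in> ?T"
        have "continuous_on Sw (\<lambda>w. (\<lambda>(w, v). P w v \<omega> + \<psi> w v) (w, v))"
          by (rule continuous_on_compose2[OF cP]) (use v in \<open>auto intro!: continuous_intros\<close>)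
        then show "continuous_on Sw (\<lambda>w. P w v \<omega> + \<psi> w v)" by simp
        have \<psi>: "convex_on Sw (\<lambda>w. \<psi> w v)" using assms(9) v by blast
        show "convex_on Sw (\<lambda>w. P w v \<omega> + \<psi> w v)"
        proof (rule convex_onI)
          fix t :: real and w w' assume "0 < t" "t < 1" "w \<in> Sw" "w' \<in> Sw"
          then show "P ((1 - t) *\<^sub>R w + t *\<^sub>R w') v \<omega> + \<psi> ((1 - t) *\<^sub>R w + t *\<^sub>R w') v
            \<le> (1 - t) * (P w v \<omega> + \<psi> w v) + t * (P w' v \<omega> + \<psi> w' v)"
            using convex_onD[OF \<psi>, of t w w'] unfolding Pw by (simp add: algebra_simps)
        qed fact
      next
        fix w assume w: "w \<in> Sw"
        have \<psi>: "concave_on ?T (\<lambda>v. \<psi> w v)" using assms(10) w by blast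
        show "concave_on ?T (\<lambda>v. P w v \<omega> + \<psi> w v)"
          unfolding concave_on_def
        proof (rule convex_onI)
          fix t :: real and v v' assume "0 < t" "t < 1" "v \<in> ?T" "v' \<in> ?T"
          then show "- (P w ((1 - t) *\<^sub>R v + t *\<^sub>R v') \<omega> + \<psi> w ((1 - t) *\<^sub>R v + t *\<^sub>R v'))
            \<le> (1 - t) * - (P w v \<omega> + \<psi> w v) + t * - (P w v' \<omega> + \<psi> w v')"
            using concave_onD[OF \<psi>, of t v v'] unfolding Pv by (simp add: algebra_simps)
        qed (rule vT)
      qed (rule K)
      then show ?thesis by (simp only: minmax_uminus \<Phi>_def) (simp add: minmax_def)
    qed
    \<comment> \<open>In \<open>Q\<close> norms are multiplied by Gaussian quantities of either
      sign, so convexity may fail. Weak duality suffices: a small value of the negated game forces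
      \<open>\<phi>\<close> to be large.\<close>
    moreover have "- \<phi> \<omega> \<le> minmax ?T Sw (\<lambda>v w. - (Q w v \<omega> + \<psi> w v))" for \<omega>
    proof -
      obtain K where K: "\<And>w v. w \<in> Sw \<Longrightarrow> v \<in> ?T \<Longrightarrow> \<bar>Q w v \<omega> + \<psi> w v\<bar> \<le> K"
        using continuous_bounded[OF \<open>compact Sw\<close> cT cQ] by blast
      have "(SUP v\<in>?T. INF w\<in>Sw. Q w v \<omega> + \<psi> w v) \<le> (INF w\<in>Sw. SUP v\<in>?T. Q w v \<omega> + \<psi> w v)"
        by (rule SUP_INF_le_INF_SUP[OF ne K])
      then show ?thesis by (simp only: minmax_uminus \<phi>_def) (simp add: minmax_def)
    qed
    ultimately have up: "prob {\<omega>\<in>space M. - \<Phi> \<omega> < r}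
        \<le> 2 ^ k * prob {\<omega>\<in>space M. minmax ?T Sw (\<lambda>v w. - (Q w v \<omega> + \<psi> w v)) < r}"
      and Q_le: "- \<phi> \<omega> \<le> minmax ?T Sw (\<lambda>v w. - (Q w v \<omega> + \<psi> w v))" for r \<omega>
      by simp_all
    have [measurable]: "\<Phi> \<in> borel_measurable M" "\<phi> \<in> borel_measurable M"
      using P.measurable_minmax Q.measurable_minmax by (simp_all add: \<Phi>_def[abs_def] \<phi>_def[abs_def])
    have upper: "prob {\<omega>\<in>space M. \<Phi> \<omega> > r} \<le> 2 ^ k * prob {\<omega>\<in>space M. \<phi> \<omega> > r}" for r
    proof -
      have "prob {\<omega>\<in>space M. minmax ?T Sw (\<lambda>v w. - (Q w v \<omega> + \<psi> w v)) < - r}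
        \<le> prob {\<omega>\<in>space M. \<phi> \<omega> > r}"
      proof (intro finite_measure_mono subsetI)
        fix \<omega> assume "\<omega> \<in> {\<omega>\<in>space M. minmax ?T Sw (\<lambda>v w. - (Q w v \<omega> + \<psi> w v)) < - r}"
        then show "\<omega> \<in> {\<omega>\<in>space M. \<phi> \<omega> > r}" unfolding mem_Collect_eq using Q_le[of \<omega>] by linarith
      qed measurable
      then have "2 ^ k * prob {\<omega>\<in>space M. minmax ?T Sw (\<lambda>v w. - (Q w v \<omega> + \<psi> w v)) < - r}
        \<le> 2 ^ k * prob {\<omega>\<in>space M. \<phi> \<omega> > r}" by (intro mult_left_mono) auto
      from order_trans[OF up[of "- r"] this] show ?thesis by simp
    qed
    have "prob {\<omega> \<in> space M. \<bar>\<Phi> \<omega> - c\<bar> > \<eta>}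
      \<le> prob ({\<omega>\<in>space M. \<Phi> \<omega> < c - \<eta>} \<union> {\<omega>\<in>space M. \<Phi> \<omega> > c + \<eta>})"
      by (intro finite_measure_mono) auto
    also have "\<dots> \<le> prob {\<omega>\<in>space M. \<Phi> \<omega> < c - \<eta>} + prob {\<omega>\<in>space M. \<Phi> \<omega> > c + \<eta>}"
      by (intro measure_Un_le) auto
    also have "\<dots> \<le> 2 ^ k * (prob {\<omega>\<in>space M. \<phi> \<omega> < c - \<eta>} + prob {\<omega>\<in>space M. \<phi> \<omega> > c + \<eta>})"
      using lower upper by (simp add: distrib_left add_mono)
    \<comment> \<open>Since \<eta> is positive the two tails are disjoint and their probabilities
      add up exactly, which keeps the constant at \<open>2 ^ k\<close>.\<close>
    also have "prob {\<omega>\<in>space M. \<phi> \<omega> < c - \<eta>} + prob {\<omega>\<in>space M. \<phi> \<omega> > c + \<eta>}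
      = prob ({\<omega>\<in>space M. \<phi> \<omega> < c - \<eta>} \<union> {\<omega>\<in>space M. \<phi> \<omega> > c + \<eta>})"
      using \<open>\<eta> > 0\<close> by (intro finite_measure_Union[symmetric]) auto
    also have "{\<omega>\<in>space M. \<phi> \<omega> < c - \<eta>} \<union> {\<omega>\<in>space M. \<phi> \<omega> > c + \<eta>} = {\<omega> \<in> space M. \<bar>\<phi> \<omega> - c\<bar> > \<eta>}"
      by auto
    finally show ?thesis .
  qed
  then show ?thesis by (simp only: \<Phi>_def \<phi>_def minmax_def P_def Q_def)
qed

end
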